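(* Over $I\Sigma_1$, $\mathsf{BME}_*$ proves the totality of the Ackermann–Péter function, i.e. $I\Sigma_1+\mathsf{BME}_*\vdash\forall m\,\forall n\,\exists k\,\phi_A(m,n,k)$, where $\phi_A(m,n,k)$ is the natural $\Sigma_1$-formula defining the graph of the Ackermann–Péter function $A$.
   Context: The Ackermann–Péter function: $A(0,n)=n+1$, $A(m,0)=A(m-1,1)$ for $m>0$, $A(m,n)=A(m-1,A(m,n-1))$ for $m,n>0$; $\phi_A(m,n,k)$ is the $\Sigma_1$-formula expressing $A(m,n)=k$ via a coded finite computation. $I\Sigma_1$ is Peano arithmetic without induction plus $\Sigma_1$-induction. $\mathsf{BME}_*$ (finite sequences of naturals and finite sets of them coded by numbers): let $E$ be a function defined by a quantifier-free formula, $E[s]$ regarded as a finite set of finite sequences, with $E[s]\subseteq E[s+1]$; $\tau$ is enumerated at stage $s$ if $\tau\in E[s]\setminus E[s-1]$; the tree enumerated by $E$ is $\{\tau:\exists s\,\exists\sigma\in E[s]\ (\tau\preceq\sigma)\}$ ($\preceq$ = initial segment). $E$ is a monotone enumeration if (1) $\langle\rangle$ is enumerated at the first stage, (2) at each stage finitely many sequences are enumerated, (3) whenever $\tau$ is enumerated at stage $s$ and $\tau_0$ is the longest initial segment of $\tau$ enumerated at a stage prior to $s$, then (a) no extension of $\tau_0$ was enumerated before stage $s$, and (b) all sequences enumerated at stage $s$ extend $\tau_0$. The stage-by-stage sequence of $\tau$ is obtained by repeatedly passing to the longest initial segment enumerated at an earlier stage, from $\tau$ down to $\langle\rangle$; $E$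 is bounded by $b$ if every stage-by-stage sequence of an element of $E$ has length at most $b$. $\mathsf{BME}_*$ states: for every monotone enumeration $E$ and every $b$, if $E$ is bounded by $b$ then the tree enumerated by $E$ is finite. *)

theory Defs
  imports Main
begin

section \<open>First-order logic over the language \<open>0, S, +, \<cdot>, <\<close>\<close>

text \<open>Variables are de Bruijn indices.\<close>

datatype tm = Var nat | Zero | Succ tm | Plus tm tm | Times tm tm

datatype fm = Eq tm tm | Less tm tm | Fls | Imp fm fm | Forall fm

notation Plus (infixl "\<^bold>+" 65)
notation Times (infixl "\<^bold>*" 70)
notation Eq (infix "\<^bold>=" 50)
notation Less (infix "\<^bold><" 50)
notation Imp (infixr "\<^bold>\<rightarrow>" 25)

definition Neg :: "fm \<Rightarrow> fm" ("\<^bold>\<not> _" [40] 40)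
  where "(\<^bold>\<not> \<phi>) = (\<phi> \<^bold>\<rightarrow> Fls)"

definition Disj :: "fm \<Rightarrow> fm \<Rightarrow> fm" (infixr "\<^bold>\<or>" 30)
  where "(\<phi> \<^bold>\<or> \<psi>) = (\<^bold>\<not> \<phi> \<^bold>\<rightarrow> \<psi>)"

definition Conj :: "fm \<Rightarrow> fm \<Rightarrow> fm" (infixr "\<^bold>\<and>" 35)
  where "(\<phi> \<^bold>\<and> \<psi>) = (\<^bold>\<not> (\<phi> \<^bold>\<rightarrow> \<^bold>\<not> \<psi>))"

definition Iff :: "fm \<Rightarrow> fm \<Rightarrow> fm" (infixr "\<^bold>\<leftrightarrow>" 25)
  where "(\<phi> \<^bold>\<leftrightarrow> \<psi>) = ((\<phi> \<^bold>\<rightarrow> \<psi>) \<^bold>\<and> (\<psi> \<^bold>\<rightarrow> \<phi>))"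

definition Exists :: "fm \<Rightarrow> fm"
  where "Exists \<phi> = (\<^bold>\<not> Forall (\<^bold>\<not> \<phi>))"

primrec subst_tm :: "(nat \<Rightarrow> tm) \<Rightarrow> tm \<Rightarrow> tm" where
  "subst_tm \<sigma> (Var n) = \<sigma> n"
| "subst_tm \<sigma> Zero = Zero"
| "subst_tm \<sigma> (Succ t) = Succ (subst_tm \<sigma> t)"
| "subst_tm \<sigma> (t \<^bold>+ u) = subst_tm \<sigma> t \<^bold>+ subst_tm \<sigma> u"
| "subst_tm \<sigma> (t \<^bold>* u) = subst_tm \<sigma> t \<^bold>* subst_tm \<sigma> u"

text \<open>\<open>up k t\<close> is \<open>t\<close> as written below \<open>k\<close> further quantifiers.\<close>

definition up :: "nat \<Rightarrow> tm \<Rightarrow> tm"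
  where "up k = subst_tm (\<lambda>n. Var (n + k))"

primrec subst :: "fm \<Rightarrow> (nat \<Rightarrow> tm) \<Rightarrow> fm" where
  "subst (t \<^bold>= u) \<sigma> = (subst_tm \<sigma> t \<^bold>= subst_tm \<sigma> u)"
| "subst (t \<^bold>< u) \<sigma> = (subst_tm \<sigma> t \<^bold>< subst_tm \<sigma> u)"
| "subst Fls \<sigma> = Fls"
| "subst (\<phi> \<^bold>\<rightarrow> \<psi>) \<sigma> = (subst \<phi> \<sigma> \<^bold>\<rightarrow> subst \<psi> \<sigma>)"
| "subst (Forall \<phi>) \<sigma> = Forall (subst \<phi> (case_nat (Var 0) (\<lambda>n. up 1 (\<sigma> n))))"

text \<open>Instantiation of the outermost bound variable of \<open>Forall \<phi>\<close>.\<close>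

definition inst :: "tm \<Rightarrow> fm \<Rightarrow> fm"
  where "inst t \<phi> = subst \<phi> (case_nat t Var)"

text \<open>Classical natural deduction with equality.\<close>

inductive prv :: "fm set \<Rightarrow> fm \<Rightarrow> bool" (infix "\<turnstile>" 20) where
  Assm: "\<phi> \<in> \<Gamma> \<Longrightarrow> \<Gamma> \<turnstile> \<phi>"
| ImpI: "insert \<phi> \<Gamma> \<turnstile> \<psi> \<Longrightarrow> \<Gamma> \<turnstile> \<phi> \<^bold>\<rightarrow> \<psi>"
| ImpE: "\<Gamma> \<turnstile> \<phi> \<^bold>\<rightarrow> \<psi> \<Longrightarrow> \<Gamma> \<turnstile> \<phi> \<Longrightarrow> \<Gamma> \<turnstile> \<psi>"
| Classical: "insert (\<^bold>\<not> \<phi>) \<Gamma> \<turnstile> Fls \<Longrightarrow> \<Gamma> \<turnstile> \<phi>"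
| AllI: "(\<lambda>\<psi>. subst \<psi> (\<lambda>n. Var (Suc n))) ` \<Gamma> \<turnstile> \<phi> \<Longrightarrow> \<Gamma> \<turnstile> Forall \<phi>"
| AllE: "\<Gamma> \<turnstile> Forall \<phi> \<Longrightarrow> \<Gamma> \<turnstile> inst t \<phi>"
| EqRefl: "\<Gamma> \<turnstile> t \<^bold>= t"
| EqSubst: "\<Gamma> \<turnstile> t \<^bold>= u \<Longrightarrow> \<Gamma> \<turnstile> inst t \<phi> \<Longrightarrow> \<Gamma> \<turnstile> inst u \<phi>"

text \<open>Forall free variables have an index below \<open>fv_bound\<close>.\<close>

primrec fv_bound_tm :: "tm \<Rightarrow> nat" where
  "fv_bound_tm (Var n) = Suc n"
| "fv_bound_tm Zero = 0"
| "fv_bound_tm (Succ t) = fv_bound_tm t"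
| "fv_bound_tm (t \<^bold>+ u) = max (fv_bound_tm t) (fv_bound_tm u)"
| "fv_bound_tm (t \<^bold>* u) = max (fv_bound_tm t) (fv_bound_tm u)"

primrec fv_bound :: "fm \<Rightarrow> nat" where
  "fv_bound (t \<^bold>= u) = max (fv_bound_tm t) (fv_bound_tm u)"
| "fv_bound (t \<^bold>< u) = max (fv_bound_tm t) (fv_bound_tm u)"
| "fv_bound Fls = 0"
| "fv_bound (\<phi> \<^bold>\<rightarrow> \<psi>) = max (fv_bound \<phi>) (fv_bound \<psi>)"
| "fv_bound (Forall \<phi>) = fv_bound \<phi> - 1"

definition univ_closure :: "fm \<Rightarrow> fm"
  where "univ_closure \<phi> = (Forall ^^ fv_bound \<phi>) \<phi>"


section \<open>The theory \<open>I\<Sigma>\<^sub>1\<close>\<close>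

definition BForall :: "tm \<Rightarrow> fm \<Rightarrow> fm"
  where "BForall t \<phi> = Forall (Var 0 \<^bold>< up 1 t \<^bold>\<rightarrow> \<phi>)"

definition BExists :: "tm \<Rightarrow> fm \<Rightarrow> fm"
  where "BExists t \<phi> = (\<^bold>\<not> BForall t (\<^bold>\<not> \<phi>))"

inductive delta0 :: "fm \<Rightarrow> bool" where
  "delta0 (t \<^bold>= u)"
| "delta0 (t \<^bold>< u)"
| "delta0 Fls"
| "delta0 \<phi> \<Longrightarrow> delta0 \<psi> \<Longrightarrow> delta0 (\<phi> \<^bold>\<rightarrow> \<psi>)"
| "delta0 \<phi> \<Longrightarrow> delta0 (BForall t \<phi>)"

inductive sigma1 :: "fm \<Rightarrow> bool" where
  "delta0 \<phi> \<Longrightarrow> sigma1 \<phi>"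
| "sigma1 \<phi> \<Longrightarrow> sigma1 (Exists \<phi>)"

text \<open>The Peano axioms without induction, with the definition of \<open><\<close>.\<close>

definition PA_basic :: "fm set" where
  "PA_basic = {
     Forall (\<^bold>\<not> Succ (Var 0) \<^bold>= Zero),
     Forall (Forall (Succ (Var 1) \<^bold>= Succ (Var 0) \<^bold>\<rightarrow> Var 1 \<^bold>= Var 0)),
     Forall (Var 0 \<^bold>+ Zero \<^bold>= Var 0),
     Forall (Forall (Var 1 \<^bold>+ Succ (Var 0) \<^bold>= Succ (Var 1 \<^bold>+ Var 0))),
     Forall (Var 0 \<^bold>* Zero \<^bold>= Zero),
     Forall (Forall (Var 1 \<^bold>* Succ (Var 0) \<^bold>= Var 1 \<^bold>* Var 0 \<^bold>+ Var 1)),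
     Forall (Forall (Var 1 \<^bold>< Var 0 \<^bold>\<leftrightarrow> Exists (Var 2 \<^bold>+ Succ (Var 0) \<^bold>= Var 1)))}"

text \<open>Induction on \<open>Var 0\<close>; the other free variables are parameters.\<close>

definition induction_ax :: "fm \<Rightarrow> fm" where
  "induction_ax \<phi> =
     (inst Zero \<phi> \<^bold>\<rightarrow>
      Forall (\<phi> \<^bold>\<rightarrow> subst \<phi> (case_nat (Succ (Var 0)) (\<lambda>n. Var (Suc n)))) \<^bold>\<rightarrow>
      Forall \<phi>)"

definition ISigma1 :: "fm set" where
  "ISigma1 = PA_basic \<union> {univ_closure (induction_ax \<phi>) |\<phi>. sigma1 \<phi>}"


section \<open>Coding of finite sequences and finite sets\<close>

definition leq :: "tm \<Rightarrow> tm \<Rightarrow> fm" (infix "\<^bold>\<le>" 50)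
  where "t \<^bold>\<le> u = (t \<^bold>< Succ u)"

text \<open>
  \<open>(x, y) \<mapsto> (x + y)\<^sup>2 + x\<close> is an injective (not surjective) pairing, as \<open>x \<le> x + y\<close>.
\<close>

definition pair :: "tm \<Rightarrow> tm \<Rightarrow> tm"
  where "pair x y = (x \<^bold>+ y) \<^bold>* (x \<^bold>+ y) \<^bold>+ x"

text \<open>
  The \<open>\<beta>\<close>-function: \<open>pair l (pair a b)\<close> codes the sequence of length \<open>l\<close> whose \<open>i\<close>-th entry is
  \<open>a mod (1 + (i + 1) b)\<close>.
\<close>

definition remainder :: "tm \<Rightarrow> tm \<Rightarrow> tm \<Rightarrow> fm" where
  "remainder a m x = (x \<^bold>< m \<^bold>\<and> BExists (Succ a) (up 1 a \<^bold>= Var 0 \<^bold>* up 1 m \<^bold>+ up 1 x))"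

definition has_length :: "tm \<Rightarrow> tm \<Rightarrow> fm" where
  "has_length c l =
     BExists (Succ c) (BExists (Succ (up 1 c)) (up 2 c \<^bold>= pair (up 2 l) (pair (Var 1) (Var 0))))"

definition entry :: "tm \<Rightarrow> tm \<Rightarrow> tm \<Rightarrow> fm" where
  "entry c i x =
     BExists (Succ c) (BExists (Succ (up 1 c)) (BExists (Succ (up 2 c))
       (up 3 c \<^bold>= pair (Var 2) (pair (Var 1) (Var 0))
        \<^bold>\<and> up 3 i \<^bold>< Var 2
        \<^bold>\<and> remainder (Var 1) (Succ (Succ (up 3 i) \<^bold>* Var 0)) (up 3 x))))"

definition same_sequence :: "tm \<Rightarrow> tm \<Rightarrow> fm" where
  "same_sequence c d =
     BExists (Succ c)
       (has_length (up 1 c) (Var 0) \<^bold>\<and> has_length (up 1 d) (Var 0)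
        \<^bold>\<and> BForall (Var 0) (BExists (Succ (up 2 c))
              (entry (up 3 c) (Var 1) (Var 0) \<^bold>\<and> entry (up 3 d) (Var 1) (Var 0))))"

text \<open>
  A sequence has many \<open>\<beta>\<close>-codes. Finite sequences are identified with their least codes, so that
  equality of sequences is equality of numbers.
\<close>

definition is_seq :: "tm \<Rightarrow> fm" where
  "is_seq c =
     (BExists (Succ c) (has_length (up 1 c) (Var 0))
      \<^bold>\<and> BForall c (\<^bold>\<not> same_sequence (up 1 c) (Var 0)))"

definition prefix :: "tm \<Rightarrow> tm \<Rightarrow> fm" where
  "prefix \<sigma> \<tau> =
     (is_seq \<sigma> \<^bold>\<and> is_seq \<tau>
      \<^bold>\<and> BExists (Succ \<sigma>) (BExists (Succ (up 1 \<tau>))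
           (has_length (up 2 \<sigma>) (Var 1) \<^bold>\<and> has_length (up 2 \<tau>) (Var 0) \<^bold>\<and> Var 1 \<^bold>\<le> Var 0
            \<^bold>\<and> BForall (Var 1) (BExists (Succ (up 3 \<sigma>))
                  (entry (up 4 \<sigma>) (Var 1) (Var 0) \<^bold>\<and> entry (up 4 \<tau>) (Var 1) (Var 0))))))"

definition not_longer :: "tm \<Rightarrow> tm \<Rightarrow> fm" where
  "not_longer \<sigma> \<tau> =
     BExists (Succ \<sigma>) (BExists (Succ (up 1 \<tau>))
       (has_length (up 2 \<sigma>) (Var 1) \<^bold>\<and> has_length (up 2 \<tau>) (Var 0) \<^bold>\<and> Var 1 \<^bold>\<le> Var 0))"

text \<open>
  A number \<open>e\<close> codes the finite set of the entries of the sequence with (any) code \<open>e\<close>, and the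
  empty set if it is no such code.
\<close>

definition member :: "tm \<Rightarrow> tm \<Rightarrow> fm" where
  "member x e = BExists (Succ e) (entry (up 1 e) (Var 0) (up 1 x))"


section \<open>Monotone enumerations\<close>

text \<open>
  A formula \<open>\<epsilon>\<close> represents a function \<open>E\<close> with parameters: \<open>E[Var 0] = Var 1\<close>, while
  \<open>Var 2, Var 3, \<dots>\<close> in \<open>\<epsilon>\<close> are the variables \<open>Var 0, Var 1, \<dots>\<close> of the context.
\<close>

definition value_is :: "fm \<Rightarrow> tm \<Rightarrow> tm \<Rightarrow> fm"
  where "value_is \<epsilon> s e = subst \<epsilon> (case_nat s (case_nat e Var))"

definition upE :: "nat \<Rightarrow> fm \<Rightarrow> fm"
  where "upE k \<epsilon> = subst \<epsilon> (case_nat (Var 0) (case_nat (Var 1) (\<lambda>n. Var (n + k + 2))))"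

text \<open>\<open>\<tau> \<in> E[s]\<close>\<close>

definition in_stage :: "fm \<Rightarrow> tm \<Rightarrow> tm \<Rightarrow> fm" where
  "in_stage \<epsilon> s \<tau> = Exists (value_is (upE 1 \<epsilon>) (up 1 s) (Var 0) \<^bold>\<and> member (up 1 \<tau>) (Var 0))"

text \<open>\<open>\<tau> \<in> E[s] - E[s - 1]\<close>. The first stage is \<open>0\<close>, with \<open>E[-1]\<close> empty.\<close>

definition enumerated_at :: "fm \<Rightarrow> tm \<Rightarrow> tm \<Rightarrow> fm" where
  "enumerated_at \<epsilon> s \<tau> =
     (in_stage \<epsilon> s \<tau>
      \<^bold>\<and> \<^bold>\<not> Exists (up 1 s \<^bold>= Succ (Var 0) \<^bold>\<and> in_stage (upE 1 \<epsilon>) (Var 0) (up 1 \<tau>)))"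

definition enumerated_before :: "fm \<Rightarrow> tm \<Rightarrow> tm \<Rightarrow> fm" where
  "enumerated_before \<epsilon> s \<tau> = BExists s (enumerated_at (upE 1 \<epsilon>) (Var 0) (up 1 \<tau>))"

text \<open>\<open>\<tau>\<^sub>0\<close> is the longest initial segment of \<open>\<tau>\<close> enumerated at a stage prior to \<open>s\<close>.\<close>

definition longest_before :: "fm \<Rightarrow> tm \<Rightarrow> tm \<Rightarrow> tm \<Rightarrow> fm" where
  "longest_before \<epsilon> s \<tau> \<tau>\<^sub>0 =
     (prefix \<tau>\<^sub>0 \<tau> \<^bold>\<and> enumerated_before \<epsilon> s \<tau>\<^sub>0
      \<^bold>\<and> Forall (prefix (Var 0) (up 1 \<tau>) \<^bold>\<and> enumerated_before (upE 1 \<epsilon>) (up 1 s) (Var 0)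
              \<^bold>\<rightarrow> not_longer (Var 0) (up 1 \<tau>\<^sub>0)))"

definition is_function :: "fm \<Rightarrow> fm" where
  "is_function \<epsilon> =
     Forall (Exists (value_is (upE 2 \<epsilon>) (Var 1) (Var 0)
              \<^bold>\<and> Forall (value_is (upE 3 \<epsilon>) (Var 2) (Var 0) \<^bold>\<rightarrow> Var 0 \<^bold>= Var 1)))"

definition increasing_sets_of_seqs :: "fm \<Rightarrow> fm" where
  "increasing_sets_of_seqs \<epsilon> =
     Forall (Forall (in_stage (upE 2 \<epsilon>) (Var 1) (Var 0)
               \<^bold>\<rightarrow> is_seq (Var 0) \<^bold>\<and> in_stage (upE 2 \<epsilon>) (Succ (Var 1)) (Var 0)))"

text \<open>
  In the last conjunct \<open>Var 2, Var 1, Var 0\<close> are \<open>s, \<tau>, \<tau>\<^sub>0\<close>. In clause (a) an extension is a proper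
  one, since \<open>\<tau>\<^sub>0\<close> itself was enumerated before stage \<open>s\<close>.
\<close>

definition monotone_enumeration :: "fm \<Rightarrow> fm" where
  "monotone_enumeration \<epsilon> =
     (is_function \<epsilon> \<^bold>\<and> increasing_sets_of_seqs \<epsilon>
      \<^bold>\<and> Exists (is_seq (Var 0) \<^bold>\<and> has_length (Var 0) Zero \<^bold>\<and> enumerated_at (upE 1 \<epsilon>) Zero (Var 0))
      \<^bold>\<and> Forall (Exists (Forall (enumerated_at (upE 3 \<epsilon>) (Var 2) (Var 0) \<^bold>\<rightarrow> member (Var 0) (Var 1))))
      \<^bold>\<and> Forall (Forall (Forall
           (enumerated_at (upE 3 \<epsilon>) (Var 2) (Var 1)
            \<^bold>\<and> longest_before (upE 3 \<epsilon>) (Var 2) (Var 1) (Var 0)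
            \<^bold>\<rightarrow> \<^bold>\<not> Exists (prefix (Var 1) (Var 0) \<^bold>\<and> \<^bold>\<not> Var 0 \<^bold>= Var 1
                      \<^bold>\<and> enumerated_before (upE 4 \<epsilon>) (Var 3) (Var 0))
               \<^bold>\<and> Forall (enumerated_at (upE 4 \<epsilon>) (Var 3) (Var 0) \<^bold>\<rightarrow> prefix (Var 1) (Var 0))))))"

text \<open>
  \<open>c\<close> is the stage-by-stage sequence of the enumerated \<open>\<tau>\<close>: it starts with \<open>\<tau>\<close>, passes from each
  entry to its longest initial segment enumerated at an earlier stage than the entry, and ends only
  when there is none. The last entry is then \<open>\<langle>\<rangle>\<close>, or another sequence enumerated at stage \<open>0\<close>
  together with \<open>\<langle>\<rangle>\<close>. (Asking for the last entry to be \<open>\<langle>\<rangle>\<close> would leave sequences above one of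
  the latter kind without any stage-by-stage sequence, and boundedness would not constrain them.)
  The first quantifier is the length; in the third conjunct \<open>Var 3, \<dots>, Var 0\<close> are \<open>i\<close>, the \<open>i\<close>-th
  entry, the next entry, and the stage of the \<open>i\<close>-th entry; in the last one \<open>Var 2, Var 1, Var 0\<close>
  are the last index, the last entry and its stage.
\<close>

definition stage_by_stage :: "fm \<Rightarrow> tm \<Rightarrow> tm \<Rightarrow> fm" where
  "stage_by_stage \<epsilon> \<tau> c =
     Exists (has_length (up 1 c) (Var 0)
       \<^bold>\<and> entry (up 1 c) Zero (up 1 \<tau>)
       \<^bold>\<and> Forall (Succ (Var 0) \<^bold>< Var 1 \<^bold>\<rightarrow>
            Exists (Exists (Exists
              (entry (up 5 c) (Var 3) (Var 2)
               \<^bold>\<and> entry (up 5 c) (Succ (Var 3)) (Var 1)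
               \<^bold>\<and> enumerated_at (upE 5 \<epsilon>) (Var 0) (Var 2)
               \<^bold>\<and> longest_before (upE 5 \<epsilon>) (Var 0) (Var 2) (Var 1)))))
       \<^bold>\<and> Exists (Exists (Exists
            (Var 3 \<^bold>= Succ (Var 2)
             \<^bold>\<and> entry (up 4 c) (Var 2) (Var 1)
             \<^bold>\<and> enumerated_at (upE 4 \<epsilon>) (Var 0) (Var 1)
             \<^bold>\<and> \<^bold>\<not> Exists (prefix (Var 0) (Var 2)
                     \<^bold>\<and> enumerated_before (upE 5 \<epsilon>) (Var 1) (Var 0))))))"

text \<open>Under the three quantifiers: \<open>\<tau>\<close>, its stage-by-stage sequence, and the length of the latter.\<close>

definition bounded_by :: "fm \<Rightarrow> tm \<Rightarrow> fm" where
  "bounded_by \<epsilon> b =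
     Forall (Forall (Forall
       (Exists (in_stage (upE 4 \<epsilon>) (Var 0) (Var 3))
        \<^bold>\<and> stage_by_stage (upE 3 \<epsilon>) (Var 2) (Var 1) \<^bold>\<and> has_length (Var 1) (Var 0)
        \<^bold>\<rightarrow> Var 0 \<^bold>\<le> up 3 b)))"

definition in_tree :: "fm \<Rightarrow> tm \<Rightarrow> fm" where
  "in_tree \<epsilon> \<tau> =
     Exists (Exists (in_stage (upE 2 \<epsilon>) (Var 1) (Var 0) \<^bold>\<and> prefix (up 2 \<tau>) (Var 0)))"

text \<open>A set is finite if it is contained in a coded set.\<close>

definition finite_tree :: "fm \<Rightarrow> fm" where
  "finite_tree \<epsilon> = Exists (Forall (in_tree (upE 2 \<epsilon>) (Var 0) \<^bold>\<rightarrow> member (Var 0) (Var 1)))"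

text \<open>
  In arithmetic with symbols for the primitive recursive functions, such as those decoding
  sequences, every \<open>\<Delta>\<^sub>0\<close> formula of the present language is provably equivalent to a quantifier-free
  one; \<open>\<Delta>\<^sub>0\<close> is therefore the class used here for the \<open>quantifier-free\<close> definitions of \<open>E\<close>. The
  literally quantifier-free formulas of the present language only compare polynomials and cannot
  inspect a code of a sequence.
  Parameters are allowed.
\<close>

definition BME_star :: "fm set" where
  "BME_star =
     {univ_closure
        (Forall (monotone_enumeration (upE 1 \<epsilon>) \<^bold>\<and> bounded_by (upE 1 \<epsilon>) (Var 0)
              \<^bold>\<rightarrow> finite_tree (upE 1 \<epsilon>))) |\<epsilon>. delta0 \<epsilon>}"


section \<open>The graph of the Ackermann-Peter function\<close>

text \<open>
  A computation is a sequence of triples \<open>(x, y, z)\<close>, standing for \<open>A(x, y) = z\<close>, each of which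
  follows from earlier ones by one of the three defining equations. Under the first three
  quantifiers \<open>Var 2, Var 1, Var 0\<close> are \<open>x, y, z\<close>; the innermost part of the last disjunct has, from
  \<open>Var 7\<close> down, \<open>x = u + 1, y = v + 1, z\<close>, then \<open>u, v\<close>, the intermediate value \<open>w = A(x, v)\<close>, and the
  indices of the triples for \<open>A(x, v) = w\<close> and \<open>A(u, w) = z\<close>.
\<close>

definition triple_at :: "tm \<Rightarrow> tm \<Rightarrow> tm \<Rightarrow> tm \<Rightarrow> tm \<Rightarrow> fm"
  where "triple_at c i x y z = entry c i (pair x (pair y z))"

definition ack_step :: "tm \<Rightarrow> tm \<Rightarrow> fm" where
  "ack_step c i =
     BExists (Succ c) (BExists (Succ (up 1 c)) (BExists (Succ (up 2 c))
       (triple_at (up 3 c) (up 3 i) (Var 2) (Var 1) (Var 0)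
        \<^bold>\<and> (Var 2 \<^bold>= Zero \<^bold>\<and> Var 0 \<^bold>= Succ (Var 1)
          \<^bold>\<or> Var 1 \<^bold>= Zero
             \<^bold>\<and> BExists (Var 2) (Var 3 \<^bold>= Succ (Var 0)
                  \<^bold>\<and> BExists (up 4 i) (triple_at (up 5 c) (Var 0) (Var 1) (Succ Zero) (Var 2)))
          \<^bold>\<or> BExists (Var 2) (BExists (Var 2)
               (Var 4 \<^bold>= Succ (Var 1) \<^bold>\<and> Var 3 \<^bold>= Succ (Var 0)
                \<^bold>\<and> BExists (Succ (up 5 c)) (BExists (up 6 i) (BExists (up 7 i)
                     (triple_at (up 8 c) (Var 1) (Var 7) (Var 3) (Var 2)
                      \<^bold>\<and> triple_at (up 8 c) (Var 0) (Var 4) (Var 2) (Var 5))))))))))"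

definition ackermann_graph :: "tm \<Rightarrow> tm \<Rightarrow> tm \<Rightarrow> fm" where
  "ackermann_graph m n k =
     Exists (BExists (Succ (Var 0))
       (has_length (Var 1) (Var 0)
        \<^bold>\<and> BForall (Var 0) (ack_step (Var 2) (Var 0))
        \<^bold>\<and> BExists (Var 0) (triple_at (Var 2) (Var 0) (up 3 m) (up 3 n) (up 3 k))))"

lemma delta0_connectives [simp]:
  "delta0 \<phi> \<Longrightarrow> delta0 (\<^bold>\<not> \<phi>)"
  "delta0 \<phi> \<Longrightarrow> delta0 \<psi> \<Longrightarrow> delta0 (\<phi> \<^bold>\<and> \<psi>)"
  "delta0 \<phi> \<Longrightarrow> delta0 \<psi> \<Longrightarrow> delta0 (\<phi> \<^bold>\<or> \<psi>)"
  "delta0 \<phi> \<Longrightarrow> delta0 (BExists t \<phi>)"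
  by (simp_all add: Neg_def Conj_def Disj_def BExists_def delta0.intros)

lemma sigma1_ackermann_graph: "sigma1 (ackermann_graph m n k)"
  unfolding ackermann_graph_def ack_step_def triple_at_def has_length_def entry_def remainder_def
  by (intro sigma1.intros delta0_connectives delta0.intros)

end

theory Submission
  imports Defs "HOL-Library.Countable_Set"
begin

text \<open>
  By completeness it suffices to show that the Ackermann function is total in every model of
  \<open>I\<Sigma>\<^sub>1 + BME\<^sub>*\<close>. Let \<open>m\<close> and \<open>n\<close> be elements of a model. As \<open>A(x, j)\<close> is the result of iterating
  \<open>A(x - 1, \<cdot>)\<close>, starting with \<open>1\<close>, \<open>j + 1\<close> times, the computation of \<open>A(m, n)\<close> unfolds into a tree
  of height \<open>m + 1\<close>: its nodes are the sequences \<open>j\<^sub>0, j\<^sub>1, \<dots>\<close> with \<open>j\<^sub>i \<le> y\<^sub>i\<close>,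
  where \<open>y\<^sub>0 = n\<close> and \<open>y\<^sub>i\<^sub>+\<^sub>1\<close> is \<open>A(m - i, j\<^sub>i - 1)\<close>, or \<open>1\<close> if \<open>j\<^sub>i = 0\<close>. The children of a node are enumerated, all at one stage, when a computation of the \<open>y\<close> that bounds
  them is found. That computation is stored in the entries of the children, so that the enumeration
  is \<open>\<Delta>\<^sub>0\<close> and a bound on the tree bounds all these computations. Stage-by-stage sequences are
  branches, hence have length at most \<open>m + 2\<close>, and \<open>BME\<^sub>*\<close> gives a bound \<open>F\<close> on the tree.

  Follow the branch on which each \<open>j\<^sub>i\<close> is maximal such that \<open>y\<^sub>i\<^sub>+\<^sub>1\<close> has a computation below \<open>F\<close>; this
  condition is \<open>\<Delta>\<^sub>0\<close>. By \<open>\<Sigma>\<^sub>1\<close>-induction from the bottom upwards, \<open>A(m - i, y\<^sub>i)\<close> is defined: as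
  \<open>A(m - i - 1, y\<^sub>i\<^sub>+\<^sub>1) = A(m - i, j\<^sub>i)\<close> is defined, \<open>j\<^sub>i < y\<^sub>i\<close> is impossible, since the sibling
  \<open>j\<^sub>i + 1\<close> would then have children in the tree and violate the maximality of \<open>j\<^sub>i\<close>.
\<close>

text \<open>BME_* is used once, and what it buys is a bound: having a computation is a Sigma_1
  condition on a call, having one below \<open>F\<close> is Delta_0, and with the latter the
  existence of the branch of maximal indices comes within reach of the induction. This is why the
  computations sit inside the codes of nodes. Monotonicity dictates the stages. By clause (a) all
  children of a node must appear together, so the stored computation has to depend on the parent
  alone; hence the least one is taken. By clause (b) different parents need different stages, and a
  node must come after its ancestors. The stage \<open>pr (\<sigma> * \<sigma>) C + 1\<close> for
  the children of \<open>\<sigma>\<close> achieves both. As \<open>m\<close>, \<open>n\<close> and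
  all lengths may be nonstandard, every induction over them is one of the model and needs a
  definable predicate. The definitions therefore bound their quantifiers, and many have an
  \<open>_iff\<close> lemma that removes the bounds again.\<close>

instance tm :: countable by countable_datatype
instance fm :: countable by countable_datatype

section \<open>Completeness of the calculus, with a countermodel on a prescribed countable
  type\<close>

section \<open>Substitution\<close>

abbreviation lift :: "(nat \<Rightarrow> tm) \<Rightarrow> nat \<Rightarrow> tm"
  where "lift \<sigma> \<equiv> case_nat (Var 0) (\<lambda>n. up (Suc 0) (\<sigma> n))"

lemma subst_tm_subst_tm: "subst_tm \<tau> (subst_tm \<sigma> t) = subst_tm (\<lambda>n. subst_tm \<tau> (\<sigma> n)) t"
  by (induction t) auto

lemma subst_tm_cong: "(\<And>n. n < fv_bound_tm t \<Longrightarrow> \<sigma> n = \<tau> n) \<Longrightarrow> subst_tm \<sigma> t = subst_tm \<tau> t"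
  by (induction t) auto

lemma subst_tm_Var [simp]: "subst_tm Var t = t"
  by (induction t) auto

lemma lift_Var: "lift Var = Var"
  by (auto simp: fun_eq_iff up_def split: nat.split)

lemma subst_Var [simp]: "subst \<phi> Var = \<phi>"
  by (induction \<phi>) (auto simp: lift_Var)

lemma subst_tm_lift_up: "subst_tm (case_nat u \<sigma>) (up (Suc 0) t) = subst_tm \<sigma> t"
  by (simp add: up_def subst_tm_subst_tm)

lemma up_subst_tm: "up (Suc 0) (subst_tm \<sigma> t) = subst_tm (\<lambda>n. up (Suc 0) (\<sigma> n)) t"
  by (simp add: up_def subst_tm_subst_tm)

lemma lift_comp: "(\<lambda>n. subst_tm (lift \<tau>) (lift \<sigma> n)) = lift (\<lambda>n. subst_tm \<tau> (\<sigma> n))"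
  by (auto simp: fun_eq_iff subst_tm_lift_up up_subst_tm split: nat.split)

lemma subst_subst: "subst (subst \<phi> \<sigma>) \<tau> = subst \<phi> (\<lambda>n. subst_tm \<tau> (\<sigma> n))"
proof (induction \<phi> arbitrary: \<sigma> \<tau>)
  case (Forall \<phi>)
  then show ?case by (simp only: subst.simps One_nat_def lift_comp)
qed (auto simp: subst_tm_subst_tm)

lemma subst_cong: "(\<And>n. n < fv_bound \<phi> \<Longrightarrow> \<sigma> n = \<tau> n) \<Longrightarrow> subst \<phi> \<sigma> = subst \<phi> \<tau>"
proof (induction \<phi> arbitrary: \<sigma> \<tau>)
  case (Forall \<phi>)
  have "subst \<phi> (lift \<sigma>) = subst \<phi> (lift \<tau>)"
    by (rule Forall.IH) (use Forall.prems in \<open>auto split: nat.split\<close>)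
  then show ?case by simp
next
  case (Imp \<phi> \<psi>)
  have "subst \<phi> \<sigma> = subst \<phi> \<tau>" "subst \<psi> \<sigma> = subst \<psi> \<tau>"
    by (rule Imp.IH, simp add: Imp.prems)+
  then show ?case by simp
next
  case (Eq t u)
  have "subst_tm \<sigma> t = subst_tm \<tau> t" "subst_tm \<sigma> u = subst_tm \<tau> u"
    by (rule subst_tm_cong, simp add: Eq.prems)+
  then show ?case by simp
next
  case (Less t u)
  have "subst_tm \<sigma> t = subst_tm \<tau> t" "subst_tm \<sigma> u = subst_tm \<tau> u"
    by (rule subst_tm_cong, simp add: Less.prems)+
  then show ?case by simp
qed simp

lemma subst_closed: "fv_bound \<phi> = 0 \<Longrightarrow> subst \<phi> \<sigma> = \<phi>"
  using subst_cong[of \<phi> \<sigma> Var] by simp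

lemma inst_subst: "subst (inst t \<phi>) \<sigma> = inst (subst_tm \<sigma> t) (subst \<phi> (lift \<sigma>))"
  unfolding inst_def subst_subst
  by (rule arg_cong[where f="subst \<phi>"]) (auto simp: fun_eq_iff subst_tm_lift_up split: nat.split)

lemma inst_subst_lift: "inst t (subst \<phi> (lift \<sigma>)) = subst \<phi> (case_nat t \<sigma>)"
  unfolding inst_def subst_subst
  by (rule arg_cong[where f="subst \<phi>"]) (auto simp: fun_eq_iff subst_tm_lift_up split: nat.split)

lemma subst_Neg [simp]: "subst (\<^bold>\<not> \<phi>) \<sigma> = (\<^bold>\<not> subst \<phi> \<sigma>)"
  by (simp add: Neg_def)

lemma fv_bound_Forall_pow: "fv_bound ((Forall ^^ k) \<phi>) = fv_bound \<phi> - k"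
  by (induction k) auto

lemma fv_bound_univ_closure [simp]: "fv_bound (univ_closure \<phi>) = 0"
  by (simp add: univ_closure_def fv_bound_Forall_pow)

section \<open>Derivations\<close>

lemma prv_mono: "\<Gamma> \<turnstile> \<phi> \<Longrightarrow> \<Gamma> \<subseteq> \<Delta> \<Longrightarrow> \<Delta> \<turnstile> \<phi>"
proof (induction arbitrary: \<Delta> rule: prv.induct)
  case (ImpI \<phi> \<Gamma> \<psi>)
  then show ?case by (meson prv.ImpI insert_mono)
next
  case (Classical \<phi> \<Gamma>)
  then show ?case by (meson prv.Classical insert_mono)
next
  case (AllI \<Gamma> \<phi>)
  then show ?case by (intro prv.AllI AllI.IH image_mono)
next
  case (ImpE \<Gamma> \<phi> \<psi>)
  then show ?case by (meson prv.ImpE)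
next
  case (AllE \<Gamma> \<phi> t)
  then show ?case by (meson prv.AllE)
next
  case (EqSubst \<Gamma> t u \<phi>)
  then show ?case by (meson prv.EqSubst)
qed (auto intro: prv.Assm prv.EqRefl)

text \<open>Compactness of derivability, which makes the union of a chain of consistent sets
  consistent. For \<open>AllI\<close>, a finite part of the shifted context is the shift of a finite
  part of the context.\<close>

lemma prv_finite: "\<Gamma> \<turnstile> \<phi> \<Longrightarrow> \<exists>\<Gamma>\<^sub>0\<subseteq>\<Gamma>. finite \<Gamma>\<^sub>0 \<and> (\<Gamma>\<^sub>0 \<turnstile> \<phi>)"
proof (induction rule: prv.induct)
  case (Assm \<phi> \<Gamma>)
  then show ?case by (intro exI[of _ "{\<phi>}"]) (auto intro: prv.Assm)
next
  case (ImpI \<phi> \<Gamma> \<psi>)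
  then obtain D where "D \<subseteq> insert \<phi> \<Gamma>" "finite D" "D \<turnstile> \<psi>" by auto
  then show ?case
    using prv.ImpI[of \<phi> "D - {\<phi>}" \<psi>] prv_mono[of D \<psi> "insert \<phi> (D - {\<phi>})"]
    by (intro exI[of _ "D - {\<phi>}"]) auto
next
  case (ImpE \<Gamma> \<phi> \<psi>)
  then obtain D1 D2 where "D1 \<subseteq> \<Gamma>" "finite D1" "D1 \<turnstile> \<phi> \<^bold>\<rightarrow> \<psi>" "D2 \<subseteq> \<Gamma>" "finite D2" "D2 \<turnstile> \<phi>" by auto
  moreover from this have "D1 \<union> D2 \<turnstile> \<psi>"
    by (meson prv.ImpE prv_mono Un_upper1 Un_upper2)
  ultimately show ?case by (intro exI[of _ "D1 \<union> D2"]) auto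
next
  case (Classical \<phi> \<Gamma>)
  then obtain D where "D \<subseteq> insert (\<^bold>\<not> \<phi>) \<Gamma>" "finite D" "D \<turnstile> Fls" by auto
  then show ?case
    using prv.Classical[of \<phi> "D - {\<^bold>\<not> \<phi>}"] prv_mono[of D Fls "insert (\<^bold>\<not> \<phi>) (D - {\<^bold>\<not> \<phi>})"]
    by (intro exI[of _ "D - {\<^bold>\<not> \<phi>}"]) auto
next
  case (AllI \<Gamma> \<phi>)
  then obtain D where "D \<subseteq> (\<lambda>\<psi>. subst \<psi> (\<lambda>n. Var (Suc n))) ` \<Gamma>" "finite D" "D \<turnstile> \<phi>" by auto
  then obtain E where "E \<subseteq> \<Gamma>" "finite E" "D = (\<lambda>\<psi>. subst \<psi> (\<lambda>n. Var (Suc n))) ` E"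
    using finite_subset_image by metis
  then show ?case using \<open>D \<turnstile> \<phi>\<close> prv.AllI by metis
next
  case (AllE \<Gamma> \<phi> t)
  then show ?case by (meson prv.AllE)
next
  case (EqRefl \<Gamma> t)
  then show ?case by (intro exI[of _ "{}"]) (auto intro: prv.EqRefl)
next
  case (EqSubst \<Gamma> t u \<phi>)
  then obtain D1 D2 where "D1 \<subseteq> \<Gamma>" "finite D1" "D1 \<turnstile> t \<^bold>= u" "D2 \<subseteq> \<Gamma>" "finite D2" "D2 \<turnstile> inst t \<phi>"
    by auto
  moreover from this have "D1 \<union> D2 \<turnstile> inst u \<phi>"
    by (meson prv.EqSubst prv_mono Un_upper1 Un_upper2)
  ultimately show ?case by (intro exI[of _ "D1 \<union> D2"]) auto
qed

lemma prv_subst: "\<Gamma> \<turnstile> \<phi> \<Longrightarrow> (\<lambda>\<psi>. subst \<psi> \<sigma>) ` \<Gamma> \<turnstile> subst \<phi> \<sigma>"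
proof (induction arbitrary: \<sigma> rule: prv.induct)
  case (ImpI \<phi> \<Gamma> \<psi>)
  then show ?case by (simp add: prv.ImpI)
next
  case (ImpE \<Gamma> \<phi> \<psi>)
  then show ?case by (metis prv.ImpE subst.simps(4))
next
  case (Classical \<phi> \<Gamma>)
  then show ?case by (simp add: prv.Classical)
next
  case (AllI \<Gamma> \<phi>)
  have "(\<lambda>\<psi>. subst \<psi> (\<lambda>n. Var (Suc n))) ` (\<lambda>\<psi>. subst \<psi> \<sigma>) ` \<Gamma>
      = (\<lambda>\<psi>. subst \<psi> (lift \<sigma>)) ` (\<lambda>\<psi>. subst \<psi> (\<lambda>n. Var (Suc n))) ` \<Gamma>"
    by (simp add: image_image subst_subst up_def)
  then show ?case using AllI.IH[of "lift \<sigma>"] by (simp add: prv.AllI)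
next
  case (AllE \<Gamma> \<phi> t)
  then show ?case by (simp add: inst_subst prv.AllE)
next
  case (EqSubst \<Gamma> t u \<phi>)
  then show ?case by (simp add: inst_subst) (metis prv.EqSubst)
qed (auto intro: prv.Assm prv.EqRefl)

text \<open>The eigenvariable rule in named form. \<open>AllI\<close> shifts the whole context
  instead, so \<open>\<sigma>\<close> moves the fresh variable \<open>k\<close> to index 0 and all
  others up by one; on formulas whose variables are below \<open>k\<close> this is the shift that
  \<open>AllI\<close> expects.\<close>

lemma prv_Forall_fresh:
  assumes "\<Gamma> \<turnstile> inst (Var k) \<phi>" and "fv_bound \<phi> \<le> k" and "\<And>\<psi>. \<psi> \<in> \<Gamma> \<Longrightarrow> fv_bound \<psi> \<le> k"
  shows "\<Gamma> \<turnstile> Forall \<phi>"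
proof -
  define \<sigma> where "\<sigma> n = (if n = k then Var 0 else Var (Suc n))" for n
  have "(\<lambda>\<psi>. subst \<psi> \<sigma>) ` \<Gamma> = (\<lambda>\<psi>. subst \<psi> (\<lambda>n. Var (Suc n))) ` \<Gamma>"
    by (intro image_cong refl subst_cong) (use assms(3) in \<open>fastforce simp: \<sigma>_def\<close>)
  moreover have "subst (inst (Var k) \<phi>) \<sigma> = subst \<phi> Var"
    unfolding inst_def subst_subst
    by (rule subst_cong) (use assms(2) in \<open>auto simp: \<sigma>_def split: nat.split\<close>)
  ultimately have "(\<lambda>\<psi>. subst \<psi> (\<lambda>n. Var (Suc n))) ` \<Gamma> \<turnstile> \<phi>"
    using prv_subst[OF assms(1), of \<sigma>] by simp
  then show ?thesis by (rule prv.AllI)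
qed

section \<open>Henkin sets\<close>

definition consistent :: "fm set \<Rightarrow> bool"
  where "consistent \<Gamma> \<longleftrightarrow> \<not> (\<Gamma> \<turnstile> Fls)"

lemma consistent_subset: "consistent \<Delta> \<Longrightarrow> \<Gamma> \<subseteq> \<Delta> \<Longrightarrow> consistent \<Gamma>"
  unfolding consistent_def using prv_mono by blast

text \<open>Free variables serve as Henkin constants, so the language is never enlarged. If adding
  the witness were inconsistent, the instance at the fresh variable would be derivable, and with it
  the universal formula.\<close>

lemma consistent_witness:
  assumes "consistent (insert (\<^bold>\<not> Forall \<phi>) \<Gamma>)" and "fv_bound \<phi> \<le> k"
    and "\<And>\<psi>. \<psi> \<in> \<Gamma> \<Longrightarrow> fv_bound \<psi> \<le> k"
  shows "consistent (insert (\<^bold>\<not> inst (Var k) \<phi>) (insert (\<^bold>\<not> Forall \<phi>) \<Gamma>))"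
proof (rule ccontr)
  let ?G = "insert (\<^bold>\<not> Forall \<phi>) \<Gamma>"
  assume "\<not> ?thesis"
  then have "?G \<turnstile> inst (Var k) \<phi>" by (simp add: consistent_def prv.Classical)
  then have "?G \<turnstile> Forall \<phi>"
    by (rule prv_Forall_fresh) (use assms in \<open>auto simp: Neg_def\<close>)
  moreover have "?G \<turnstile> Forall \<phi> \<^bold>\<rightarrow> Fls" by (intro prv.Assm) (simp add: Neg_def)
  ultimately show False using assms(1) prv.ImpE unfolding consistent_def by blast
qed

definition henkin :: "fm set \<Rightarrow> bool" where
  "henkin H \<longleftrightarrow> consistent H \<and> (\<forall>\<phi>. \<phi> \<in> H \<or> (\<^bold>\<not> \<phi>) \<in> H)
     \<and> (\<forall>\<phi>. (\<^bold>\<not> Forall \<phi>) \<in> H \<longrightarrow> (\<exists>t. (\<^bold>\<not> inst t \<phi>) \<in> H))"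

text \<open>A negated universal formula is recognised in its unfolded form, an implication with
  conclusion \<open>Fls\<close>. The choice of \<open>k\<close> is meaningful when the variables of
  the set are bounded, which \<open>extension_bounded\<close> provides.\<close>

fun witness :: "fm set \<Rightarrow> fm \<Rightarrow> fm set" where
  "witness \<Gamma> (Forall \<psi> \<^bold>\<rightarrow> Fls) =
     {\<^bold>\<not> inst (Var (SOME k. fv_bound \<psi> \<le> k \<and> (\<forall>\<theta>\<in>\<Gamma>. fv_bound \<theta> \<le> k))) \<psi>}"
| "witness \<Gamma> _ = {}"

primrec extension :: "fm set \<Rightarrow> nat \<Rightarrow> fm set" where
  "extension \<Gamma> 0 = \<Gamma>"
| "extension \<Gamma> (Suc n) =
     (let \<Delta> = extension \<Gamma> n; \<phi> = from_nat n in
      if consistent (insert \<phi> \<Delta>) then insert \<phi> \<Delta> \<union> witness \<Delta> \<phi> else \<Delta>)"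

text \<open>A fresh variable remains at every step, since each step adds only finitely many
  formulas.\<close>

lemma extension_bounded:
  assumes "\<And>\<psi>. \<psi> \<in> \<Gamma> \<Longrightarrow> fv_bound \<psi> \<le> k"
  shows "\<exists>k. \<forall>\<psi>\<in>extension \<Gamma> n. fv_bound \<psi> \<le> k"
proof (induction n)
  case 0
  then show ?case using assms by auto
next
  case (Suc n)
  then obtain k where k: "\<forall>\<psi>\<in>extension \<Gamma> n. fv_bound \<psi> \<le> k" ..
  have "finite (insert (from_nat n) (witness (extension \<Gamma> n) (from_nat n)))"
    by (cases "(extension \<Gamma> n, from_nat n :: fm)" rule: witness.cases) auto
  then obtain k' where "\<forall>\<psi>\<in>insert (from_nat n) (witness (extension \<Gamma> n) (from_nat n)). fv_bound \<psi> \<le> k'"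
    by (metis finite_nat_set_iff_bounded_le finite_imageI imageI)
  with k have "\<forall>\<psi>\<in>extension \<Gamma> (Suc n). fv_bound \<psi> \<le> max k k'"
    by (fastforce simp: Let_def split: if_splits)
  then show ?case ..
qed

lemma consistent_extension:
  assumes "\<And>\<psi>. \<psi> \<in> \<Gamma> \<Longrightarrow> fv_bound \<psi> \<le> k" and "consistent \<Gamma>"
  shows "consistent (extension \<Gamma> n)"
proof (induction n)
  case 0
  then show ?case using assms by simp
next
  case (Suc n)
  let ?D = "extension \<Gamma> n" and ?\<phi> = "from_nat n :: fm"
  show ?case
  proof (cases "consistent (insert ?\<phi> ?D) \<and> (\<exists>\<psi>. ?\<phi> = (Forall \<psi> \<^bold>\<rightarrow> Fls))")
    case True
    then obtain \<psi> where \<psi>: "?\<phi> = (Forall \<psi> \<^bold>\<rightarrow> Fls)" by auto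
    define P where "P k \<longleftrightarrow> fv_bound \<psi> \<le> k \<and> (\<forall>\<theta>\<in>?D. fv_bound \<theta> \<le> k)" for k
    obtain k' where "\<forall>\<psi>\<in>?D. fv_bound \<psi> \<le> k'" using extension_bounded assms(1) by metis
    then have "P (max k' (fv_bound \<psi>))" by (auto simp: P_def intro: le_max_iff_disj[THEN iffD2])
    then have "P (SOME k. P k)" by (rule someI)
    then have "consistent (insert (\<^bold>\<not> inst (Var (SOME k. P k)) \<psi>) (insert (\<^bold>\<not> Forall \<psi>) ?D))"
      using True \<psi> by (intro consistent_witness) (auto simp: P_def Neg_def)
    then show ?thesis using True \<psi> by (simp add: Let_def P_def Neg_def)
  next
    case False
    then have "witness ?D ?\<phi> = {}" if "consistent (insert ?\<phi> ?D)"
      using that by (cases "(?D, ?\<phi>)" rule: witness.cases) auto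
    then show ?thesis using Suc by (auto simp: Let_def)
  qed
qed

lemma extension_mono: "m \<le> n \<Longrightarrow> extension \<Gamma> m \<subseteq> extension \<Gamma> n"
  by (rule lift_Suc_mono_le) (auto simp: Let_def)

lemma henkin_extension:
  assumes "\<And>\<psi>. \<psi> \<in> \<Gamma> \<Longrightarrow> fv_bound \<psi> \<le> k" and "consistent \<Gamma>"
  obtains H where "henkin H" and "\<Gamma> \<subseteq> H"
proof
  let ?H = "\<Union>n. extension \<Gamma> n"
  have fin: "\<exists>n. D \<subseteq> extension \<Gamma> n" if "finite D" "D \<subseteq> ?H" for D
    using that
  proof (induction D rule: finite_induct)
    case (insert x D)
    then obtain n m where "D \<subseteq> extension \<Gamma> n" "x \<in> extension \<Gamma> m" by auto
    then have "insert x D \<subseteq> extension \<Gamma> (max n m)"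
      using extension_mono[of n "max n m" \<Gamma>] extension_mono[of m "max n m" \<Gamma>] by auto
    then show ?case ..
  qed simp
  have con: "consistent ?H"
  proof (rule ccontr)
    assume "\<not> consistent ?H"
    then obtain D where D: "D \<subseteq> ?H" "finite D" "D \<turnstile> Fls" unfolding consistent_def using prv_finite by metis
    then obtain n where "D \<subseteq> extension \<Gamma> n" using fin by blast
    then show False using consistent_extension[OF assms, of n] D prv_mono unfolding consistent_def by blast
  qed
  \<comment> \<open>A formula is treated at the step given by its own number; consistency with the
    whole union implies consistency with the part built so far.\<close>
  have max: "\<phi> \<in> extension \<Gamma> (Suc (to_nat \<phi>))" if "consistent (insert \<phi> ?H)" for \<phi>
  proof -
    have "consistent (insert \<phi> (extension \<Gamma> (to_nat \<phi>)))"
      by (rule consistent_subset[OF that]) auto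
    then show ?thesis by (simp add: Let_def)
  qed
  have neg: "\<phi> \<in> ?H \<or> (\<^bold>\<not> \<phi>) \<in> ?H" for \<phi>
  proof (rule ccontr)
    assume "\<not> ?thesis"
    then have "insert \<phi> ?H \<turnstile> Fls" "insert (\<^bold>\<not> \<phi>) ?H \<turnstile> Fls"
      using max unfolding consistent_def by blast+
    then have "?H \<turnstile> \<phi> \<^bold>\<rightarrow> Fls" "?H \<turnstile> \<phi>" by (simp_all add: prv.ImpI prv.Classical)
    then show False using con prv.ImpE unfolding consistent_def by blast
  qed
  have wit: "\<exists>t. (\<^bold>\<not> inst t \<phi>) \<in> ?H" if "(\<^bold>\<not> Forall \<phi>) \<in> ?H" for \<phi>
  proof -
    let ?n = "to_nat (\<^bold>\<not> Forall \<phi>)"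
    have "consistent (insert (\<^bold>\<not> Forall \<phi>) (extension \<Gamma> ?n))"
      by (rule consistent_subset[OF con]) (use that in auto)
    then have "witness (extension \<Gamma> ?n) (\<^bold>\<not> Forall \<phi>) \<subseteq> extension \<Gamma> (Suc ?n)"
      by (simp add: Let_def subset_insertI2)
    then show ?thesis by (auto simp: Neg_def simp del: extension.simps)
  qed
  show "henkin ?H" unfolding henkin_def using con neg wit by blast
  show "\<Gamma> \<subseteq> ?H" using extension.simps(1) by blast
qed

section \<open>Structures and satisfaction\<close>

record 'a struct =
  zero_of :: 'a
  succ_of :: "'a \<Rightarrow> 'a"
  plus_of :: "'a \<Rightarrow> 'a \<Rightarrow> 'a"
  times_of :: "'a \<Rightarrow> 'a \<Rightarrow> 'a"
  less_of :: "'a \<Rightarrow> 'a \<Rightarrow> bool"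

primrec val_in :: "'a struct \<Rightarrow> (nat \<Rightarrow> 'a) \<Rightarrow> tm \<Rightarrow> 'a" where
  "val_in S e (Var n) = e n"
| "val_in S e Zero = zero_of S"
| "val_in S e (Succ t) = succ_of S (val_in S e t)"
| "val_in S e (t \<^bold>+ u) = plus_of S (val_in S e t) (val_in S e u)"
| "val_in S e (t \<^bold>* u) = times_of S (val_in S e t) (val_in S e u)"

primrec sat_in :: "'a struct \<Rightarrow> (nat \<Rightarrow> 'a) \<Rightarrow> fm \<Rightarrow> bool" where
  "sat_in S e (t \<^bold>= u) \<longleftrightarrow> val_in S e t = val_in S e u"
| "sat_in S e (t \<^bold>< u) \<longleftrightarrow> less_of S (val_in S e t) (val_in S e u)"
| "sat_in S e Fls \<longleftrightarrow> False"
| "sat_in S e (\<phi> \<^bold>\<rightarrow> \<psi>) \<longleftrightarrow> (sat_in S e \<phi> \<longrightarrow> sat_in S e \<psi>)"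
| "sat_in S e (Forall \<phi>) \<longleftrightarrow> (\<forall>x. sat_in S (case_nat x e) \<phi>)"

definition models :: "'a struct \<Rightarrow> fm set \<Rightarrow> bool"
  where "models S \<Gamma> \<longleftrightarrow> (\<forall>\<phi>\<in>\<Gamma>. \<forall>e. sat_in S e \<phi>)"

section \<open>Completeness\<close>

context
  fixes H :: "fm set"
  assumes H: "henkin H"
begin

lemma H_prv: "\<Gamma> \<turnstile> \<phi> \<Longrightarrow> \<Gamma> \<subseteq> H \<Longrightarrow> \<phi> \<in> H"
proof (rule ccontr)
  assume "\<Gamma> \<turnstile> \<phi>" "\<Gamma> \<subseteq> H" "\<phi> \<notin> H"
  then have "(\<phi> \<^bold>\<rightarrow> Fls) \<in> H" "H \<turnstile> \<phi>" using H prv_mono by (auto simp: henkin_def Neg_def)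
  then show False using H by (meson henkin_def consistent_def prv.Assm prv.ImpE)
qed

lemma H_Fls: "Fls \<notin> H"
  using H by (auto simp: henkin_def consistent_def intro: prv.Assm)

lemma H_Imp: "(\<phi> \<^bold>\<rightarrow> \<psi>) \<in> H \<longleftrightarrow> (\<phi> \<in> H \<longrightarrow> \<psi> \<in> H)"
proof
  assume "(\<phi> \<^bold>\<rightarrow> \<psi>) \<in> H"
  then show "\<phi> \<in> H \<longrightarrow> \<psi> \<in> H" using H_prv[of H] by (meson prv.Assm prv.ImpE order_refl)
next
  assume *: "\<phi> \<in> H \<longrightarrow> \<psi> \<in> H"
  show "(\<phi> \<^bold>\<rightarrow> \<psi>) \<in> H"
  proof (cases "\<psi> \<in> H")
    case True
    then have "H \<turnstile> \<phi> \<^bold>\<rightarrow> \<psi>" by (intro prv.ImpI prv.Assm) simp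
    then show ?thesis using H_prv by blast
  next
    case False
    then have "(\<phi> \<^bold>\<rightarrow> Fls) \<in> H" using * H by (auto simp: henkin_def Neg_def)
    then have "insert (\<^bold>\<not> \<psi>) (insert \<phi> H) \<turnstile> \<phi> \<^bold>\<rightarrow> Fls" by (simp add: prv.Assm)
    then have "insert (\<^bold>\<not> \<psi>) (insert \<phi> H) \<turnstile> Fls" by (rule prv.ImpE) (simp add: prv.Assm)
    then have "H \<turnstile> \<phi> \<^bold>\<rightarrow> \<psi>" by (rule prv.ImpI[OF prv.Classical])
    then show ?thesis using H_prv by blast
  qed
qed

lemma H_Forall: "Forall \<phi> \<in> H \<longleftrightarrow> (\<forall>t. inst t \<phi> \<in> H)"
proof
  assume "Forall \<phi> \<in> H"
  then show "\<forall>t. inst t \<phi> \<in> H" using H_prv[of H] by (auto intro: prv.Assm prv.AllE)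
next
  assume *: "\<forall>t. inst t \<phi> \<in> H"
  show "Forall \<phi> \<in> H"
  proof (rule ccontr)
    assume "Forall \<phi> \<notin> H"
    then obtain t where "(\<^bold>\<not> inst t \<phi>) \<in> H" using H by (auto simp: henkin_def)
    then show False using * H_Imp H_Fls by (auto simp: Neg_def)
  qed
qed

definition teq :: "tm \<Rightarrow> tm \<Rightarrow> bool"
  where "teq t u \<longleftrightarrow> (t \<^bold>= u) \<in> H"

lemma teq_subst: "teq t u \<Longrightarrow> inst t \<phi> \<in> H \<Longrightarrow> inst u \<phi> \<in> H"
  unfolding teq_def using H_prv[of H] by (meson prv.Assm prv.EqSubst order_refl)

lemma inst_simps:
  "inst t (a \<^bold>= b) = (subst_tm (case_nat t Var) a \<^bold>= subst_tm (case_nat t Var) b)"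
  "inst t (a \<^bold>< b) = (subst_tm (case_nat t Var) a \<^bold>< subst_tm (case_nat t Var) b)"
  "subst_tm (case_nat t Var) (up (Suc 0) a) = a"
  by (simp_all add: inst_def subst_tm_lift_up)

lemma teq_refl: "teq t t"
  unfolding teq_def using H_prv[of H] by (auto intro: prv.EqRefl)

lemma teq_sym: "teq t u \<Longrightarrow> teq u t"
  using teq_subst[of t u "Var 0 \<^bold>= up (Suc 0) t"] teq_refl[of t] by (simp add: inst_simps teq_def)

lemma teq_trans: "teq t u \<Longrightarrow> teq u v \<Longrightarrow> teq t v"
  using teq_subst[of u v "up (Suc 0) t \<^bold>= Var 0"] by (simp add: inst_simps teq_def)

lemma teq_cong1: "teq t u \<Longrightarrow> teq (subst_tm (case_nat t Var) a) (subst_tm (case_nat u Var) a)"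
  using teq_subst[of t u "up (Suc 0) (subst_tm (case_nat t Var) a) \<^bold>= a"]
    teq_refl[of "subst_tm (case_nat t Var) a"]
  by (simp add: inst_simps teq_def)

lemma teq_Succ: "teq t u \<Longrightarrow> teq (Succ t) (Succ u)"
  using teq_cong1[of t u "Succ (Var 0)"] by simp

lemma teq_Plus: "teq t t' \<Longrightarrow> teq u u' \<Longrightarrow> teq (t \<^bold>+ u) (t' \<^bold>+ u')"
  using teq_cong1[of t t' "Var 0 \<^bold>+ up (Suc 0) u"] teq_cong1[of u u' "up (Suc 0) t' \<^bold>+ Var 0"]
  by (simp add: subst_tm_lift_up) (metis teq_trans)

lemma teq_Times: "teq t t' \<Longrightarrow> teq u u' \<Longrightarrow> teq (t \<^bold>* u) (t' \<^bold>* u')"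
  using teq_cong1[of t t' "Var 0 \<^bold>* up (Suc 0) u"] teq_cong1[of u u' "up (Suc 0) t' \<^bold>* Var 0"]
  by (simp add: subst_tm_lift_up) (metis teq_trans)

lemma teq_Less: "teq t t' \<Longrightarrow> teq u u' \<Longrightarrow> (t \<^bold>< u) \<in> H \<Longrightarrow> (t' \<^bold>< u') \<in> H"
  using teq_subst[of t t' "Var 0 \<^bold>< up (Suc 0) u"] teq_subst[of u u' "up (Suc 0) t' \<^bold>< Var 0"]
  by (simp add: inst_simps)

text \<open>Makes the term model infinite, so that it can be put in bijection with a given countably
  infinite type.\<close>

lemma numerals_distinct:
  assumes "PA_basic \<subseteq> H" and "teq ((Succ ^^ i) Zero) ((Succ ^^ j) Zero)"
  shows "i = j"
proof -
  have 1: "\<not> teq (Succ t) Zero" for t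
  proof -
    have "Forall (\<^bold>\<not> Succ (Var 0) \<^bold>= Zero) \<in> H" using assms(1) by (auto simp: PA_basic_def)
    then have "inst t (\<^bold>\<not> Succ (Var 0) \<^bold>= Zero) \<in> H" by (simp add: H_Forall)
    then show ?thesis using H_Imp H_Fls by (simp add: inst_def Neg_def teq_def)
  qed
  have 2: "teq t u" if "teq (Succ t) (Succ u)" for t u
  proof -
    have "Forall (Forall (Succ (Var 1) \<^bold>= Succ (Var 0) \<^bold>\<rightarrow> Var 1 \<^bold>= Var 0)) \<in> H"
      using assms(1) by (auto simp: PA_basic_def)
    then have "inst u (subst (Succ (Var 1) \<^bold>= Succ (Var 0) \<^bold>\<rightarrow> Var 1 \<^bold>= Var 0) (lift (case_nat t Var))) \<in> H"
      using H_Forall by (simp add: inst_def)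
    then show ?thesis using that H_Imp by (simp add: inst_def teq_def up_def subst_tm_subst_tm)
  qed
  show ?thesis using assms(2)
  proof (induction i arbitrary: j)
    case 0
    then show ?case using 1 teq_sym by (cases j) auto
  next
    case (Suc i)
    then show ?case using 1 2 by (cases j) auto
  qed
qed

text \<open>Structures interpret \<open>Eq\<close> by equality of HOL, so the carrier consists of
  the classes of terms under \<open>teq\<close>, renamed along \<open>g\<close>. Every element is
  the value \<open>h t\<close> of a term; environments therefore have the form of \<open>h\<close>
  after a substitution, and truth becomes membership of the substituted formula in
  \<open>H\<close>.\<close>

lemma term_model:
  fixes g :: "nat \<Rightarrow> 'a"
  assumes "PA_basic \<subseteq> H" and "bij g"
  obtains S :: "'a struct" and h :: "tm \<Rightarrow> 'a"
  where "surj h" and "\<And>\<phi> \<sigma>. sat_in S (\<lambda>n. h (\<sigma> n)) \<phi> \<longleftrightarrow> subst \<phi> \<sigma> \<in> H"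
proof -
  define cls where "cls t = {u. teq t u}" for t
  have cls: "cls t = cls u \<longleftrightarrow> teq t u" for t u
    unfolding cls_def using teq_refl teq_sym teq_trans by blast
  have "inj (\<lambda>i. cls ((Succ ^^ i) Zero))"
    using numerals_distinct[OF assms(1)] by (auto simp: inj_def cls)
  then have "infinite (range cls)"
    by (metis finite_subset range_inj_infinite image_subset_iff rangeI)
  then obtain f\<^sub>0 :: "tm set \<Rightarrow> nat" where "bij_betw f\<^sub>0 (range cls) UNIV"
    using countableE_infinite[of "range cls"] by (metis countableI_type countable_image)
  then have "bij_betw (g \<circ> f\<^sub>0) (range cls) UNIV" using assms(2) by (rule bij_betw_trans)
  then obtain f :: "tm set \<Rightarrow> 'a" where f: "bij_betw f (range cls) UNIV" ..
  define h where "h t = f (cls t)" for t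
  have h: "h t = h u \<longleftrightarrow> teq t u" for t u
    using f cls unfolding h_def bij_betw_def by (metis inj_on_eq_iff rangeI)
  have surj: "surj h" using f unfolding h_def bij_betw_def by (metis image_image)
  define r where "r = inv h"
  have r: "teq (r (h t)) t" for t using h surj by (simp add: r_def surj_f_inv_f flip: h)
  define S where "S = \<lparr>zero_of = h Zero, succ_of = (\<lambda>x. h (Succ (r x))),
    plus_of = (\<lambda>x y. h (r x \<^bold>+ r y)), times_of = (\<lambda>x y. h (r x \<^bold>* r y)),
    less_of = (\<lambda>x y. (r x \<^bold>< r y) \<in> H)\<rparr>"
  have val: "val_in S (\<lambda>n. h (\<sigma> n)) t = h (subst_tm \<sigma> t)" for \<sigma> t
    by (induction t) (simp_all add: S_def h r teq_Succ teq_Plus teq_Times)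
  have "sat_in S (\<lambda>n. h (\<sigma> n)) \<phi> \<longleftrightarrow> subst \<phi> \<sigma> \<in> H" for \<phi> \<sigma>
  proof (induction \<phi> arbitrary: \<sigma>)
    case (Eq t u)
    then show ?case by (simp add: val h teq_def)
  next
    case (Less t u)
    have "(r (h a) \<^bold>< r (h b)) \<in> H \<longleftrightarrow> (a \<^bold>< b) \<in> H" for a b
      using teq_Less r teq_sym by meson
    then show ?case by (simp add: val) (simp add: S_def)
  next
    case (Forall \<phi>)
    have *: "case_nat (h t) (\<lambda>n. h (\<sigma> n)) = (\<lambda>n. h (case_nat t \<sigma> n))" for t
      by (auto simp: fun_eq_iff split: nat.split)
    have "sat_in S (\<lambda>n. h (\<sigma> n)) (Forall \<phi>) \<longleftrightarrow> (\<forall>t. sat_in S (case_nat (h t) (\<lambda>n. h (\<sigma> n))) \<phi>)"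
      using surj by simp (metis surjD)
    also have "\<dots> \<longleftrightarrow> (\<forall>t. inst t (subst \<phi> (lift \<sigma>)) \<in> H)"
      unfolding * Forall.IH inst_subst_lift ..
    finally show ?case by (simp add: H_Forall)
  qed (simp_all add: H_Fls H_Imp)
  with surj show ?thesis by (rule that)
qed

end

theorem completeness:
  fixes g :: "nat \<Rightarrow> 'a"
  assumes "\<And>\<psi>. \<psi> \<in> \<Gamma> \<Longrightarrow> fv_bound \<psi> = 0" and "PA_basic \<subseteq> \<Gamma>" and "\<not> (\<Gamma> \<turnstile> \<phi>)"
    and "bij g"
  obtains S :: "'a struct" and e where "models S \<Gamma>" and "\<not> sat_in S e \<phi>"
proof -
  have "consistent (insert (\<^bold>\<not> \<phi>) \<Gamma>)"
    using assms(3) prv.Classical unfolding consistent_def by blast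
  moreover have "fv_bound \<psi> \<le> fv_bound (\<^bold>\<not> \<phi>)" if "\<psi> \<in> insert (\<^bold>\<not> \<phi>) \<Gamma>" for \<psi>
    using that assms(1)[of \<psi>] by auto
  ultimately obtain H where H: "henkin H" "insert (\<^bold>\<not> \<phi>) \<Gamma> \<subseteq> H"
    using henkin_extension[of "insert (\<^bold>\<not> \<phi>) \<Gamma>" "fv_bound (\<^bold>\<not> \<phi>)"] by metis
  then obtain S :: "'a struct" and h where
    S: "surj h" "\<And>\<phi> \<sigma>. sat_in S (\<lambda>n. h (\<sigma> n)) \<phi> \<longleftrightarrow> subst \<phi> \<sigma> \<in> H"
    using term_model[OF H(1) _ assms(4)] assms(2) by (metis insert_subset order_trans)
  have "models S \<Gamma>" unfolding models_def
  proof (intro ballI allI)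
    fix \<psi> and e :: "nat \<Rightarrow> 'a" assume "\<psi> \<in> \<Gamma>"
    \<comment> \<open>An arbitrary environment is pulled back to a substitution, which a sentence
      does not notice.\<close>
    moreover have "e = (\<lambda>n. h (inv h (e n)))" using S(1) by (simp add: surj_f_inv_f)
    ultimately show "sat_in S e \<psi>" using S(2)[of "\<lambda>n. inv h (e n)"] H(2) assms(1) subst_closed by auto
  qed
  moreover have "\<not> sat_in S (\<lambda>n. h (Var n)) \<phi>"
  proof
    assume "sat_in S (\<lambda>n. h (Var n)) \<phi>"
    then have "\<phi> \<in> H" using S(2)[of Var] by simp
    then show False using H H_Imp[OF H(1)] H_Fls[OF H(1)] by (simp add: Neg_def)
  qed
  ultimately show ?thesis by (rule that)
qed

section \<open>Working inside one model: definable predicates, induction, ordered arithmetic\<close>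

section \<open>A model of \<open>I\<Sigma>\<^sub>1\<close> as a type\<close>

lemma sat_connectives [simp]:
  "sat_in S e (\<^bold>\<not> \<phi>) \<longleftrightarrow> \<not> sat_in S e \<phi>"
  "sat_in S e (\<phi> \<^bold>\<and> \<psi>) \<longleftrightarrow> sat_in S e \<phi> \<and> sat_in S e \<psi>"
  "sat_in S e (\<phi> \<^bold>\<or> \<psi>) \<longleftrightarrow> sat_in S e \<phi> \<or> sat_in S e \<psi>"
  "sat_in S e (\<phi> \<^bold>\<leftrightarrow> \<psi>) \<longleftrightarrow> (sat_in S e \<phi> \<longleftrightarrow> sat_in S e \<psi>)"
  "sat_in S e (Exists \<phi>) \<longleftrightarrow> (\<exists>x. sat_in S (case_nat x e) \<phi>)"
  by (auto simp: Neg_def Conj_def Disj_def Iff_def Exists_def)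

lemma val_subst_tm: "val_in S e (subst_tm \<sigma> t) = val_in S (\<lambda>n. val_in S e (\<sigma> n)) t"
  by (induction t) auto

lemma val_up [simp]: "val_in S e (up k t) = val_in S (\<lambda>n. e (n + k)) t"
  by (simp add: up_def val_subst_tm)

lemma sat_subst: "sat_in S e (subst \<phi> \<sigma>) \<longleftrightarrow> sat_in S (\<lambda>n. val_in S e (\<sigma> n)) \<phi>"
proof (induction \<phi> arbitrary: e \<sigma>)
  case (Forall \<phi>)
  have "(\<lambda>n. val_in S (case_nat x e) (lift \<sigma> n)) = case_nat x (\<lambda>n. val_in S e (\<sigma> n))" for x
    by (auto simp: fun_eq_iff split: nat.split)
  then show ?case by (simp add: Forall.IH)
qed (simp_all add: val_subst_tm)

lemma sat_inst: "sat_in S e (inst t \<phi>) \<longleftrightarrow> sat_in S (case_nat (val_in S e t) e) \<phi>"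
proof -
  have "(\<lambda>n. val_in S e (case_nat t Var n)) = case_nat (val_in S e t) e"
    by (auto simp: fun_eq_iff split: nat.split)
  then show ?thesis by (simp add: inst_def sat_subst)
qed

text \<open>Through this, axioms given as sentences can be used with arbitrary elements of the model
  as parameters.\<close>

lemma sat_univ_closure:
  "(\<forall>e. sat_in S e (univ_closure \<phi>)) \<longleftrightarrow> (\<forall>e. sat_in S e \<phi>)"
proof -
  have "(\<forall>e. sat_in S e ((Forall ^^ k) \<phi>)) \<longleftrightarrow> (\<forall>e. sat_in S e \<phi>)" for k
  proof (induction k)
    case (Suc k)
    have "(\<forall>e x. sat_in S (case_nat x e) \<psi>) \<longleftrightarrow> (\<forall>e. sat_in S e \<psi>)" for \<psi>
    proof
      assume *: "\<forall>e x. sat_in S (case_nat x e) \<psi>"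
      show "\<forall>e. sat_in S e \<psi>"
      proof
        fix e :: "nat \<Rightarrow> 'a"
        have "e = case_nat (e 0) (\<lambda>n. e (Suc n))" by (auto simp: fun_eq_iff split: nat.split)
        then show "sat_in S e \<psi>" using * by metis
      qed
    qed blast
    then show ?case using Suc by simp
  qed simp
  then show ?thesis by (simp add: univ_closure_def)
qed

lemma sat_induction_ax:
  "sat_in S e (induction_ax \<phi>) \<longleftrightarrow>
     (sat_in S (case_nat (zero_of S) e) \<phi> \<longrightarrow>
      (\<forall>x. sat_in S (case_nat x e) \<phi> \<longrightarrow> sat_in S (case_nat (succ_of S x) e) \<phi>) \<longrightarrow>
      (\<forall>x. sat_in S (case_nat x e) \<phi>))"
proof -
  have "(\<lambda>n. val_in S (case_nat x e) (case_nat (Succ (Var 0)) (\<lambda>n. Var (Suc n)) n))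
      = case_nat (succ_of S x) e" for x
    by (auto simp: fun_eq_iff split: nat.split)
  then show ?thesis by (simp add: induction_ax_def sat_inst sat_subst)
qed

definition totality :: fm
  where "totality = Forall (Forall (Exists (ackermann_graph (Var 2) (Var 1) (Var 0))))"

text \<open>
  A countermodel of the totality statement, if there is one, is made into a type, so that it can be
  an instance of type classes.
\<close>

typedef num = "UNIV :: nat set" ..

lemma bij_Abs_num: "bij Abs_num"
  by (metis UNIV_I Abs_num_inverse Rep_num_inverse bijI')

text \<open>A type class instance needs its axioms unconditionally. The standard model is the
  fallback that keeps \<open>\<MM>\<close> a model of \<open>ISigma1\<close> even if there is no
  countermodel.\<close>

lemma standard_model: "\<exists>S :: num struct. models S ISigma1"
proof
  let ?S = "\<lparr>zero_of = Abs_num 0, succ_of = (\<lambda>x. Abs_num (Suc (Rep_num x))),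
    plus_of = (\<lambda>x y. Abs_num (Rep_num x + Rep_num y)),
    times_of = (\<lambda>x y. Abs_num (Rep_num x * Rep_num y)),
    less_of = (\<lambda>x y. Rep_num x < Rep_num y)\<rparr>"
  have ind: "P x" if "P (Abs_num 0)" "\<And>x. P x \<Longrightarrow> P (Abs_num (Suc (Rep_num x)))" for P x
  proof -
    have "P (Abs_num n)" for n
      by (induction n) (use that in \<open>force simp: Abs_num_inverse\<close>)+
    then show ?thesis by (metis Rep_num_inverse)
  qed
  have "\<forall>e. sat_in ?S e (univ_closure (induction_ax \<phi>))" for \<phi>
    unfolding sat_univ_closure sat_induction_ax using ind[of "\<lambda>x. sat_in ?S (case_nat x e) \<phi>" for e] by auto
  moreover have "\<exists>z. n + Suc (Rep_num z) = m" if "n < m" for n m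
    using less_imp_Suc_add[OF that] by (metis Abs_num_inverse UNIV_I add_Suc_right)
  then have "\<forall>e. sat_in ?S e \<phi>" if "\<phi> \<in> PA_basic" for \<phi>
    using that by (auto simp: PA_basic_def Abs_num_inverse Abs_num_inject simp flip: Rep_num_inject)
  ultimately show "models ?S ISigma1" unfolding models_def ISigma1_def by blast
qed

text \<open>The second conjunct is an implication, so that the choice succeeds in every case and
  gives a countermodel whenever one exists.\<close>

definition \<MM> :: "num struct" where
  "\<MM> = (SOME S. models S ISigma1 \<and>
     ((\<exists>S :: num struct. \<exists>e. models S (ISigma1 \<union> BME_star) \<and> \<not> sat_in S e totality)
        \<longrightarrow> models S BME_star \<and> (\<exists>e. \<not> sat_in S e totality)))"

lemma models_Un: "models S (\<Gamma> \<union> \<Delta>) \<longleftrightarrow> models S \<Gamma> \<and> models S \<Delta>"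
  by (auto simp: models_def)

lemma \<MM>: "models \<MM> ISigma1"
  "models S (ISigma1 \<union> BME_star) \<Longrightarrow> \<not> sat_in S e totality \<Longrightarrow>
     models \<MM> BME_star \<and> (\<exists>e. \<not> sat_in \<MM> e totality)" for S :: "num struct"
proof -
  let ?P = "\<lambda>S :: num struct. models S ISigma1 \<and>
     ((\<exists>S :: num struct. \<exists>e. models S (ISigma1 \<union> BME_star) \<and> \<not> sat_in S e totality)
        \<longrightarrow> models S BME_star \<and> (\<exists>e. \<not> sat_in S e totality))"
  have "\<exists>S. ?P S"
    using standard_model
    by (cases "\<exists>S :: num struct. models S ISigma1 \<and> models S BME_star \<and> (\<exists>e. \<not> sat_in S e totality)")
      (auto simp: models_Un)
  then have "?P \<MM>" unfolding \<MM>_def by (rule someI_ex)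
  then show "models \<MM> ISigma1"
    "models S (ISigma1 \<union> BME_star) \<Longrightarrow> \<not> sat_in S e totality \<Longrightarrow>
     models \<MM> BME_star \<and> (\<exists>e. \<not> sat_in \<MM> e totality)" for S :: "num struct" and e
    by blast+
qed

instantiation num :: "{zero, one, plus, times, ord}"
begin
definition "0 = zero_of \<MM>"
definition "1 = succ_of \<MM> 0"
definition "x + y = plus_of \<MM> x y"
definition "x * y = times_of \<MM> x y"
definition "x < y \<longleftrightarrow> less_of \<MM> x y"
definition "x \<le> y \<longleftrightarrow> x < y \<or> x = (y :: num)"
instance ..
end

lemma PA:
  fixes x y :: num
  shows "succ_of \<MM> x \<noteq> 0"
    and "succ_of \<MM> x = succ_of \<MM> y \<Longrightarrow> x = y"
    and "x + 0 = x"
    and "x + succ_of \<MM> y = succ_of \<MM> (x + y)"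
    and "x * 0 = 0"
    and "x * succ_of \<MM> y = x * y + x"
    and "x < y \<longleftrightarrow> (\<exists>z. x + succ_of \<MM> z = y)"
proof -
  have "\<forall>\<phi>\<in>PA_basic. \<forall>e. sat_in \<MM> e \<phi>"
    using \<MM>(1) by (simp add: models_Un ISigma1_def) (simp add: models_def)
  then show "succ_of \<MM> x \<noteq> 0" "succ_of \<MM> x = succ_of \<MM> y \<Longrightarrow> x = y" "x + 0 = x"
    "x + succ_of \<MM> y = succ_of \<MM> (x + y)" "x * 0 = 0" "x * succ_of \<MM> y = x * y + x"
    "x < y \<longleftrightarrow> (\<exists>z. x + succ_of \<MM> z = y)"
    by (simp_all add: PA_basic_def zero_num_def plus_num_def times_num_def less_num_def)
qed

lemma succ_of: "succ_of \<MM> x = x + 1"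
  by (simp add: one_num_def PA(3,4))

lemmas Peano = PA[unfolded succ_of]

abbreviation val :: "(nat \<Rightarrow> num) \<Rightarrow> tm \<Rightarrow> num" where "val \<equiv> val_in \<MM>"
abbreviation sat :: "(nat \<Rightarrow> num) \<Rightarrow> fm \<Rightarrow> bool" where "sat \<equiv> sat_in \<MM>"

lemma val_simps [simp]:
  "val e Zero = 0" "val e (Succ t) = val e t + 1"
  "val e (t \<^bold>+ u) = val e t + val e u" "val e (t \<^bold>* u) = val e t * val e u"
  by (simp_all add: zero_num_def succ_of plus_num_def times_num_def)

lemma sat_Less [simp]: "sat e (t \<^bold>< u) \<longleftrightarrow> val e t < val e u"
  by (simp add: less_num_def)

declare val_in.simps(2-5) [simp del] sat_in.simps(2) [simp del]

lemma sat_bounded [simp]: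
  "sat e (BForall t \<phi>) \<longleftrightarrow> (\<forall>x<val e t. sat (case_nat x e) \<phi>)"
  "sat e (BExists t \<phi>) \<longleftrightarrow> (\<exists>x<val e t. sat (case_nat x e) \<phi>)"
  by (simp_all add: BForall_def BExists_def)

section \<open>Definable predicates\<close>

text \<open>Predicates of environments; elements of the model may occur as constants.\<close>

inductive Tm :: "((nat \<Rightarrow> num) \<Rightarrow> num) \<Rightarrow> bool" where
  Tm_var: "Tm (\<lambda>e. e n)"
| Tm_const: "Tm (\<lambda>e. c)"
| Tm_plus: "Tm f \<Longrightarrow> Tm g \<Longrightarrow> Tm (\<lambda>e. f e + g e)"
| Tm_times: "Tm f \<Longrightarrow> Tm g \<Longrightarrow> Tm (\<lambda>e. f e * g e)"

text \<open>Definability is tracked on HOL predicates, with rules that follow their shape; actual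
  formulas are produced only by \<open>D0_rep\<close> and \<open>S1_rep\<close>.\<close>

inductive D0 :: "((nat \<Rightarrow> num) \<Rightarrow> bool) \<Rightarrow> bool" where
  D0_eq: "Tm f \<Longrightarrow> Tm g \<Longrightarrow> D0 (\<lambda>e. f e = g e)"
| D0_less: "Tm f \<Longrightarrow> Tm g \<Longrightarrow> D0 (\<lambda>e. f e < g e)"
| D0_False: "D0 (\<lambda>e. False)"
| D0_imp: "D0 P \<Longrightarrow> D0 Q \<Longrightarrow> D0 (\<lambda>e. P e \<longrightarrow> Q e)"
| D0_ball': "Tm f \<Longrightarrow> D0 P \<Longrightarrow> D0 (\<lambda>e. \<forall>x<f e. P (case_nat x e))"

inductive S1 :: "((nat \<Rightarrow> num) \<Rightarrow> bool) \<Rightarrow> bool" where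
  S1_D0: "D0 P \<Longrightarrow> S1 P"
| S1_ex': "S1 P \<Longrightarrow> S1 (\<lambda>e. \<exists>x. P (case_nat x e))"

lemma D0_not: "D0 P \<Longrightarrow> D0 (\<lambda>e. \<not> P e)"
  using D0_imp[OF _ D0_False] by simp

lemma D0_disj: "D0 P \<Longrightarrow> D0 Q \<Longrightarrow> D0 (\<lambda>e. P e \<or> Q e)"
  using D0_imp[OF D0_not[of P], of Q] by (simp add: disj_imp)

lemma D0_conj: "D0 P \<Longrightarrow> D0 Q \<Longrightarrow> D0 (\<lambda>e. P e \<and> Q e)"
  using D0_not[OF D0_imp[OF _ D0_not[of Q]], of P] by simp

lemma D0_le: "Tm f \<Longrightarrow> Tm g \<Longrightarrow> D0 (\<lambda>e. f e \<le> g e)"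
  using D0_disj[OF D0_less[of f g] D0_eq[of f g]] by (simp add: less_eq_num_def)

text \<open>A form of the rule that higher-order unification can apply to any bounded quantifier:
  the body depends on the bound variable and the old environment separately, and the premise reads
  them off as head and tail of the new one.\<close>

lemma D0_ball: "Tm f \<Longrightarrow> D0 (\<lambda>e. P (e 0) (\<lambda>n. e (Suc n))) \<Longrightarrow> D0 (\<lambda>e. \<forall>x<f e. P x e)"
  using D0_ball'[of f "\<lambda>e. P (e 0) (\<lambda>n. e (Suc n))"] by simp

lemma D0_bex: "Tm f \<Longrightarrow> D0 (\<lambda>e. P (e 0) (\<lambda>n. e (Suc n))) \<Longrightarrow> D0 (\<lambda>e. \<exists>x<f e. P x e)"
  using D0_not[OF D0_ball[of f "\<lambda>x e. \<not> P x e"]] D0_not[of "\<lambda>e. P (e 0) (\<lambda>n. e (Suc n))"] by simp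

lemma S1_ex: "S1 (\<lambda>e. P (e 0) (\<lambda>n. e (Suc n))) \<Longrightarrow> S1 (\<lambda>e. \<exists>x. P x e)"
  using S1_ex'[of "\<lambda>e. P (e 0) (\<lambda>n. e (Suc n))"] by simp

lemma Tm_comp: "Tm f \<Longrightarrow> (\<And>n. Tm (\<sigma> n)) \<Longrightarrow> Tm (\<lambda>e. f (\<lambda>n. \<sigma> n e))"
  by (induction rule: Tm.induct) (auto intro: Tm.intros)

text \<open>Closure under substitution of terms. With its instances below, a defined predicate is
  unfolded once, for variables, and then used with arbitrary terms.\<close>

lemma D0_comp: "D0 P \<Longrightarrow> (\<And>n. Tm (\<sigma> n)) \<Longrightarrow> D0 (\<lambda>e. P (\<lambda>n. \<sigma> n e))"
proof (induction arbitrary: \<sigma> rule: D0.induct)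
  case (D0_ball' f P)
  define \<tau> where "\<tau> = case_nat (\<lambda>e :: nat \<Rightarrow> num. e 0) (\<lambda>n e. \<sigma> n (\<lambda>n. e (Suc n)))"
  have "Tm (\<tau> n)" for n
    using Tm_comp[OF D0_ball'.prems, of "\<lambda>n e. e (Suc n)"]
    by (auto simp: \<tau>_def intro: Tm_var split: nat.split)
  then have "D0 (\<lambda>e. P (\<lambda>n. \<tau> n e))" by (rule D0_ball'.IH)
  moreover have "(\<lambda>n. \<tau> n e) = case_nat (e 0) (\<lambda>n. \<sigma> n (\<lambda>n. e (Suc n)))" for e
    by (auto simp: \<tau>_def fun_eq_iff split: nat.split)
  ultimately have "D0 (\<lambda>e. P (case_nat (e 0) (\<lambda>n. \<sigma> n (\<lambda>n. e (Suc n)))))" by simp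
  then show ?case
    using D0_ball[of "\<lambda>e. f (\<lambda>n. \<sigma> n e)" "\<lambda>x e. P (case_nat x (\<lambda>n. \<sigma> n e))"] Tm_comp D0_ball'
    by simp
qed (simp_all add: D0.intros Tm_comp)

lemma D0_comp1: "D0 (\<lambda>e. P (e 0)) \<Longrightarrow> Tm f \<Longrightarrow> D0 (\<lambda>e. P (f e))"
  using D0_comp[of "\<lambda>e. P (e 0)" "\<lambda>n. f"] by simp

lemma D0_comp2: "D0 (\<lambda>e. P (e 0) (e 1)) \<Longrightarrow> Tm f \<Longrightarrow> Tm g \<Longrightarrow> D0 (\<lambda>e. P (f e) (g e))"
  using D0_comp[of "\<lambda>e. P (e 0) (e 1)" "\<lambda>n. if n = 0 then f else g"] by simp

lemma D0_comp3:
  "D0 (\<lambda>e. P (e 0) (e 1) (e 2)) \<Longrightarrow> Tm f \<Longrightarrow> Tm g \<Longrightarrow> Tm h \<Longrightarrow> D0 (\<lambda>e. P (f e) (g e) (h e))"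
  using D0_comp[of "\<lambda>e. P (e 0) (e 1) (e 2)" "\<lambda>n. if n = 0 then f else if n = 1 then g else h"]
  by simp

lemma D0_comp4:
  "D0 (\<lambda>e. P (e 0) (e 1) (e 2) (e 3)) \<Longrightarrow> Tm f \<Longrightarrow> Tm g \<Longrightarrow> Tm h \<Longrightarrow> Tm k \<Longrightarrow>
     D0 (\<lambda>e. P (f e) (g e) (h e) (k e))"
  using D0_comp[of "\<lambda>e. P (e 0) (e 1) (e 2) (e 3)"
    "\<lambda>n. if n = 0 then f else if n = 1 then g else if n = 2 then h else k"]
  by simp

text \<open>
  In a formula for a definable predicate, the map \<open>h\<close> sends the variables to the entries of the
  environment and to the constants.
\<close>

abbreviation fill :: "(nat \<Rightarrow> nat + num) \<Rightarrow> (nat \<Rightarrow> num) \<Rightarrow> nat \<Rightarrow> num"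
  where "fill h e n \<equiv> case_sum e id (h n)"

text \<open>Two formulas come with separate maps for their variables. Even and odd indices keep
  these apart when the formulas are combined.\<close>

definition merge :: "(nat \<Rightarrow> 'a) \<Rightarrow> (nat \<Rightarrow> 'a) \<Rightarrow> nat \<Rightarrow> 'a"
  where "merge h k n = (if even n then h (n div 2) else k (n div 2))"

lemma merge_simps [simp]: "merge h k (2 * n) = h n" "merge h k (Suc (2 * n)) = k n"
  by (simp_all add: merge_def)

lemma Tm_rep: "Tm f \<Longrightarrow> \<exists>t h. \<forall>e. f e = val (fill h e) t"
proof (induction rule: Tm.induct)
  case (Tm_var n)
  show ?case by (rule exI[of _ "Var 0"], rule exI[of _ "\<lambda>_. Inl n"]) simp
next
  case (Tm_const c)
  show ?case by (rule exI[of _ "Var 0"], rule exI[of _ "\<lambda>_. Inr c"]) simp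
next
  case (Tm_plus f g)
  then obtain t h u k where "\<forall>e. f e = val (fill h e) t" "\<forall>e. g e = val (fill k e) u" by blast
  then show ?case
    by (intro exI[of _ "subst_tm (\<lambda>n. Var (2 * n)) t \<^bold>+ subst_tm (\<lambda>n. Var (Suc (2 * n))) u"]
        exI[of _ "merge h k"]) (simp add: val_subst_tm)
next
  case (Tm_times f g)
  then obtain t h u k where "\<forall>e. f e = val (fill h e) t" "\<forall>e. g e = val (fill k e) u" by blast
  then show ?case
    by (intro exI[of _ "subst_tm (\<lambda>n. Var (2 * n)) t \<^bold>* subst_tm (\<lambda>n. Var (Suc (2 * n))) u"]
        exI[of _ "merge h k"]) (simp add: val_subst_tm)
qed

lemma delta0_subst: "delta0 \<phi> \<Longrightarrow> delta0 (subst \<phi> \<sigma>)"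
proof (induction arbitrary: \<sigma> rule: delta0.induct)
  case (5 \<phi> t)
  have "subst_tm (lift \<sigma>) (up (Suc 0) t) = up (Suc 0) (subst_tm \<sigma> t)"
    by (simp add: up_def subst_tm_subst_tm)
  then have "subst (BForall t \<phi>) \<sigma> = BForall (subst_tm \<sigma> t) (subst \<phi> (lift \<sigma>))"
    by (simp add: BForall_def)
  then show ?case using 5 by (simp add: delta0.intros)
qed (auto intro: delta0.intros)

lemma sigma1_subst: "sigma1 \<phi> \<Longrightarrow> sigma1 (subst \<phi> \<sigma>)"
proof (induction arbitrary: \<sigma> rule: sigma1.induct)
  case (2 \<phi>)
  have "subst (Exists \<phi>) \<sigma> = Exists (subst \<phi> (lift \<sigma>))" by (simp add: Exists_def)
  then show ?case using 2 by (simp add: sigma1.intros(2))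
qed (simp add: sigma1.intros(1) delta0_subst)

text \<open>Several variables may stand for entry 0 of the environment. When that entry is
  quantified, all of them have to become the bound variable.\<close>

definition front :: "(nat \<Rightarrow> nat + num) \<Rightarrow> nat \<Rightarrow> tm" where
  "front h n = (if h n = Inl 0 then Var 0 else Var (Suc n))"

text \<open>The truncated \<open>0 - 1\<close> arises only for variables standing for entry 0, and
  \<open>front\<close> redirects exactly those to \<open>Var 0\<close>.\<close>

definition pop :: "(nat \<Rightarrow> nat + num) \<Rightarrow> nat \<Rightarrow> nat + num" where
  "pop h n = map_sum (\<lambda>k. k - 1) id (h n)"

lemma fill_case_nat: "fill h (case_nat x e) = (\<lambda>n. val (case_nat x (fill (pop h) e)) (front h n))"
  by (auto simp: fun_eq_iff front_def pop_def split: sum.split nat.split)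

lemma D0_rep: "D0 P \<Longrightarrow> \<exists>\<phi> h. delta0 \<phi> \<and> (\<forall>e. P e \<longleftrightarrow> sat (fill h e) \<phi>)"
proof (induction rule: D0.induct)
  case (D0_eq f g)
  then obtain t h u k where "\<forall>e. f e = val (fill h e) t" "\<forall>e. g e = val (fill k e) u"
    using Tm_rep by metis
  then show ?case
    by (intro exI[of _ "subst_tm (\<lambda>n. Var (2 * n)) t \<^bold>= subst_tm (\<lambda>n. Var (Suc (2 * n))) u"]
        exI[of _ "merge h k"]) (simp add: val_subst_tm delta0.intros)
next
  case (D0_less f g)
  then obtain t h u k where "\<forall>e. f e = val (fill h e) t" "\<forall>e. g e = val (fill k e) u"
    using Tm_rep by metis
  then show ?case
    by (intro exI[of _ "subst_tm (\<lambda>n. Var (2 * n)) t \<^bold>< subst_tm (\<lambda>n. Var (Suc (2 * n))) u"]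
        exI[of _ "merge h k"]) (simp add: val_subst_tm delta0.intros)
next
  case D0_False
  show ?case by (rule exI[of _ Fls]) (auto intro: delta0.intros)
next
  case (D0_imp P Q)
  then obtain \<phi> h \<psi> k where "delta0 \<phi>" "\<forall>e. P e \<longleftrightarrow> sat (fill h e) \<phi>"
    "delta0 \<psi>" "\<forall>e. Q e \<longleftrightarrow> sat (fill k e) \<psi>"
    by auto
  then show ?case
    by (intro exI[of _ "subst \<phi> (\<lambda>n. Var (2 * n)) \<^bold>\<rightarrow> subst \<psi> (\<lambda>n. Var (Suc (2 * n)))"]
        exI[of _ "merge h k"]) (simp add: sat_subst delta0.intros delta0_subst)
next
  case (D0_ball' f P)
  then obtain \<phi> h where \<phi>: "delta0 \<phi>" "\<forall>e. P e \<longleftrightarrow> sat (fill h e) \<phi>" by auto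
  obtain t k where t: "\<forall>e. f e = val (fill k e) t" using Tm_rep D0_ball' by metis
  \<comment> \<open>Below the new quantifier, \<open>Var 0\<close> stays bound, and the other
    variables go to the odd places of the merged map, shifted by one; the even places belong to the
    bounding term.\<close>
  let ?\<psi> = "subst \<phi> (\<lambda>n. subst_tm (case_nat (Var 0) (\<lambda>n. Var (Suc (Suc (2 * n))))) (front h n))"
  have *: "(\<lambda>n. val (case_nat x (fill (merge k (pop h)) e))
      (subst_tm (case_nat (Var 0) (\<lambda>n. Var (Suc (Suc (2 * n))))) (front h n))) = fill h (case_nat x e)" for x e
    by (auto simp: fun_eq_iff fill_case_nat front_def)
  have "sat (case_nat x (fill (merge k (pop h)) e)) ?\<psi> \<longleftrightarrow> P (case_nat x e)" for x e
    by (simp add: \<phi>(2) sat_subst *)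
  then show ?case
    by (intro exI[of _ "BForall (subst_tm (\<lambda>n. Var (2 * n)) t) ?\<psi>"] exI[of _ "merge k (pop h)"])
      (simp add: \<phi>(1) t val_subst_tm delta0.intros delta0_subst)
qed

lemma S1_rep: "S1 P \<Longrightarrow> \<exists>\<phi> h. sigma1 \<phi> \<and> (\<forall>e. P e \<longleftrightarrow> sat (fill h e) \<phi>)"
proof (induction rule: S1.induct)
  case (S1_D0 P)
  then show ?case using D0_rep sigma1.intros(1) by blast
next
  case (S1_ex' P)
  then obtain \<phi> h where \<phi>: "sigma1 \<phi>" "\<forall>e. P e \<longleftrightarrow> sat (fill h e) \<phi>" by auto
  then show ?case
    by (intro exI[of _ "Exists (subst \<phi> (front h))"] exI[of _ "pop h"])
      (simp add: sat_subst fill_case_nat sigma1_subst sigma1.intros(2))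
qed

text \<open>The point where the induction axioms of the theory are applied; constants of the model
  enter as values of the parameters.\<close>

lemma S1_induct:
  assumes "S1 (\<lambda>e. P (e 0))" and "P 0" and "\<And>x. P x \<Longrightarrow> P (x + 1)"
  shows "P x"
proof -
  obtain \<phi> h where \<phi>: "sigma1 \<phi>" "\<forall>e. P (e 0) \<longleftrightarrow> sat (fill h e) \<phi>"
    using S1_rep[OF assms(1)] by auto
  let ?\<phi> = "subst \<phi> (front h)"
  \<comment> \<open>Only entry 0 matters for the predicate, so the tail of the environment is
    arbitrary.\<close>
  define d :: "nat \<Rightarrow> num" where "d = (\<lambda>_. 0)"
  have P: "sat (case_nat x (fill (pop h) d)) ?\<phi> \<longleftrightarrow> P x" for x
    using \<phi>(2)[rule_format, of "case_nat x d"] by (simp add: sat_subst fill_case_nat)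
  have "univ_closure (induction_ax ?\<phi>) \<in> ISigma1"
    using sigma1_subst[OF \<phi>(1)] by (auto simp: ISigma1_def)
  then have "\<forall>e. sat e (univ_closure (induction_ax ?\<phi>))"
    using \<MM>(1) unfolding models_def by blast
  then have "sat (fill (pop h) d) (induction_ax ?\<phi>)" unfolding sat_univ_closure ..
  then have "P x" unfolding sat_induction_ax P
    using assms(2,3) by (simp add: succ_of zero_num_def)
  then show ?thesis .
qed

lemma D0_induct: "D0 (\<lambda>e. P (e 0)) \<Longrightarrow> P 0 \<Longrightarrow> (\<And>x. P x \<Longrightarrow> P (x + 1)) \<Longrightarrow> P x"
  by (rule S1_induct[OF S1_D0])

section \<open>Arithmetic in the model\<close>

named_theorems D0_intros

lemmas [D0_intros] = Tm.intros D0_eq D0_less D0_le D0_False D0_imp D0_not D0_disj D0_conj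
  D0_ball D0_bex

lemma num_add_assoc: "(x + y) + z = x + (y + z)" for x :: num
proof (rule D0_induct[of "\<lambda>z. (x + y) + z = x + (y + z)"])
  show "D0 (\<lambda>e. (x + y) + e 0 = x + (y + e 0))" by (intro D0_intros)
qed (simp_all add: Peano(3,4))

lemma num_0_add: "0 + x = x" for x :: num
proof (rule D0_induct[of "\<lambda>x. 0 + x = x"])
  show "D0 (\<lambda>e. 0 + e 0 = e 0)" by (intro D0_intros)
qed (simp_all add: Peano(3,4))

lemma num_1_add: "1 + x = x + 1" for x :: num
proof (rule D0_induct[of "\<lambda>x. 1 + x = x + 1"])
  show "D0 (\<lambda>e. 1 + e 0 = e 0 + 1)" by (intro D0_intros)
qed (simp_all add: Peano(3,4) num_0_add)

lemma num_add_commute: "x + y = y + x" for x :: num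
proof (rule D0_induct[of "\<lambda>y. x + y = y + x"])
  show "D0 (\<lambda>e. x + e 0 = e 0 + x)" by (intro D0_intros)
  show "x + (y + 1) = y + 1 + x" if "x + y = y + x" for y
    using that by (simp add: num_add_assoc num_1_add) (simp flip: num_add_assoc)
qed (simp_all add: Peano(3,4) num_0_add)

lemma num_add_left_commute: "x + (y + z) = y + (x + z)" for x :: num
  by (metis num_add_assoc num_add_commute)

lemmas num_ac = num_add_assoc num_add_commute num_add_left_commute

lemma num_0_mult: "0 * x = 0" for x :: num
proof (rule D0_induct[of "\<lambda>x. 0 * x = 0"])
  show "D0 (\<lambda>e. 0 * e 0 = 0)" by (intro D0_intros)
qed (simp_all add: Peano(3,5,6))

lemma num_add_mult: "(x + y) * z = x * z + y * z" for x :: num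
proof (rule D0_induct[of "\<lambda>z. (x + y) * z = x * z + y * z"])
  show "D0 (\<lambda>e. (x + y) * e 0 = x * e 0 + y * e 0)" by (intro D0_intros)
  show "(x + y) * (z + 1) = x * (z + 1) + y * (z + 1)" if "(x + y) * z = x * z + y * z" for z
    using that by (simp only: Peano(6)) (simp add: num_ac)
qed (simp add: Peano(3,5))

lemma num_1_mult: "1 * x = x" for x :: num
proof (rule D0_induct[of "\<lambda>x. 1 * x = x"])
  show "D0 (\<lambda>e. 1 * e 0 = e 0)" by (intro D0_intros)
qed (simp_all add: Peano(5,6))

lemma num_mult_commute: "x * y = y * x" for x :: num
proof (rule D0_induct[of "\<lambda>y. x * y = y * x"])
  show "D0 (\<lambda>e. x * e 0 = e 0 * x)" by (intro D0_intros)
qed (simp_all add: Peano(5,6) num_0_mult num_add_mult num_1_mult)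

lemma num_mult_assoc: "(x * y) * z = x * (y * z)" for x :: num
proof (rule D0_induct[of "\<lambda>z. (x * y) * z = x * (y * z)"])
  show "D0 (\<lambda>e. (x * y) * e 0 = x * (y * e 0))" by (intro D0_intros)
  show "(x * y) * (z + 1) = x * (y * (z + 1))" if "(x * y) * z = x * (y * z)" for z
    using that num_add_mult[of "y * z" y x] by (simp add: Peano(6) num_mult_commute[of _ x])
qed (simp add: Peano(5))

lemma num_add_right_cancel_imp: "x + z = y + z \<longrightarrow> x = y" for x :: num
proof (rule D0_induct[of "\<lambda>z. x + z = y + z \<longrightarrow> x = y"])
  show "D0 (\<lambda>e. x + e 0 = y + e 0 \<longrightarrow> x = y)" by (intro D0_intros)
  show "x + (z + 1) = y + (z + 1) \<longrightarrow> x = y" if "x + z = y + z \<longrightarrow> x = y" for z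
    using that Peano(2)[of "x + z" "y + z"] by (simp add: num_add_assoc)
qed (auto simp: Peano(3))

lemmas num_add_right_cancel = num_add_right_cancel_imp[rule_format]

lemma num_less: "x < y \<longleftrightarrow> (\<exists>z. y = x + (z + 1))" for x :: num
  using Peano(7)[of x y] by auto

lemma num_cases:
  fixes x :: num
  obtains "x = 0" | w where "x = w + 1"
proof -
  \<comment> \<open>The bound on \<open>w\<close> is there to make the induction statement
    Delta_0.\<close>
  have "x = 0 \<or> (\<exists>w<x+1. x = w + 1)"
  proof (rule D0_induct[of "\<lambda>x. x = 0 \<or> (\<exists>w<x+1. x = w + 1)"])
    show "D0 (\<lambda>e. e 0 = 0 \<or> (\<exists>w<e 0 + 1. e 0 = w + 1))" by (intro D0_intros)
    show "x + 1 = 0 \<or> (\<exists>w<x + 1 + 1. x + 1 = w + 1)" for x :: num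
      using num_less[of x "x + 1 + 1"] by (auto simp: num_add_assoc num_0_add intro: exI[of _ x] exI[of _ 0])
  qed simp
  then show ?thesis using that by blast
qed

lemma num_le: "x \<le> y \<longleftrightarrow> (\<exists>z. y = x + z)" for x :: num
proof
  assume "\<exists>z. y = x + z"
  then obtain z where z: "y = x + z" ..
  show "x \<le> y" using z by (cases z rule: num_cases) (auto simp: less_eq_num_def num_less Peano(3))
qed (auto simp: less_eq_num_def num_less Peano(3) intro: exI[of _ 0])

lemma num_add_eq_0: "x + y = 0 \<Longrightarrow> y = 0" for x :: num
  by (cases y rule: num_cases) (simp_all add: Peano(1) flip: num_add_assoc)

lemma num_antisym: "x \<le> y \<Longrightarrow> y \<le> x \<Longrightarrow> x = y" for x :: num
proof -
  assume "x \<le> y" "y \<le> x"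
  then obtain u v where "y = x + u" "x = y + v" by (auto simp: num_le)
  then have "0 + x = (u + v) + x" by (metis num_add_assoc num_add_commute num_0_add)
  then have "u + v = 0" using num_add_right_cancel by metis
  then show "x = y" using num_add_eq_0[of u v] \<open>x = y + v\<close> by (simp add: Peano(3))
qed

lemma num_linear: "x \<le> y \<or> y \<le> x" for x :: num
proof (rule D0_induct[of "\<lambda>y. x \<le> y \<or> y \<le> x"])
  show "D0 (\<lambda>e. x \<le> e 0 \<or> e 0 \<le> x)" by (intro D0_intros)
  show "x \<le> 0 \<or> 0 \<le> x" by (auto simp: num_le num_0_add)
  show "x \<le> y + 1 \<or> y + 1 \<le> x" if "x \<le> y \<or> y \<le> x" for y
  proof (cases "x \<le> y")
    case True
    then show ?thesis by (auto simp: num_le num_add_assoc)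
  next
    case False
    then have "y < x" using that by (auto simp: less_eq_num_def)
    then show ?thesis by (auto simp: num_le num_less num_ac)
  qed
qed

instantiation num :: linordered_semidom
begin

text \<open>The class asks for truncated subtraction: cancellation justifies \<open>THE\<close>, and
  0 is the value if \<open>y\<close> exceeds \<open>x\<close>.\<close>

definition "x - y = (if y \<le> x then THE z. y + z = x else 0)" for x y :: num

instance
proof
  fix a b c :: num
  show "a + b + c = a + (b + c)" by (rule num_add_assoc)
  show "a + b = b + a" by (rule num_add_commute)
  show "0 + a = a" by (rule num_0_add)
  show "a * b * c = a * (b * c)" by (rule num_mult_assoc)
  show "a * b = b * a" by (rule num_mult_commute)
  show "1 * a = a" by (rule num_1_mult)
  show "(a + b) * c = a * c + b * c" by (rule num_add_mult)
  show "(0::num) \<noteq> 1" using Peano(1)[of 0] by (simp add: num_0_add)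
  show diff: "a + b - a = b" for a b :: num
  proof -
    have "(THE z. a + z = a + b) = b"
      by (rule the_equality) (use num_add_right_cancel num_add_commute in metis)+
    then show ?thesis by (auto simp: minus_num_def num_le)
  qed
  have sub: "b + (a - b) = a" if "b \<le> a" for a b :: num using that diff by (auto simp: num_le)
  show le_add: "a - b + b = a" if "b \<le> a" for a b :: num using sub[OF that] by (simp add: num_add_commute)
  show "a - b - c = a - (b + c)"
  proof (cases "b + c \<le> a")
    case True
    then obtain z where "a = b + (c + z)" by (auto simp: num_le num_add_assoc)
    then show ?thesis using diff by (metis num_add_assoc)
  next
    case False
    have "\<not> c \<le> a - b" if "b \<le> a"
    proof
      assume "c \<le> a - b"
      then obtain z where "a - b = c + z" by (auto simp: num_le)
      then have "a = b + c + z" using sub[OF that] by (simp add: num_add_assoc)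
      then show False using False by (auto simp: num_le)
    qed
    moreover have "c \<le> 0 \<Longrightarrow> c = 0" using num_antisym[of c 0] by (auto simp: num_le num_0_add)
    then have "(0 :: num) - c = 0" using diff[of 0 0] by (auto simp: minus_num_def num_0_add)
    ultimately show ?thesis using False by (auto simp: minus_num_def[of a] minus_num_def[of _ c])
  qed
  show "a * b \<noteq> 0" if nz: "a \<noteq> 0" "b \<noteq> 0"
  proof -
    have pos: "\<exists>z. a = z + 1" if "a \<noteq> 0" for a :: num
      using that num_cases by metis
    obtain x y where "a = x + 1" "b = y + 1" using pos[OF nz(1)] pos[OF nz(2)] by blast
    then show ?thesis using Peano(1) by (auto simp: Peano(6) simp flip: num_add_assoc)
  qed
  show "a \<le> a" by (simp add: less_eq_num_def)
  show "a \<le> c" if "a \<le> b" "b \<le> c" using that by (auto simp: num_le num_add_assoc)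
  show antisym: "a = b" if "a \<le> b" "b \<le> a" using num_antisym that .
  show "a \<le> b \<or> b \<le> a" by (rule num_linear)
  have irrefl: "\<not> a < a" for a :: num
  proof
    assume "a < a"
    then obtain z where "0 + a = (z + 1) + a" by (auto simp: num_less num_add_commute num_0_add)
    then show False using num_add_right_cancel Peano(1) by metis
  qed
  show "a < b \<longleftrightarrow> a \<le> b \<and> \<not> b \<le> a"
    using antisym irrefl by (auto simp: less_eq_num_def)
  show "c + a \<le> c + b" if "a \<le> b" using that by (auto simp: num_le num_add_assoc)
  show "c * a < c * b" if *: "a < b" "0 < c"
  proof -
    obtain x y where "c = x + 1" "b = a + (y + 1)"
      using *(1) *(2)[unfolded num_less num_0_add] by (auto simp: num_less)
    have "c * b = c * a + c * (y + 1)"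
      unfolding \<open>b = a + (y + 1)\<close> by (simp only: num_mult_commute[of c] num_add_mult)
    also have "c * (y + 1) = (c * y + x) + 1" by (simp only: Peano(6) num_add_assoc \<open>c = x + 1\<close>)
    finally show ?thesis by (auto simp: num_less)
  qed
  show "(0::num) < 1" by (auto simp: num_less num_0_add intro: exI[of _ 0])
  show distrib: "a * (b + c) = a * b + a * c" for a b c :: num
    by (simp only: num_mult_commute[of a] num_add_mult)
  show "a * (b - c) = a * b - a * c"
  proof (cases "c \<le> b")
    case True
    then obtain z where "b = c + z" by (auto simp: num_le)
    then show ?thesis by (simp add: diff distrib)
  next
    case False
    then obtain z where z: "c = b + z" using num_linear[of b c] by (auto simp: num_le)
    have "x - (x + y) = 0" for x y :: num
    proof (cases "x + y \<le> x")
      case True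
      then have "x + y = x" using num_antisym by (metis num_le)
      then show ?thesis using diff[of x 0] by (simp add: Peano(3))
    qed (simp add: minus_num_def)
    then show ?thesis unfolding z distrib by (simp add: Peano(5))
  qed
qed (simp_all add: num_0_mult Peano(5))

end

lemma num_zero_le [simp]: "0 \<le> (x :: num)"
  by (auto simp: num_le)

lemma num_less_iff: "x < y \<longleftrightarrow> x + 1 \<le> y" for x :: num
  by (auto simp: num_less num_le add_ac)

lemma num_le_iff: "x \<le> y \<longleftrightarrow> x < y + 1" for x :: num
  by (simp add: num_less_iff)

lemma num_not_less_0 [simp]: "\<not> x < 0" for x :: num
  by (simp add: not_less)

lemma num_le_0 [simp]: "x \<le> 0 \<longleftrightarrow> x = 0" for x :: num
  by (simp add: order.eq_iff)

lemma num_less_add1 [simp]: "x < y + 1 \<longleftrightarrow> x \<le> y" "x < 1 + y \<longleftrightarrow> x \<le> y" for x :: num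
  by (simp_all add: num_less_iff add.commute)

lemma num_less_1 [simp]: "x < 1 \<longleftrightarrow> x = 0" for x :: num
  using num_le_iff[of x 0] by simp

lemma num_add_eq_0_iff [simp]: "x + y = 0 \<longleftrightarrow> x = 0 \<and> y = 0" for x :: num
  by (simp add: add_nonneg_eq_0_iff)

lemma num_pos [simp]: "0 < x \<longleftrightarrow> x \<noteq> 0" for x :: num
  by (simp add: less_le)

lemma num_mult_ge [simp]: "y \<noteq> 0 \<Longrightarrow> x \<le> x * y" "y \<noteq> 0 \<Longrightarrow> x \<le> y * x" for x :: num
  by (cases y rule: num_cases; simp add: algebra_simps)+

text \<open>Induction on the statement that no number below \<open>x\<close> satisfies
  \<open>P\<close>, which is Delta_0 together with \<open>P\<close>.\<close>

lemma D0_least: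
  assumes "D0 (\<lambda>e. P (e 0))" and "P x"
  shows "\<exists>y. P y \<and> (\<forall>z<y. \<not> P z)"
proof (rule ccontr)
  assume *: "\<not> ?thesis"
  have "\<forall>z<x+1. \<not> P z"
  proof (rule D0_induct[of "\<lambda>x. \<forall>z<x. \<not> P z"])
    show "D0 (\<lambda>e. \<forall>z<e 0. \<not> P z)"
      by (intro D0_intros D0_comp1[OF assms(1)])
    show "\<forall>z<y+1. \<not> P z" if "\<forall>z<y. \<not> P z" for y
      using that * by (metis num_less_add1(1) order.order_iff_strict)
  qed simp
  then show False using assms(2) by simp
qed

lemma D0_less_induct:
  assumes "D0 (\<lambda>e. P (e 0))" and "\<And>x. (\<And>y. y < x \<Longrightarrow> P y) \<Longrightarrow> P x"
  shows "P x"
  using D0_least[of "\<lambda>x. \<not> P x" x] assms(2) D0_not[OF assms(1)] by blast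

lemma D0_greatest:
  assumes "D0 (\<lambda>e. P (e 0))" and "P x" and "\<And>y. P y \<Longrightarrow> y \<le> b"
  shows "\<exists>y. P y \<and> (\<forall>z. P z \<longrightarrow> z \<le> y)"
proof -
  have "D0 (\<lambda>e. \<forall>z<b+1. P z \<longrightarrow> z \<le> e 0)"
    by (intro D0_intros D0_comp1[OF assms(1)])
  moreover have "\<forall>z<b+1. P z \<longrightarrow> z \<le> b" by simp
  ultimately obtain y where y: "\<forall>z<b+1. P z \<longrightarrow> z \<le> y" "\<forall>w<y. \<not> (\<forall>z<b+1. P z \<longrightarrow> z \<le> w)"
    using D0_least[of "\<lambda>y. \<forall>z<b+1. P z \<longrightarrow> z \<le> y" b] by blast
  \<comment> \<open>The least upper bound is attained: otherwise its predecessor would be an upper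
    bound as well.\<close>
  have "P y"
  proof (cases y rule: num_cases)
    case 1
    then show ?thesis using y(1) assms(2,3) by (metis num_le_0 num_less_add1(1))
  next
    case (2 w)
    then obtain z where "P z" "w < z" using y(2) by (auto simp: not_le)
    then show ?thesis using y(1) assms(3) 2 by (metis num_less_add1(1) num_less_iff order.antisym)
  qed
  then show ?thesis using y(1) assms(3) by (metis num_less_add1(1))
qed

section \<open>Finite sequences and finite sets coded in the model\<close>

section \<open>Pairs and remainders\<close>

lemma num_less_cases: "x < y + 1 \<Longrightarrow> (x < y \<Longrightarrow> P) \<Longrightarrow> (x = y \<Longrightarrow> P) \<Longrightarrow> P" for x :: num
  by (auto simp: order.order_iff_strict)

lemma num_lessE: "x < y \<Longrightarrow> (\<And>z. y = x + z + 1 \<Longrightarrow> P) \<Longrightarrow> P" for x :: num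
  by (auto simp: num_less add_ac)

definition pr :: "num \<Rightarrow> num \<Rightarrow> num"
  where "pr x y = (x + y) * (x + y) + x"

lemma Tm_pr [D0_intros]: "Tm f \<Longrightarrow> Tm g \<Longrightarrow> Tm (\<lambda>e. pr (f e) (g e))"
  unfolding pr_def by (intro D0_intros)

text \<open>With \<open>s = x + y\<close>, the code is at least \<open>s * s\<close> and below
  \<open>(s + 1) * (s + 1)\<close>, so the codes for different sums lie in disjoint
  intervals.\<close>

lemma pr_less: "x + y < x' + y' \<Longrightarrow> pr x y < pr x' y'"
proof -
  assume "x + y < x' + y'"
  then obtain z where z: "x' + y' = x + y + z + 1" by (rule num_lessE)
  define s where "s = x + y"
  have "(s + z + 1) * (s + z + 1) = s * s + s + (s + s * z + s * z + z * z + z + z) + 1"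
    by (simp add: algebra_simps)
  then have "pr x' y' = pr x y + (y + (s + s * z + s * z + z * z + z + z) + x') + 1"
    unfolding pr_def z s_def[symmetric] by (simp add: s_def add_ac)
  then show ?thesis by simp
qed

lemma pr_inj [simp]: "pr x y = pr x' y' \<longleftrightarrow> x = x' \<and> y = y'"
proof
  assume *: "pr x y = pr x' y'"
  then have "x + y = x' + y'" using pr_less by (metis linorder_neqE order_less_irrefl)
  with * show "x = x' \<and> y = y'" by (auto simp: pr_def)
qed simp

lemma pr_ge: "x \<le> pr x y" "y \<le> pr x y"
proof -
  have "y \<le> (x + y) * (x + y)"
  proof (cases "y = 0")
    case False
    then have "x + y \<le> (x + y) * (x + y)" by simp
    then show ?thesis by (meson le_add_same_cancel2 num_zero_le order_trans)
  qed simp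
  then show "y \<le> pr x y" unfolding pr_def by (meson le_add_same_cancel1 num_zero_le order_trans)
qed (simp add: pr_def)

text \<open>Applied to a length in first place: it makes the entries of a sequence strictly smaller
  than its code, on which the order of the stages will rest.\<close>

lemma less_pr: "x \<noteq> 0 \<Longrightarrow> y < pr x y"
proof -
  assume "x \<noteq> 0"
  then have "x + y \<le> (x + y) * (x + y)" by simp
  then have "x + y + x \<le> pr x y" unfolding pr_def by simp
  then have "y + x \<le> pr x y" by (meson add_right_mono le_add_same_cancel2 num_zero_le order_trans)
  moreover have "y < y + x" using \<open>x \<noteq> 0\<close> by simp
  ultimately show ?thesis by order
qed

definition rm :: "num \<Rightarrow> num \<Rightarrow> num \<Rightarrow> bool"
  where "rm a m x \<longleftrightarrow> x < m \<and> (\<exists>q<a+1. a = q * m + x)"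

lemma D0_rm [D0_intros]: "Tm f \<Longrightarrow> Tm g \<Longrightarrow> Tm h \<Longrightarrow> D0 (\<lambda>e. rm (f e) (g e) (h e))"
  by (rule D0_comp3[of rm]) (unfold rm_def, intro D0_intros)

lemma rmI: "x < m \<Longrightarrow> a = q * m + x \<Longrightarrow> rm a m x"
proof -
  assume *: "x < m" "a = q * m + x"
  then have "q \<le> q * m" by (intro num_mult_ge) auto
  then have "q \<le> a" using *(2) by (meson le_add_same_cancel1 num_zero_le order_trans order.eq_iff)
  then show ?thesis using * by (auto simp: rm_def)
qed

lemma rm_unique: "rm a m x \<Longrightarrow> rm a m y \<Longrightarrow> x = y"
proof -
  have *: "\<not> q < r" if "q * m + x = r * m + y" "x < m" for q r x y m :: num
  proof
    assume "q < r"
    then obtain z where "r = q + z + 1" by (rule num_lessE)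
    have "(q + z + 1) * m + y = q * m + (m + (z * m + y))"
      by (simp only: distrib_right mult_1_left add_ac)
    then have "x = m + (z * m + y)" using that(1) unfolding \<open>r = q + z + 1\<close> by (metis add_left_imp_eq)
    then show False using that(2) by (metis le_add_same_cancel1 not_le num_zero_le)
  qed
  assume "rm a m x" "rm a m y"
  then obtain q r where "a = q * m + x" "a = r * m + y" "x < m" "y < m" unfolding rm_def by blast
  then show ?thesis using *[of q m x r y] *[of r m y q x] by (metis add_left_cancel linorder_neqE)
qed

lemma rm_exists: "m \<noteq> 0 \<Longrightarrow> \<exists>x. rm a m x"
proof -
  assume m: "m \<noteq> 0"
  have "\<exists>x<m. rm a m x"
  proof (rule D0_induct[of "\<lambda>a. \<exists>x<m. rm a m x"])
    show "D0 (\<lambda>e. \<exists>x<m. rm (e 0) m x)" by (intro D0_intros)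
    show "\<exists>x<m. rm 0 m x" using m by (intro exI[of _ 0]) (simp add: rmI[of _ _ _ 0])
    show "\<exists>x<m. rm (a+1) m x" if *: "\<exists>x<m. rm a m x" for a
    proof -
      obtain x where "x < m" "rm a m x" using * by auto
      then obtain q where x: "x < m" "a = q * m + x" by (auto simp: rm_def)
      show ?thesis
      proof (cases "x + 1 = m")
        case True
        then have "a + 1 = (q + 1) * m + 0" using x(2) by (auto simp: algebra_simps)
        then show ?thesis using m rmI num_pos by metis
      next
        case False
        moreover have "x + 1 \<le> m" using x(1) unfolding num_less_iff .
        ultimately have "x + 1 < m" by order
        moreover have "a + 1 = q * m + (x + 1)" using x(2) by (simp add: add_ac)
        ultimately show ?thesis using rmI by blast
      qed
    qed
  qed
  then show ?thesis by blast
qed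

lemma D0_dvd [D0_intros]: "Tm f \<Longrightarrow> Tm g \<Longrightarrow> D0 (\<lambda>e. f e dvd g e)"
proof (rule D0_comp2[of "(dvd)"])
  have "x dvd y \<longleftrightarrow> (\<exists>q<y+1. y = x * q)" for x y :: num
  proof
    assume "x dvd y"
    then obtain q where q: "y = x * q" by auto
    show "\<exists>q<y+1. y = x * q"
    proof (cases "x = 0")
      case True
      then show ?thesis using q by (intro exI[of _ 0]) simp
    next
      case False
      then show ?thesis using q by (intro exI[of _ q]) simp
    qed
  qed auto
  then show "D0 (\<lambda>e. e 0 dvd e 1)" by (simp only:) (intro D0_intros)
qed

text \<open>Replaces the factorial, which is no term of the language. Only the existence of some
  multiple is claimed, and this is Sigma_1.\<close>

lemma common_multiple: "\<exists>b. b \<noteq> 0 \<and> (\<forall>d<k+1. d \<noteq> 0 \<longrightarrow> d dvd b)" for k :: num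
proof (rule S1_induct[of "\<lambda>k. \<exists>b. b \<noteq> 0 \<and> (\<forall>d<k+1. d \<noteq> 0 \<longrightarrow> d dvd b)"])
  show "S1 (\<lambda>e. \<exists>b. b \<noteq> 0 \<and> (\<forall>d<e 0+1. d \<noteq> 0 \<longrightarrow> d dvd b))"
    by (intro S1_ex S1_D0 D0_intros)
  show "\<exists>b. b \<noteq> (0 :: num) \<and> (\<forall>d<0+1. d \<noteq> 0 \<longrightarrow> d dvd b)" by (intro exI[of _ 1]) simp
  show "\<exists>b. b \<noteq> 0 \<and> (\<forall>d<k+1+1. d \<noteq> 0 \<longrightarrow> d dvd b)"
    if *: "\<exists>b. b \<noteq> 0 \<and> (\<forall>d<k+1. d \<noteq> 0 \<longrightarrow> d dvd b)" for k :: num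
  proof -
    obtain b where b: "b \<noteq> 0" "\<forall>d<k+1. d \<noteq> 0 \<longrightarrow> d dvd b" using * by blast
    have "d dvd b * (k+1)" if "d < k+1+1" "d \<noteq> 0" for d
      using that(1) by (rule num_less_cases) (use b that(2) in auto)
    with b(1) show ?thesis by (intro exI[of _ "b * (k+1)"]) simp
  qed
qed

text \<open>Invertibility of \<open>p\<close> modulo \<open>m\<close>, with bounds that make it
  Delta_0. It stands in for coprimality and supplies the inverse directly, without a Bezout
  argument.\<close>

definition unit_mod :: "num \<Rightarrow> num \<Rightarrow> bool"
  where "unit_mod p m \<longleftrightarrow> (\<exists>w<m. \<exists>v<p*m+1. p * w = v * m + 1)"

lemma D0_unit_mod [D0_intros]: "Tm f \<Longrightarrow> Tm g \<Longrightarrow> D0 (\<lambda>e. unit_mod (f e) (g e))"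
  by (rule D0_comp2[of unit_mod]) (unfold unit_mod_def, intro D0_intros)

text \<open>An inverse of any size will do, as its remainder modulo \<open>m\<close> is an inverse
  within the bounds.\<close>

lemma unit_modI:
  assumes "1 < m" and "p * w = v * m + 1"
  shows "unit_mod p m"
proof -
  have "m \<noteq> 0" using assms(1) by auto
  then obtain w' where "rm w m w'" using rm_exists by blast
  then obtain q where w': "w' < m" "w = q * m + w'" by (auto simp: rm_def)
  obtain s where "rm (p * w') m s" using rm_exists \<open>m \<noteq> 0\<close> by blast
  then obtain q' where s: "s < m" "p * w' = q' * m + s" by (auto simp: rm_def)
  have "p * w = (p * q + q') * m + s" using w' s by (simp add: algebra_simps)
  then have "rm (p * w) m s" using s(1) by (rule rmI[rotated])
  moreover have "rm (p * w) m 1" using assms by (rule rmI)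
  ultimately have "s = 1" by (rule rm_unique)
  have "q' \<le> q' * m" using \<open>m \<noteq> 0\<close> by simp
  also have "\<dots> \<le> p * w'" using s(2) by simp
  also have "\<dots> \<le> p * m" using w'(1) by (simp add: mult_left_mono)
  finally show ?thesis using s w' \<open>s = 1\<close> by (auto simp: unit_mod_def)
qed

lemma unit_mod_mult:
  assumes "1 < m" and "unit_mod p m" and "unit_mod q m"
  shows "unit_mod (p * q) m"
proof -
  obtain w v w' v' where 1: "p * w = v * m + 1" "q * w' = v' * m + 1"
    using assms unfolding unit_mod_def by blast
  have "p * q * (w * w') = (p * w) * (q * w')" by (simp add: mult_ac)
  also have "\<dots> = (v * v' * m + v + v') * m + 1" unfolding 1 by (simp add: algebra_simps)
  finally show ?thesis using assms(1) by (rule unit_modI[rotated])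
qed

lemma unit_mod_moduli:
  assumes "d \<noteq> 0" and "d dvd b" and "b \<noteq> 0"
  shows "unit_mod ((i+1) * b + 1) ((i+d+1) * b + 1)"
proof -
  obtain q where q: "b = d * q" using assms(2) ..
  let ?I = "i + 1" let ?J = "i + 1 + d"
  \<comment> \<open>Modulo \<open>?J * b + 1\<close> one has \<open>?J * (?I * b + 1) = d\<close>.
    Multiplying by \<open>q\<close> gives \<open>b\<close>, and since \<open>?J * b\<close> is -1,
    two further factors lead to the inverse \<open>q * b * ?J * ?J * ?J\<close>. Adding the modulus
    once avoids a subtraction in the quotient.\<close>
  have "(?I * b + 1) * (q * b * (?J * ?J * ?J) + (?J * b + 1))
     = ?I * b * ?J * b + q * b * ?J * ?J * ?J + ?I * b * q * b * ?J * ?J * ?J + ?J * b + ?I * b + 1"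
    by (simp add: algebra_simps)
  also have "q * b * ?J * ?J * ?J = q * b * ?J * ?J * ?I + b * b * ?J * ?J"
    unfolding q by (simp add: algebra_simps)
  also have "?I * b * ?J * b + (q * b * ?J * ?J * ?I + b * b * ?J * ?J) + ?I * b * q * b * ?J * ?J * ?J + ?J * b + ?I * b + 1
    = (q * b * ?J * ?J * ?I + ?J * b + ?I * b) * (?J * b + 1) + 1"
    by (simp add: algebra_simps)
  finally have "unit_mod (?I * b + 1) (?J * b + 1)"
    using assms(3) by (intro unit_modI) auto
  then show ?thesis by (simp add: add_ac)
qed

section \<open>Codes of sequences\<close>

definition has_len :: "num \<Rightarrow> num \<Rightarrow> bool"
  where "has_len c l \<longleftrightarrow> (\<exists>a<c+1. \<exists>b<c+1. c = pr l (pr a b))"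

definition ent :: "num \<Rightarrow> num \<Rightarrow> num \<Rightarrow> bool" where
  "ent c i x \<longleftrightarrow> (\<exists>l<c+1. \<exists>a<c+1. \<exists>b<c+1. c = pr l (pr a b) \<and> i < l \<and> rm a ((i+1) * b + 1) x)"

lemma D0_has_len [D0_intros]: "Tm f \<Longrightarrow> Tm g \<Longrightarrow> D0 (\<lambda>e. has_len (f e) (g e))"
  by (rule D0_comp2[of has_len]) (unfold has_len_def, intro D0_intros)

lemma D0_ent [D0_intros]: "Tm f \<Longrightarrow> Tm g \<Longrightarrow> Tm h \<Longrightarrow> D0 (\<lambda>e. ent (f e) (g e) (h e))"
  by (rule D0_comp3[of ent]) (unfold ent_def, intro D0_intros)

lemma pr_ge': "l \<le> pr l (pr a b)" "a \<le> pr l (pr a b)" "b \<le> pr l (pr a b)"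
  by (meson pr_ge order_trans)+

lemma has_len_iff: "has_len c l \<longleftrightarrow> (\<exists>a b. c = pr l (pr a b))"
  unfolding has_len_def using pr_ge'(2,3) by auto

lemma ent_iff: "ent c i x \<longleftrightarrow> (\<exists>l a b. c = pr l (pr a b) \<and> i < l \<and> rm a ((i+1) * b + 1) x)"
proof
  assume "\<exists>l a b. c = pr l (pr a b) \<and> i < l \<and> rm a ((i+1) * b + 1) x"
  then obtain l a b where *: "c = pr l (pr a b)" "i < l" "rm a ((i+1) * b + 1) x" by blast
  then have "l < c + 1" "a < c + 1" "b < c + 1" by (simp_all add: pr_ge')
  with * show "ent c i x" unfolding ent_def by blast
qed (unfold ent_def, blast)

lemma has_len_unique: "has_len c l \<Longrightarrow> has_len c k \<Longrightarrow> l = k"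
  by (auto simp: has_len_iff)

lemma has_len_le: "has_len c l \<Longrightarrow> l \<le> c"
  using pr_ge by (auto simp: has_len_iff)

lemma ent_has_len: "ent c i x \<Longrightarrow> \<exists>l. has_len c l \<and> i < l"
  by (auto simp: ent_iff has_len_iff)

lemma ent_index_less: "ent c i x \<Longrightarrow> has_len c l \<Longrightarrow> i < l"
  by (auto simp: ent_iff has_len_iff)

lemma ent_unique: "ent c i x \<Longrightarrow> ent c i y \<Longrightarrow> x = y"
  using rm_unique by (auto simp: ent_iff)

lemma ent_exists: "has_len c l \<Longrightarrow> i < l \<Longrightarrow> \<exists>x. ent c i x"
  using rm_exists by (fastforce simp: ent_iff has_len_iff)

lemma ent_less: "ent c i x \<Longrightarrow> x < c"
proof -
  assume "ent c i x"
  then obtain l a b where *: "c = pr l (pr a b)" "i < l" "rm a ((i+1) * b + 1) x" by (auto simp: ent_iff)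
  then have "x \<le> a" by (auto simp: rm_def)
  also have "a \<le> pr a b" by (rule pr_ge)
  also have "pr a b < c" unfolding *(1) using *(2) by (intro less_pr) auto
  finally show ?thesis .
qed

lemma ent_index_less': "ent c i x \<Longrightarrow> i < c"
  using ent_has_len has_len_le by (metis order_less_le_trans)

text \<open>Bounded comprehension is the Chinese remainder theorem for the moduli \<open>(i + 1) b + 1\<close>.\<close>

lemma bounded_comprehension:
  assumes D0: "D0 (\<lambda>e. \<phi> (e 0) (e 1))" and ex: "\<And>i. i < l \<Longrightarrow> \<exists>x<B+1. \<phi> i x"
  shows "\<exists>c. has_len c l \<and> (\<forall>i<l. \<exists>x. ent c i x \<and> \<phi> i x)"
proof -
  obtain b0 :: num where b0: "b0 \<noteq> 0" "\<forall>d<l+1. d \<noteq> 0 \<longrightarrow> d dvd b0" using common_multiple by blast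
  \<comment> \<open>Divisibility by every nonzero \<open>d\<close> up to \<open>l\<close> makes the
    moduli invertible modulo later ones; the factor \<open>B + 1\<close> makes them exceed all
    prescribed values.\<close>
  define b where "b = b0 * (B+1)"
  have b: "b \<noteq> 0" "\<And>d. d \<le> l \<Longrightarrow> d \<noteq> 0 \<Longrightarrow> d dvd b" "B \<le> b"
    using b0 num_mult_ge(2)[of b0 B] order_trans[of B "B * b0"] by (auto simp: b_def algebra_simps)
  let ?m = "\<lambda>i. (i+1) * b + 1"
  have Bm: "x < ?m i" if "x < B+1" for x i
  proof -
    have "x \<le> b" using that b(3) by auto
    also have "b \<le> (i+1) * b" by simp
    finally show ?thesis by simp
  qed
  have unit: "unit_mod (?m i) (?m j)" if "i < j" "j < l" for i j
  proof -
    obtain d where d: "j = i + (d + 1)" using \<open>i < j\<close> by (auto simp: num_less)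
    then have "d + 1 \<le> j" by simp
    then have "d + 1 \<le> l" using that by order
    then have "unit_mod ((i+1) * b + 1) ((i+(d+1)+1) * b + 1)"
      by (intro unit_mod_moduli b) auto
    then show ?thesis by (simp only: d)
  qed
  have m1: "1 < ?m i" for i using b(1) by simp
  \<comment> \<open>Besides the partial solution \<open>a\<close>, the induction carries a common
    multiple \<open>p\<close> of the moduli already treated that is invertible modulo the remaining
    ones.\<close>
  have "k < l + 1 \<longrightarrow> (\<exists>a p. (\<forall>i<k. \<exists>x<B+1. \<phi> i x \<and> rm a (?m i) x \<and> ?m i dvd p) \<and>
      (\<forall>j<l. k \<le> j \<longrightarrow> unit_mod p (?m j)))" (is "?P k") for k
  proof (rule S1_induct[of ?P])
    \<comment> \<open>The existential quantifiers are moved in front of the implication, where the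
      rules for \<open>S1\<close> admit them.\<close>
    have "S1 (\<lambda>e. \<exists>a p. e 0 < l + 1 \<longrightarrow> (\<forall>i<e 0. \<exists>x<B+1. \<phi> i x \<and> rm a (?m i) x \<and> ?m i dvd p) \<and>
      (\<forall>j<l. e 0 \<le> j \<longrightarrow> unit_mod p (?m j)))"
      by (intro S1_ex S1_D0 D0_intros D0_comp2[OF D0])
    then show "S1 (\<lambda>e. ?P (e 0))" by simp
    have "unit_mod 1 (?m j)" for j using m1 by (intro unit_modI[of _ _ 1 0]) auto
    then show "?P 0" by (intro impI exI[of _ 0] exI[of _ 1]) auto
    show "?P (k+1)" if "?P k" for k
    proof
      assume "k + 1 < l + 1"
      then have "k < l" by (simp add: num_less_iff)
      then obtain a p where ap: "\<forall>i<k. \<exists>x<B+1. \<phi> i x \<and> rm a (?m i) x \<and> ?m i dvd p"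
        "\<forall>j<l. k \<le> j \<longrightarrow> unit_mod p (?m j)" using \<open>?P k\<close> by auto
      obtain y where y: "y < B+1" "\<phi> k y" using ex[OF \<open>k < l\<close>] by auto
      obtain w v where "p * w = v * ?m k + 1" using ap(2) \<open>k < l\<close> by (auto simp: unit_mod_def)
      \<comment> \<open>Adding multiples of \<open>p\<close> preserves the earlier remainders.
        Modulo the new modulus, \<open>w\<close> inverts \<open>p\<close> and
        \<open>(k+1) * b\<close> is -1, so that \<open>p * t\<close> is \<open>y - a\<close> without
        subtraction.\<close>
      define t where "t = w * (y + a * ((k+1) * b))"
      have "a + p * t = a + (p * w) * (y + a * ((k+1) * b))" by (simp add: t_def mult_ac)
      also have "\<dots> = (v * (y + a * ((k+1) * b)) + a) * ?m k + y"
        unfolding \<open>p * w = v * ?m k + 1\<close> by (simp add: algebra_simps)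
      finally have k: "rm (a + p * t) (?m k) y" by (rule rmI[OF Bm[OF y(1)]])
      have "\<exists>x<B+1. \<phi> i x \<and> rm (a + p * t) (?m i) x \<and> ?m i dvd p * ?m k" if "i < k + 1" for i
        using that
      proof (rule num_less_cases)
        assume "i < k"
        then obtain x where x: "x < B+1" "\<phi> i x" "rm a (?m i) x" "?m i dvd p" using ap(1) by auto
        obtain r where "p = ?m i * r" using x(4) ..
        obtain q where "a = q * ?m i + x" using x(3) by (auto simp: rm_def)
        then have "a + p * t = (q + r * t) * ?m i + x"
          unfolding \<open>p = ?m i * r\<close> by (simp add: algebra_simps)
        then have "rm (a + p * t) (?m i) x" by (rule rmI[OF Bm[OF x(1)]])
        then show ?thesis using x by (intro exI[of _ x]) (auto intro: dvd_mult2)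
      qed (use k y in auto)
      moreover have "unit_mod (p * ?m k) (?m j)" if "j < l" "k + 1 \<le> j" for j
      proof -
        have "k < j" using that(2) by (simp add: num_less_iff)
        then show ?thesis using that(1) ap(2) unit[of k j] m1 by (intro unit_mod_mult) auto
      qed
      ultimately show "\<exists>a p. (\<forall>i<k+1. \<exists>x<B+1. \<phi> i x \<and> rm a (?m i) x \<and> ?m i dvd p) \<and>
          (\<forall>j<l. k+1 \<le> j \<longrightarrow> unit_mod p (?m j))" by blast
    qed
  qed
  from this[of l] obtain a p where "\<forall>i<l. \<exists>x<B+1. \<phi> i x \<and> rm a (?m i) x \<and> ?m i dvd p" by auto
  then have "has_len (pr l (pr a b)) l \<and> (\<forall>i<l. \<exists>x. ent (pr l (pr a b)) i x \<and> \<phi> i x)"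
    by (fastforce simp: has_len_iff ent_iff)
  then show ?thesis ..
qed

text \<open>Delta_0-collection follows from Sigma_1-induction on the initial segment already
  bounded; each step takes the maximum with one more witness.\<close>

lemma collection:
  assumes D0: "D0 (\<lambda>e. \<phi> (e 0) (e 1))" and ex: "\<And>i. i < l \<Longrightarrow> \<exists>x. \<phi> i x"
  shows "\<exists>B. \<forall>i<l. \<exists>x<B+1. \<phi> i x"
proof -
  have "k < l + 1 \<longrightarrow> (\<exists>B. \<forall>i<k. \<exists>x<B+1. \<phi> i x)" (is "?P k") for k
  proof (rule S1_induct[of ?P])
    have "S1 (\<lambda>e. \<exists>B. e 0 < l + 1 \<longrightarrow> (\<forall>i<e 0. \<exists>x<B+1. \<phi> i x))"
      by (intro S1_ex S1_D0 D0_intros D0_comp2[OF D0])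
    then show "S1 (\<lambda>e. ?P (e 0))" by simp
    show "?P (k+1)" if "?P k" for k
    proof
      assume "k + 1 < l + 1"
      then have "k < l" by (simp add: num_less_iff)
      then obtain B where B: "\<forall>i<k. \<exists>x<B+1. \<phi> i x" using \<open>?P k\<close> by auto
      obtain y where y: "\<phi> k y" using ex[OF \<open>k < l\<close>] by auto
      have "\<exists>x<max B y+1. \<phi> i x" if "i < k + 1" for i
        using that
      proof (rule num_less_cases)
        assume "i < k"
        then obtain x where "x \<le> B" "\<phi> i x" using B by auto
        then show ?thesis by (intro exI[of _ x]) (auto simp: le_max_iff_disj)
      qed (use y in \<open>auto simp: le_max_iff_disj\<close>)
      then show "\<exists>B. \<forall>i<k+1. \<exists>x<B+1. \<phi> i x" by blast
    qed
  qed simp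
  then show ?thesis by (metis num_less_add1(1) order_refl)
qed

lemma comprehension:
  assumes "D0 (\<lambda>e. \<phi> (e 0) (e 1))" and "\<And>i. i < l \<Longrightarrow> \<exists>x. \<phi> i x"
  shows "\<exists>c. has_len c l \<and> (\<forall>i<l. \<exists>x. ent c i x \<and> \<phi> i x)"
  using collection[OF assms] bounded_comprehension[OF assms(1)] by metis

section \<open>Canonical codes\<close>

definition same :: "num \<Rightarrow> num \<Rightarrow> bool" where
  "same c d \<longleftrightarrow> (\<exists>l<c+1. has_len c l \<and> has_len d l \<and> (\<forall>i<l. \<exists>x<c+1. ent c i x \<and> ent d i x))"

definition is_sq :: "num \<Rightarrow> bool"
  where "is_sq c \<longleftrightarrow> (\<exists>l<c+1. has_len c l) \<and> (\<forall>d<c. \<not> same c d)"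

definition pre :: "num \<Rightarrow> num \<Rightarrow> bool" where
  "pre \<sigma> \<tau> \<longleftrightarrow> is_sq \<sigma> \<and> is_sq \<tau> \<and> (\<exists>k<\<sigma>+1. \<exists>l<\<tau>+1. has_len \<sigma> k \<and> has_len \<tau> l \<and> k \<le> l \<and>
     (\<forall>i<k. \<exists>x<\<sigma>+1. ent \<sigma> i x \<and> ent \<tau> i x))"

definition app :: "num \<Rightarrow> num \<Rightarrow> num \<Rightarrow> bool" where
  "app \<sigma> u \<tau> \<longleftrightarrow> pre \<sigma> \<tau> \<and> (\<exists>l<\<sigma>+1. has_len \<sigma> l \<and> has_len \<tau> (l+1) \<and> ent \<tau> l u)"

definition mem :: "num \<Rightarrow> num \<Rightarrow> bool"
  where "mem x e \<longleftrightarrow> (\<exists>i<e+1. ent e i x)"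

lemma D0_same [D0_intros]: "Tm f \<Longrightarrow> Tm g \<Longrightarrow> D0 (\<lambda>e. same (f e) (g e))"
  by (rule D0_comp2[of same]) (unfold same_def, intro D0_intros)

lemma D0_is_sq [D0_intros]: "Tm f \<Longrightarrow> D0 (\<lambda>e. is_sq (f e))"
  by (rule D0_comp1[of is_sq]) (unfold is_sq_def, intro D0_intros)

lemma D0_pre [D0_intros]: "Tm f \<Longrightarrow> Tm g \<Longrightarrow> D0 (\<lambda>e. pre (f e) (g e))"
  by (rule D0_comp2[of pre]) (unfold pre_def, intro D0_intros)

lemma D0_app [D0_intros]: "Tm f \<Longrightarrow> Tm g \<Longrightarrow> Tm h \<Longrightarrow> D0 (\<lambda>e. app (f e) (g e) (h e))"
  by (rule D0_comp3[of app]) (unfold app_def, intro D0_intros)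

lemma D0_mem [D0_intros]: "Tm f \<Longrightarrow> Tm g \<Longrightarrow> D0 (\<lambda>e. mem (f e) (g e))"
  by (rule D0_comp2[of mem]) (unfold mem_def, intro D0_intros)

lemma ent_le: "ent c i x \<Longrightarrow> x \<le> c"
  using ent_less order_less_imp_le by blast

lemma mem_iff: "mem x e \<longleftrightarrow> (\<exists>i. ent e i x)"
  unfolding mem_def using ent_index_less' by (meson order_less_imp_le num_less_add1(1))

lemma has_len_ent_le: "has_len c l \<Longrightarrow> l < c + 1" "ent c i x \<Longrightarrow> x < c + 1"
  by (simp_all add: has_len_le ent_le)

lemma same_iff:
  "same c d \<longleftrightarrow> (\<exists>l. has_len c l \<and> has_len d l \<and> (\<forall>i<l. \<exists>x. ent c i x \<and> ent d i x))"
  unfolding same_def using has_len_ent_le by meson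

lemma pre_iff:
  "pre \<sigma> \<tau> \<longleftrightarrow> is_sq \<sigma> \<and> is_sq \<tau> \<and> (\<exists>k l. has_len \<sigma> k \<and> has_len \<tau> l \<and> k \<le> l \<and>
     (\<forall>i<k. \<exists>x. ent \<sigma> i x \<and> ent \<tau> i x))"
  unfolding pre_def using has_len_ent_le by meson

lemma app_iff: "app \<sigma> u \<tau> \<longleftrightarrow> pre \<sigma> \<tau> \<and> (\<exists>l. has_len \<sigma> l \<and> has_len \<tau> (l+1) \<and> ent \<tau> l u)"
  unfolding app_def using has_len_ent_le by meson

lemma is_sq_len: "is_sq c \<Longrightarrow> \<exists>l. has_len c l"
  by (auto simp: is_sq_def)

lemma same_sym: "same c d \<Longrightarrow> same d c"
  by (meson same_iff)

lemma same_trans: "same c d \<Longrightarrow> same d e \<Longrightarrow> same c e"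
  unfolding same_iff by (metis has_len_unique ent_unique)

lemma is_sq_eqI: "is_sq c \<Longrightarrow> is_sq d \<Longrightarrow> same c d \<Longrightarrow> c = d"
  unfolding is_sq_def using same_sym by (metis linorder_neqE)

text \<open>The least among the codes of the same sequence. That it does not exceed the given code
  lets bounds pass to canonical codes.\<close>

lemma canonical: "has_len c l \<Longrightarrow> \<exists>d\<le>c. is_sq d \<and> same c d"
proof -
  assume c: "has_len c l"
  have "same c c" using c ent_exists[OF c] by (auto simp: same_iff)
  moreover have "D0 (\<lambda>e. same c (e 0))" by (intro D0_intros)
  ultimately obtain d where d: "same c d" "\<forall>z<d. \<not> same c z" using D0_least[of "same c" c] by blast
  then have "d \<le> c" using \<open>same c c\<close> by (meson not_le)
  moreover have "\<exists>l. has_len d l" using d(1) by (auto simp: same_iff)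
  moreover have "\<forall>z<d. \<not> same d z" using d same_trans by blast
  ultimately show ?thesis using d has_len_ent_le unfolding is_sq_def by blast
qed

lemma pre_sq: "pre \<sigma> \<tau> \<Longrightarrow> is_sq \<sigma>" "pre \<sigma> \<tau> \<Longrightarrow> is_sq \<tau>"
  by (auto simp: pre_def)

lemma pre_len: "pre \<sigma> \<tau> \<Longrightarrow> has_len \<sigma> k \<Longrightarrow> has_len \<tau> l \<Longrightarrow> k \<le> l"
  unfolding pre_iff by (metis has_len_unique)

lemma pre_ent: "pre \<sigma> \<tau> \<Longrightarrow> ent \<sigma> i x \<Longrightarrow> ent \<tau> i x"
  unfolding pre_iff by (metis ent_index_less ent_unique)

lemma pre_ent': "pre \<sigma> \<tau> \<Longrightarrow> has_len \<sigma> k \<Longrightarrow> i < k \<Longrightarrow> ent \<tau> i x \<Longrightarrow> ent \<sigma> i x"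
  using pre_ent ent_exists ent_unique by metis

lemma preI:
  assumes "is_sq \<sigma>" "is_sq \<tau>" "has_len \<sigma> k" "has_len \<tau> l" "k \<le> l"
    and "\<And>i x. i < k \<Longrightarrow> ent \<sigma> i x \<Longrightarrow> ent \<tau> i x"
  shows "pre \<sigma> \<tau>"
  unfolding pre_iff using assms ent_exists by meson

lemma pre_refl: "is_sq \<sigma> \<Longrightarrow> pre \<sigma> \<sigma>"
  using is_sq_len preI[of \<sigma> \<sigma>] by blast

lemma pre_trans: "pre \<rho> \<sigma> \<Longrightarrow> pre \<sigma> \<tau> \<Longrightarrow> pre \<rho> \<tau>"
proof -
  assume *: "pre \<rho> \<sigma>" "pre \<sigma> \<tau>"
  then obtain j k l where "has_len \<rho> j" "has_len \<sigma> k" "has_len \<tau> l" using pre_sq is_sq_len by meson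
  then show ?thesis using * pre_len[of \<rho> \<sigma> j k] pre_len[of \<sigma> \<tau> k l] pre_sq pre_ent
    by (intro preI[of \<rho> \<tau> j l]) auto
qed

lemma pre_linear:
  assumes "pre \<rho> \<tau>" "pre \<sigma> \<tau>" "has_len \<rho> k" "has_len \<sigma> l" "k \<le> l"
  shows "pre \<rho> \<sigma>"
  using assms by (intro preI[of _ _ k l]) (meson pre_sq pre_ent pre_ent' order_less_le_trans)+

lemma pre_same_len: "pre \<sigma> \<tau> \<Longrightarrow> has_len \<sigma> k \<Longrightarrow> has_len \<tau> k \<Longrightarrow> \<sigma> = \<tau>"
proof (rule is_sq_eqI)
  assume *: "pre \<sigma> \<tau>" "has_len \<sigma> k" "has_len \<tau> k"
  then show "same \<sigma> \<tau>" unfolding same_iff using ent_exists pre_ent by meson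
qed (simp_all add: pre_sq)

text \<open>Replacing the length \<open>l\<close> in the code by \<open>k\<close> truncates the
  sequence and lowers the number, and the canonical code is lower still. Hence proper initial
  segments have smaller codes.\<close>

lemma restrict: "is_sq \<tau> \<Longrightarrow> has_len \<tau> l \<Longrightarrow> k < l \<Longrightarrow> \<exists>\<sigma><\<tau>. pre \<sigma> \<tau> \<and> has_len \<sigma> k"
proof -
  assume *: "is_sq \<tau>" "has_len \<tau> l" "k < l"
  then obtain a b where \<tau>: "\<tau> = pr l (pr a b)" by (auto simp: has_len_iff)
  let ?c = "pr k (pr a b)"
  have c: "has_len ?c k" by (auto simp: has_len_iff)
  then obtain \<sigma> where \<sigma>: "\<sigma> \<le> ?c" "is_sq \<sigma>" "same ?c \<sigma>" using canonical by blast
  have "?c < \<tau>" unfolding \<tau> using \<open>k < l\<close> by (intro pr_less) simp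
  moreover have "has_len \<sigma> k" using \<sigma>(3) c has_len_unique unfolding same_iff by blast
  moreover have "ent \<tau> i x" if "i < k" "ent \<sigma> i x" for i x
  proof -
    have "ent ?c i x" using \<sigma>(3) c that has_len_unique ent_unique unfolding same_iff by metis
    then show ?thesis using that(1) \<open>k < l\<close> unfolding ent_iff \<tau> by auto
  qed
  then have "pre \<sigma> \<tau>" using * \<sigma>(2) \<open>has_len \<sigma> k\<close> by (intro preI[of \<sigma> \<tau> k l]) auto
  ultimately show ?thesis using \<sigma>(1) by (meson order_le_less_trans)
qed

lemma app_exists: "is_sq \<sigma> \<Longrightarrow> \<exists>\<tau>. app \<sigma> u \<tau>"
proof -
  assume "is_sq \<sigma>"
  then obtain l where l: "has_len \<sigma> l" using is_sq_len by blast
  have "D0 (\<lambda>e. e 0 < l \<and> ent \<sigma> (e 0) (e 1) \<or> e 0 = l \<and> e 1 = u)" by (intro D0_intros)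
  moreover have "\<exists>x. i < l \<and> ent \<sigma> i x \<or> i = l \<and> x = u" if "i < l + 1" for i
    using that by (rule num_less_cases) (use ent_exists[OF l] in auto)
  ultimately obtain c where c: "has_len c (l+1)"
    "\<forall>i<l+1. \<exists>x. ent c i x \<and> (i < l \<and> ent \<sigma> i x \<or> i = l \<and> x = u)"
    using comprehension[of "\<lambda>i x. i < l \<and> ent \<sigma> i x \<or> i = l \<and> x = u" "l+1"] by blast
  then obtain \<tau> where \<tau>: "is_sq \<tau>" "same c \<tau>" using canonical by blast
  then have len: "has_len \<tau> (l+1)" using c(1) has_len_unique unfolding same_iff by blast
  have "ent \<tau> i x \<longleftrightarrow> ent c i x" if "i < l + 1" for i x
    using that \<tau>(2) c(1) has_len_unique ent_unique unfolding same_iff by metis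
  then have ent: "\<forall>i<l+1. \<exists>x. ent \<tau> i x \<and> (i < l \<and> ent \<sigma> i x \<or> i = l \<and> x = u)" using c(2) by metis
  have "ent \<tau> l u" using ent[rule_format, of l] by auto
  moreover have "ent \<tau> i x" if "i < l" "ent \<sigma> i x" for i x
    using ent[rule_format, of i] that ent_unique by force
  then have "pre \<sigma> \<tau>" using \<open>is_sq \<sigma>\<close> \<tau>(1) l len by (intro preI[of \<sigma> \<tau> l "l+1"]) auto
  ultimately show ?thesis using l len unfolding app_iff by blast
qed

lemma app_unique: "app \<sigma> u \<tau> \<Longrightarrow> app \<sigma> u \<tau>' \<Longrightarrow> \<tau> = \<tau>'"
proof -
  assume *: "app \<sigma> u \<tau>" "app \<sigma> u \<tau>'"
  then obtain l where l: "has_len \<sigma> l" "has_len \<tau> (l+1)" "has_len \<tau>' (l+1)" "ent \<tau> l u" "ent \<tau>' l u"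
    "pre \<sigma> \<tau>" "pre \<sigma> \<tau>'" unfolding app_iff using has_len_unique by metis
  have "\<exists>x. ent \<tau> i x \<and> ent \<tau>' i x" if "i < l + 1" for i
    using that by (rule num_less_cases) (use l ent_exists pre_ent in blast)+
  then have "same \<tau> \<tau>'" using l unfolding same_iff by blast
  then show ?thesis using l pre_sq is_sq_eqI by blast
qed

lemma app_split: "is_sq \<tau> \<Longrightarrow> has_len \<tau> (l+1) \<Longrightarrow> \<exists>\<sigma> u. app \<sigma> u \<tau> \<and> has_len \<sigma> l"
  unfolding app_iff using restrict[of \<tau> "l+1" l] ent_exists[of \<tau> "l+1" l] by auto

lemma app_inj: "app \<sigma> u \<tau> \<Longrightarrow> app \<sigma>' u' \<tau> \<Longrightarrow> \<sigma> = \<sigma>' \<and> u = u'"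
proof -
  assume *: "app \<sigma> u \<tau>" "app \<sigma>' u' \<tau>"
  then obtain l l' where l: "has_len \<sigma> l" "has_len \<tau> (l+1)" "ent \<tau> l u" "pre \<sigma> \<tau>"
    "has_len \<sigma>' l'" "has_len \<tau> (l'+1)" "ent \<tau> l' u'" "pre \<sigma>' \<tau>" unfolding app_iff by metis
  then have "l = l'" using has_len_unique[of \<tau> "l+1" "l'+1"] by simp
  then show ?thesis using l pre_linear[of \<sigma> \<tau> \<sigma>' l l] pre_same_len ent_unique by blast
qed

lemma app_less: "app \<sigma> u \<tau> \<Longrightarrow> \<sigma> < \<tau> \<and> u < \<tau>"
proof -
  assume *: "app \<sigma> u \<tau>"
  then obtain l where l: "has_len \<sigma> l" "has_len \<tau> (l+1)" "ent \<tau> l u" "pre \<sigma> \<tau>" unfolding app_iff by blast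
  then obtain \<sigma>' where "\<sigma>' < \<tau>" "pre \<sigma>' \<tau>" "has_len \<sigma>' l" using restrict[of \<tau> "l+1" l] pre_sq by auto
  then show ?thesis using l pre_linear[of \<sigma> \<tau> \<sigma>' l l] pre_same_len ent_less by blast
qed

lemma pre_app: "pre \<rho> \<tau> \<Longrightarrow> app \<sigma> u \<tau> \<Longrightarrow> \<rho> = \<tau> \<or> pre \<rho> \<sigma>"
proof -
  assume *: "pre \<rho> \<tau>" "app \<sigma> u \<tau>"
  then obtain l where l: "has_len \<sigma> l" "has_len \<tau> (l+1)" "pre \<sigma> \<tau>" unfolding app_iff by blast
  obtain k where k: "has_len \<rho> k" using * pre_sq is_sq_len by blast
  then have "k \<le> l + 1" using * l pre_len by blast
  then show ?thesis using pre_same_len[OF *(1)] pre_linear[OF *(1) l(3) k l(1)] k l(2)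
    by (metis num_less_add1(1) order.order_iff_strict)
qed

text \<open>As \<open>pr 0 (pr 0 0)\<close> is 0, the root of the tree will be the number 0.\<close>

lemma has_len_0: "has_len 0 0"
  by (auto simp: has_len_iff pr_def intro: exI[of _ 0])

lemma is_sq_0: "is_sq 0"
  using has_len_0 by (auto simp: is_sq_def)

lemma pre_0: "is_sq \<sigma> \<Longrightarrow> pre 0 \<sigma>"
  using is_sq_len[of \<sigma>] is_sq_0 has_len_0 by (auto intro: preI)

lemma has_len_0_eq: "is_sq \<sigma> \<Longrightarrow> has_len \<sigma> 0 \<Longrightarrow> \<sigma> = 0"
  using pre_same_len[OF pre_0 has_len_0] by auto

text \<open>The entry with index \<open>i\<close> is \<open>i\<close> if \<open>P i\<close> holds.
  Otherwise some member has to fill the place, and \<open>P 0\<close> provides 0.\<close>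

lemma set_comprehension:
  assumes "D0 (\<lambda>e. P (e 0))" and "P 0"
  shows "\<exists>e. \<forall>x. mem x e \<longleftrightarrow> x \<le> B \<and> P x"
proof -
  have "D0 (\<lambda>e. e 1 = e 0 \<and> P (e 0) \<or> e 1 = 0 \<and> \<not> P (e 0))"
    by (intro D0_intros D0_comp1[OF assms(1)])
  then obtain c where c: "has_len c (B+1)" "\<forall>i<B+1. \<exists>x. ent c i x \<and> (x = i \<and> P i \<or> x = 0 \<and> \<not> P i)"
    using comprehension[of "\<lambda>i x. x = i \<and> P i \<or> x = 0 \<and> \<not> P i" "B+1"] by blast
  have "x \<le> B \<and> P x" if "ent c i x" for i x
    using c that assms(2) ent_unique ent_index_less by (metis num_less_add1(1) num_zero_le)
  moreover have "\<exists>i. ent c i x" if "x \<le> B" "P x" for x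
    using c(2)[rule_format, of x] that by auto
  ultimately show ?thesis unfolding mem_iff by blast
qed

section \<open>Computations of the Ackermann function in the model\<close>

section \<open>Ackermann computations\<close>

abbreviation tr :: "num \<Rightarrow> num \<Rightarrow> num \<Rightarrow> num"
  where "tr x y z \<equiv> pr x (pr y z)"

definition astep :: "num \<Rightarrow> num \<Rightarrow> bool" where
  "astep c i \<longleftrightarrow> (\<exists>x<c+1. \<exists>y<c+1. \<exists>z<c+1. ent c i (tr x y z) \<and>
     (x = 0 \<and> z = y + 1
      \<or> y = 0 \<and> (\<exists>u<x. x = u + 1 \<and> (\<exists>p<i. ent c p (tr u 1 z)))
      \<or> (\<exists>u<x. \<exists>v<y. x = u + 1 \<and> y = v + 1 \<and>
           (\<exists>w<c+1. \<exists>p<i. \<exists>q<i. ent c p (tr x v w) \<and> ent c q (tr u w z)))))"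

definition comp_of :: "num \<Rightarrow> num \<Rightarrow> num \<Rightarrow> num \<Rightarrow> bool" where
  "comp_of c x y z \<longleftrightarrow>
     (\<exists>l<c+1. has_len c l \<and> (\<forall>i<l. astep c i) \<and> (\<exists>i<l. ent c i (tr x y z)))"

definition ack :: "num \<Rightarrow> num \<Rightarrow> num \<Rightarrow> bool"
  where "ack x y z \<longleftrightarrow> (\<exists>c. comp_of c x y z)"

lemma D0_astep [D0_intros]: "Tm f \<Longrightarrow> Tm g \<Longrightarrow> D0 (\<lambda>e. astep (f e) (g e))"
  by (rule D0_comp2[of astep]) (unfold astep_def, intro D0_intros)

lemma D0_comp_of [D0_intros]:
  "Tm f \<Longrightarrow> Tm g \<Longrightarrow> Tm h \<Longrightarrow> Tm k \<Longrightarrow> D0 (\<lambda>e. comp_of (f e) (g e) (h e) (k e))"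
  by (rule D0_comp4[of comp_of]) (unfold comp_of_def, intro D0_intros)

lemma sat_has_length [simp]: "sat e (has_length c l) \<longleftrightarrow> has_len (val e c) (val e l)"
  by (simp add: has_length_def has_len_def pair_def pr_def eval_nat_numeral)

lemma sat_entry [simp]: "sat e (entry c i x) \<longleftrightarrow> ent (val e c) (val e i) (val e x)"
  by (simp add: entry_def ent_def pair_def pr_def remainder_def rm_def eval_nat_numeral)

lemma val_pair [simp]: "val e (pair t u) = pr (val e t) (val e u)"
  by (simp add: pair_def pr_def)

lemma sat_leq [simp]: "sat e (t \<^bold>\<le> u) \<longleftrightarrow> val e t \<le> val e u"
  by (simp add: leq_def)

lemma sat_same_sequence [simp]: "sat e (same_sequence c d) \<longleftrightarrow> same (val e c) (val e d)"
  by (simp add: same_sequence_def same_def eval_nat_numeral)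

lemma sat_is_seq [simp]: "sat e (is_seq c) \<longleftrightarrow> is_sq (val e c)"
  by (simp add: is_seq_def is_sq_def)

lemma sat_prefix [simp]: "sat e (prefix \<sigma> \<tau>) \<longleftrightarrow> pre (val e \<sigma>) (val e \<tau>)"
  by (simp add: prefix_def pre_def eval_nat_numeral)

lemma sat_member [simp]: "sat e (member x c) \<longleftrightarrow> mem (val e x) (val e c)"
  by (simp add: member_def mem_def)

lemma sat_not_longer:
  "sat e (not_longer \<sigma> \<tau>) \<longleftrightarrow> (\<exists>k l. has_len (val e \<sigma>) k \<and> has_len (val e \<tau>) l \<and> k \<le> l)"
proof -
  have "sat e (not_longer \<sigma> \<tau>) \<longleftrightarrow>
    (\<exists>k<val e \<sigma> + 1. \<exists>l<val e \<tau> + 1. has_len (val e \<sigma>) k \<and> has_len (val e \<tau>) l \<and> k \<le> l)"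
    by (simp add: not_longer_def eval_nat_numeral)
  then show ?thesis using has_len_ent_le(1) by blast
qed

lemma sat_ack_step [simp]: "sat e (ack_step c i) \<longleftrightarrow> astep (val e c) (val e i)"
  by (simp add: ack_step_def triple_at_def astep_def eval_nat_numeral)

lemma sat_ackermann_graph [simp]:
  "sat e (ackermann_graph x y z) \<longleftrightarrow> ack (val e x) (val e y) (val e z)"
  by (simp add: ackermann_graph_def triple_at_def ack_def comp_of_def eval_nat_numeral)

text \<open>The recursion equations over an arbitrary relation \<open>R\<close> of values already
  obtained, free of codes and bounds.\<close>

definition follows :: "(num \<Rightarrow> num \<Rightarrow> num \<Rightarrow> bool) \<Rightarrow> num \<Rightarrow> num \<Rightarrow> num \<Rightarrow> bool" where
  "follows R x y z \<longleftrightarrow> x = 0 \<and> z = y + 1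
     \<or> y = 0 \<and> (\<exists>u. x = u + 1 \<and> R u 1 z)
     \<or> (\<exists>u v w. x = u + 1 \<and> y = v + 1 \<and> R x v w \<and> R u w z)"

lemma follows_mono: "follows R x y z \<Longrightarrow> (\<And>x y z. R x y z \<Longrightarrow> S x y z) \<Longrightarrow> follows S x y z"
  unfolding follows_def by blast

lemma ent_tr_le: "ent c i (tr x y z) \<Longrightarrow> x < c + 1 \<and> y < c + 1 \<and> z < c + 1"
  using ent_le[of c i "tr x y z"] pr_ge'(1)[of x y z] pr_ge'(2)[of y x z] pr_ge'(3)[of z x y]
  by (auto intro: order_trans)

lemma astep_iff:
  "astep c i \<longleftrightarrow>
     (\<exists>x y z. ent c i (tr x y z) \<and> follows (\<lambda>x y z. \<exists>p<i. ent c p (tr x y z)) x y z)"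
proof -
  have "u < u + 1" for u :: num by simp
  then have *: "x = u + 1 \<Longrightarrow> u < x" for x u :: num by blast
  show ?thesis
  proof
    assume "astep c i"
    then show "\<exists>x y z. ent c i (tr x y z) \<and> follows (\<lambda>x y z. \<exists>p<i. ent c p (tr x y z)) x y z"
      unfolding astep_def follows_def by blast
  next
    assume "\<exists>x y z. ent c i (tr x y z) \<and> follows (\<lambda>x y z. \<exists>p<i. ent c p (tr x y z)) x y z"
    then obtain x y z where xyz: "ent c i (tr x y z)" "follows (\<lambda>x y z. \<exists>p<i. ent c p (tr x y z)) x y z"
      by blast
    from xyz(2) have "x = 0 \<and> z = y + 1
      \<or> y = 0 \<and> (\<exists>u<x. x = u + 1 \<and> (\<exists>p<i. ent c p (tr u 1 z)))
      \<or> (\<exists>u<x. \<exists>v<y. x = u + 1 \<and> y = v + 1 \<and>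
           (\<exists>w<c+1. \<exists>p<i. \<exists>q<i. ent c p (tr x v w) \<and> ent c q (tr u w z)))"
      unfolding follows_def using * ent_tr_le by metis
    then show "astep c i" unfolding astep_def
      using xyz(1) ent_tr_le[OF xyz(1)] by (intro exI[of _ x] exI[of _ y] exI[of _ z] conjI) simp_all
  qed
qed

lemma comp_of_iff:
  "comp_of c x y z \<longleftrightarrow> (\<exists>l. has_len c l \<and> (\<forall>i<l. astep c i) \<and> (\<exists>i. ent c i (tr x y z)))"
  unfolding comp_of_def using has_len_ent_le(1) ent_index_less by blast

lemma astep_follows:
  "astep c i \<Longrightarrow> ent c i (tr x y z) \<Longrightarrow> follows (\<lambda>x y z. \<exists>p<i. ent c p (tr x y z)) x y z"
proof -
  assume "astep c i" and xyz: "ent c i (tr x y z)"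
  then obtain x' y' z' where *: "ent c i (tr x' y' z')" "follows (\<lambda>x y z. \<exists>p<i. ent c p (tr x y z)) x' y' z'"
    unfolding astep_iff by blast
  then have "tr x y z = tr x' y' z'" using xyz ent_unique by blast
  then show ?thesis using *(2) by simp
qed

text \<open>Course-of-values induction on the position of the first triple, with the second one
  anywhere in the same computation. Comparing different computations is avoided: least ones have
  equal codes.\<close>

lemma comp_of_unique: "comp_of c x y z \<Longrightarrow> comp_of c x y z' \<Longrightarrow> z = z'"
proof -
  assume 1: "comp_of c x y z" and 2: "comp_of c x y z'"
  from 1 obtain l where l: "has_len c l" "\<forall>i<l. astep c i" by (auto simp: comp_of_def)
  have step: "follows (\<lambda>x y z. \<exists>p<i. ent c p (tr x y z)) x y z" if "ent c i (tr x y z)" for i x y z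
    using l that ent_index_less astep_follows by blast
  let ?P = "\<lambda>i. \<forall>j<l. \<forall>x<c+1. \<forall>y<c+1. \<forall>z<c+1. \<forall>z'<c+1. ent c i (tr x y z) \<longrightarrow> ent c j (tr x y z') \<longrightarrow> z = z'"
  have "D0 (\<lambda>e. ?P (e 0))" by (intro D0_intros)
  then have "?P i" for i
  proof (rule D0_less_induct)
    fix i assume IH: "\<And>j. j < i \<Longrightarrow> ?P j"
    have IH: "z = z'" if "p < i" "ent c p (tr x y z)" "ent c q (tr x y z')" for p q x y z z'
      using IH that ent_tr_le[OF that(2)] ent_tr_le[OF that(3)] ent_index_less[OF that(3) l(1)] by blast
    have "z = z'" if *: "ent c i (tr x y z)" "ent c j (tr x y z')" for j x y z z'
    proof (cases x rule: num_cases)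
      case 1
      then show ?thesis using step[OF *(1)] step[OF *(2)] by (auto simp: follows_def)
    next
      case x: (2 u)
      show ?thesis
      proof (cases y rule: num_cases)
        case 1
        then show ?thesis using step[OF *(1)] step[OF *(2)] x IH by (auto simp: follows_def)
      next
        case y: (2 v)
        obtain w p q where 1: "p < i" "q < i" "ent c p (tr x v w)" "ent c q (tr u w z)"
          using step[OF *(1)] x y by (auto simp: follows_def)
        obtain w' p' q' where 2: "ent c p' (tr x v w')" "ent c q' (tr u w' z')"
          using step[OF *(2)] x y by (auto simp: follows_def)
        have "w = w'" using IH 1 2 by blast
        then show ?thesis using IH 1 2 by blast
      qed
    qed
    then show "?P i" by blast
  qed
  then have "z = z'" if "ent c i (tr x y z)" "ent c j (tr x y z')" for i j
    using that ent_tr_le[OF that(1)] ent_tr_le[OF that(2)] ent_index_less[OF that(2) l(1)] by blast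
  then show ?thesis using 1 2 unfolding comp_of_iff by blast
qed

text \<open>Concatenate two computations and append the new triple at position
  \<open>l1 + l2\<close>. Equations with fewer than two premises use the empty computation
  0.\<close>

lemma ack_follows:
  assumes C1: "has_len c1 l1" "\<forall>i<l1. astep c1 i" and C2: "has_len c2 l2" "\<forall>i<l2. astep c2 i"
    and F: "follows (\<lambda>x y z. \<exists>i. ent c1 i (tr x y z) \<or> ent c2 i (tr x y z)) x y z"
  shows "ack x y z"
proof -
  let ?\<phi> = "\<lambda>i t. i < l1 \<and> ent c1 i t \<or> (\<exists>j<l2. i = l1 + j \<and> ent c2 j t) \<or> i = l1 + l2 \<and> t = tr x y z"
  have cases: "i < l1 \<or> (\<exists>j<l2. i = l1 + j) \<or> i = l1 + l2" if "i < l1 + l2 + 1" for i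
  proof (cases "i < l1")
    case False
    then obtain j where "i = l1 + j" by (auto simp: not_less num_le)
    then show ?thesis using that by (auto simp: add.assoc order.order_iff_strict)
  qed simp
  have "D0 (\<lambda>e. ?\<phi> (e 0) (e 1))" by (intro D0_intros)
  moreover have "\<exists>t. ?\<phi> i t" if "i < l1 + l2 + 1" for i
    using cases[OF that] ent_exists[OF C1(1)] ent_exists[OF C2(1)] by blast
  ultimately obtain c where c: "has_len c (l1+l2+1)" "\<forall>i<l1+l2+1. \<exists>t. ent c i t \<and> ?\<phi> i t"
    using comprehension[of ?\<phi> "l1+l2+1"] by blast
  have e1: "ent c i t" if "ent c1 i t" for i t
  proof -
    have "i < l1" using that C1(1) ent_index_less by blast
    moreover have "i < l1 + l2 + 1" using \<open>i < l1\<close> by (simp add: add_increasing2 less_imp_le)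
    ultimately show ?thesis using c(2) that ent_unique by (metis le_add_same_cancel1 not_le num_zero_le)
  qed
  have e2: "ent c (l1 + i) t" if "ent c2 i t" for i t
  proof -
    have "i < l2" using that C2(1) ent_index_less by blast
    moreover have "l1 + i < l1 + l2 + 1" using \<open>i < l2\<close> by (simp add: less_imp_le)
    ultimately show ?thesis using c(2)[rule_format, of "l1 + i"] that ent_unique by force
  qed
  have e3: "ent c (l1 + l2) (tr x y z)"
    using c(2)[rule_format, of "l1 + l2"] by auto
  have "astep c i" if "i < l1 + l2 + 1" for i
    using cases[OF that]
  proof (elim disjE exE conjE)
    assume "i < l1"
    then obtain x y z where "ent c1 i (tr x y z)" "follows (\<lambda>x y z. \<exists>p<i. ent c1 p (tr x y z)) x y z"
      using C1(2) unfolding astep_iff by blast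
    moreover from this have "follows (\<lambda>x y z. \<exists>p<i. ent c p (tr x y z)) x y z"
      using e1 by (elim follows_mono) blast
    ultimately show ?thesis using e1 unfolding astep_iff by blast
  next
    fix j assume j: "j < l2" "i = l1 + j"
    then obtain x y z where "ent c2 j (tr x y z)" "follows (\<lambda>x y z. \<exists>p<j. ent c2 p (tr x y z)) x y z"
      using C2(2) unfolding astep_iff by blast
    moreover from this have "follows (\<lambda>x y z. \<exists>p<i. ent c p (tr x y z)) x y z"
      using e2 j(2) by (elim follows_mono) (metis add_strict_left_mono)
    ultimately show ?thesis using e2 j unfolding astep_iff by blast
  next
    assume i: "i = l1 + l2"
    have "\<exists>p<i. ent c p t" if "ent c1 j t \<or> ent c2 j t" for j t
      using that
    proof
      assume "ent c1 j t"
      then show ?thesis using e1 ent_index_less[OF _ C1(1)] unfolding i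
        by (metis le_add_same_cancel1 num_zero_le order_less_le_trans)
    next
      assume "ent c2 j t"
      then show ?thesis using e2 ent_index_less[OF _ C2(1)] unfolding i by (metis add_strict_left_mono)
    qed
    then have "follows (\<lambda>x y z. \<exists>p<i. ent c p (tr x y z)) x y z"
      using F by (elim follows_mono) blast
    then show ?thesis using e3 i unfolding astep_iff by blast
  qed
  then show ?thesis using c(1) e3 unfolding ack_def comp_of_iff by blast
qed

lemma ack_0: "ack 0 y (y + 1)"
  by (rule ack_follows[of 0 0 0 0]) (simp_all add: has_len_0 follows_def)

lemma ack_Suc_0: "ack x 1 z \<Longrightarrow> ack (x + 1) 0 z"
  unfolding ack_def[of x] comp_of_iff
  by (elim exE conjE, rule ack_follows[of _ _ 0 0]) (auto simp: has_len_0 follows_def)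

lemma ack_Suc_Suc: "ack (x + 1) y w \<Longrightarrow> ack x w z \<Longrightarrow> ack (x + 1) (y + 1) z"
proof -
  assume "ack (x + 1) y w" "ack x w z"
  then obtain c c' l l' where 1: "has_len c l" "\<forall>i<l. astep c i" "has_len c' l'" "\<forall>i<l'. astep c' i"
    and *: "\<exists>i. ent c i (tr (x + 1) y w)" "\<exists>i. ent c' i (tr x w z)"
    unfolding ack_def comp_of_iff by blast
  have "follows (\<lambda>x y z. \<exists>i. ent c i (tr x y z) \<or> ent c' i (tr x y z)) (x + 1) (y + 1) z"
    unfolding follows_def using * by blast
  with 1 show ?thesis by (rule ack_follows)
qed

section \<open>The tree of calls and its Delta_0 enumeration\<close>

section \<open>The tree of recursive calls\<close>

lemma pre_less: "pre \<rho> \<tau> \<Longrightarrow> \<rho> \<noteq> \<tau> \<Longrightarrow> \<rho> < \<tau>"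
proof -
  assume *: "pre \<rho> \<tau>" "\<rho> \<noteq> \<tau>"
  obtain k l where kl: "has_len \<rho> k" "has_len \<tau> l" using * pre_sq is_sq_len by meson
  then have "k \<le> l" "k \<noteq> l" using * pre_len pre_same_len by blast+
  then have "k < l" by order
  then obtain \<sigma> where "\<sigma> < \<tau>" "pre \<sigma> \<tau>" "has_len \<sigma> k" using restrict[of \<tau> l k] kl * pre_sq by blast
  then show ?thesis using * kl pre_linear[of \<rho> \<tau> \<sigma> k k] pre_same_len by blast
qed

lemma comp_of_le: "comp_of c x y z \<Longrightarrow> x < c + 1 \<and> y < c + 1 \<and> z < c + 1"
  unfolding comp_of_def using ent_tr_le by blast

text \<open>
  \<open>LW x j y C\<close>: the \<open>j\<close>-fold iterate \<open>y\<close> of \<open>A(x - 1, \<cdot>)\<close> on \<open>1\<close>, that is, \<open>A(x, j - 1)\<close> if \<open>j > 0\<close>,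
  is computed by the least possible computation \<open>C\<close>.
\<close>

definition LW :: "num \<Rightarrow> num \<Rightarrow> num \<Rightarrow> num \<Rightarrow> bool" where
  "LW x j y C \<longleftrightarrow> j = 0 \<and> y = 1 \<and> C = 0 \<or>
     (\<exists>k<j. j = k + 1 \<and> comp_of C x k y \<and> (\<forall>D<C. \<forall>z<D+1. \<not> comp_of D x k z))"

lemma D0_LW [D0_intros]:
  "Tm f \<Longrightarrow> Tm g \<Longrightarrow> Tm h \<Longrightarrow> Tm k \<Longrightarrow> D0 (\<lambda>e. LW (f e) (g e) (h e) (k e))"
  by (rule D0_comp4[of LW]) (unfold LW_def, intro D0_intros)

lemma LW_Suc: "LW x (k+1) y C \<longleftrightarrow> comp_of C x k y \<and> (\<forall>D<C. \<forall>z. \<not> comp_of D x k z)"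
proof -
  have "(\<forall>z<D+1. \<not> comp_of D x k z) \<longleftrightarrow> (\<forall>z. \<not> comp_of D x k z)" for D
    using comp_of_le by blast
  then show ?thesis unfolding LW_def by simp
qed

text \<open>Leastness determines the code \<open>C\<close>, and a single computation yields a single
  value.\<close>

lemma LW_unique: "LW x j y C \<Longrightarrow> LW x j y' C' \<Longrightarrow> y = y' \<and> C = C'"
proof (cases j rule: num_cases)
  case (2 k)
  assume "LW x j y C" "LW x j y' C'"
  then have *: "comp_of C x k y" "comp_of C' x k y'"
    "\<And>D z. D < C \<Longrightarrow> \<not> comp_of D x k z" "\<And>D z. D < C' \<Longrightarrow> \<not> comp_of D x k z"
    unfolding 2 LW_Suc by blast+
  then have "C = C'" by (meson linorder_neqE)
  then show ?thesis using * comp_of_unique by blast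
qed (auto simp: LW_def)

text \<open>The 2 is due to index 0, where \<open>y = 1\<close> and \<open>C = 0\<close>; for
  positive indices \<open>y\<close> is at most \<open>C\<close>.\<close>

lemma LW_le: "LW x j y C \<Longrightarrow> y < C + 2"
  using comp_of_le unfolding LW_def one_add_one[symmetric] add.assoc[symmetric]
  by (auto intro: order_less_imp_le order_trans)

lemma LW_0: "LW x 0 1 0"
  by (simp add: LW_def)

lemma ack_LW: "ack x k y \<Longrightarrow> \<exists>y C. LW x (k+1) y C"
proof -
  assume "ack x k y"
  then obtain c where "\<exists>z<c+1. comp_of c x k z" using comp_of_le unfolding ack_def by blast
  moreover have "D0 (\<lambda>e. \<exists>z<e 0+1. comp_of (e 0) x k z)" by (intro D0_intros)
  ultimately obtain C where "\<exists>z<C+1. comp_of C x k z" "\<forall>D<C. \<not> (\<exists>z<D+1. comp_of D x k z)"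
    using D0_least[of "\<lambda>c. \<exists>z<c+1. comp_of c x k z" c] by blast
  then have "\<exists>y. comp_of C x k y" "\<forall>D<C. \<forall>z. \<not> comp_of D x k z" using comp_of_le by blast+
  then show ?thesis unfolding LW_Suc by blast
qed

lemma LW_ack: "LW x (k+1) y C \<Longrightarrow> ack x k y"
  by (auto simp: LW_def ack_def)

lemma pr_mono: "x \<le> x' \<Longrightarrow> y \<le> y' \<Longrightarrow> pr x y \<le> pr x' y'"
  unfolding pr_def by (intro add_mono mult_mono) (auto intro: add_mono)

context
  fixes m n :: num
begin

text \<open>
  An entry of a node is a pair of an index \<open>j\<close> and a computation. \<open>Arg \<tau> i y C\<close>: the first \<open>i\<close>
  entries of \<open>\<tau>\<close> lead to the call \<open>A(m - i, y)\<close>, and \<open>C\<close> computes its argument \<open>y\<close>.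
\<close>

definition Arg :: "num \<Rightarrow> num \<Rightarrow> num \<Rightarrow> num \<Rightarrow> bool" where
  "Arg \<tau> i y C \<longleftrightarrow> i = 0 \<and> y = n \<and> C = 0 \<or>
     (\<exists>k<i. \<exists>x<m+1. \<exists>j<\<tau>+1. \<exists>D<\<tau>+1. i = k + 1 \<and> k + x = m \<and> ent \<tau> k (pr j D) \<and> LW x j y C)"

lemma D0_Arg [D0_intros]:
  "Tm f \<Longrightarrow> Tm g \<Longrightarrow> Tm h \<Longrightarrow> Tm k \<Longrightarrow> D0 (\<lambda>e. Arg (f e) (g e) (h e) (k e))"
  by (rule D0_comp4[of Arg]) (unfold Arg_def, intro D0_intros)

lemma ent_pr_le: "ent \<tau> k (pr j D) \<Longrightarrow> j < \<tau> + 1 \<and> D < \<tau> + 1"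
  using ent_le[of \<tau> k "pr j D"] pr_ge(1)[of j D] pr_ge(2)[of D j] by (auto intro: order_trans)

lemma Arg_0: "Arg \<tau> 0 y C \<longleftrightarrow> y = n \<and> C = 0"
  by (simp add: Arg_def)

lemma Arg_Suc: "Arg \<tau> (k+1) y C \<longleftrightarrow> (\<exists>x j D. k + x = m \<and> ent \<tau> k (pr j D) \<and> LW x j y C)"
proof
  assume "\<exists>x j D. k + x = m \<and> ent \<tau> k (pr j D) \<and> LW x j y C"
  then obtain x j D where *: "k + x = m" "ent \<tau> k (pr j D)" "LW x j y C" by blast
  moreover have "x < m + 1" using *(1) by auto
  ultimately show "Arg \<tau> (k+1) y C" unfolding Arg_def using ent_pr_le[OF *(2)] by auto
qed (auto simp: Arg_def)

lemma Arg_unique: "Arg \<tau> i y C \<Longrightarrow> Arg \<tau> i y' C' \<Longrightarrow> y = y' \<and> C = C'"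
proof (cases i rule: num_cases)
  case (2 k)
  assume "Arg \<tau> i y C" "Arg \<tau> i y' C'"
  then obtain x j D x' j' D' where *: "k + x = m" "ent \<tau> k (pr j D)" "LW x j y C"
    "k + x' = m" "ent \<tau> k (pr j' D')" "LW x' j' y' C'" unfolding 2 Arg_Suc by blast
  then have "x = x'" by (metis add_left_imp_eq)
  moreover have "j = j'" using * ent_unique[of \<tau> k "pr j D" "pr j' D'"] by simp
  ultimately show ?thesis using * LW_unique by blast
qed (auto simp: Arg_0)

text \<open>The summand \<open>n\<close> covers the root, whose argument is \<open>n\<close> while
  its computation is the dummy 0.\<close>

lemma Arg_le: "Arg \<tau> i y C \<Longrightarrow> y < n + C + 2"
proof (cases i rule: num_cases)
  case (2 k)
  assume "Arg \<tau> i y C"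
  then have "y < C + 2" unfolding 2 Arg_Suc using LW_le by blast
  also have "C + 2 \<le> n + C + 2" by simp
  finally show ?thesis .
qed (simp add: Arg_0 add.assoc add_pos_nonneg)

text \<open>For positive \<open>i\<close>, only the entry with index \<open>i - 1\<close> matters,
  and both sequences have it.\<close>

lemma Arg_pre:
  assumes "pre \<sigma> \<tau>" "has_len \<sigma> l" "i \<le> l"
  shows "Arg \<sigma> i y C \<longleftrightarrow> Arg \<tau> i y C"
proof (cases i rule: num_cases)
  case (2 k)
  then have "k < l" using assms(3) by (simp add: num_less_iff)
  then have "ent \<sigma> k u \<longleftrightarrow> ent \<tau> k u" for u
    using pre_ent[OF assms(1)] pre_ent'[OF assms(1,2)] by blast
  then show ?thesis unfolding 2 Arg_Suc by simp
qed (simp add: Arg_0)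

text \<open>The entry with index \<open>i\<close> stores the computation of the argument on level
  \<open>i\<close>. Length \<open>m + 1\<close> is therefore allowed, so that the argument of the
  call of \<open>A(0, y)\<close> on level \<open>m\<close> is covered too.\<close>

definition node :: "num \<Rightarrow> bool" where
  "node \<tau> \<longleftrightarrow> is_sq \<tau> \<and> (\<exists>l<\<tau>+1. has_len \<tau> l \<and> l \<le> m + 1 \<and>
     (\<forall>i<l. \<exists>j<\<tau>+1. \<exists>C<\<tau>+1. \<exists>y<n+\<tau>+2. ent \<tau> i (pr j C) \<and> Arg \<tau> i y C \<and> j \<le> y))"

lemma D0_node [D0_intros]: "Tm f \<Longrightarrow> D0 (\<lambda>e. node (f e))"
  by (rule D0_comp1[of node]) (unfold node_def, intro D0_intros)

lemma node_iff:
  "node \<tau> \<longleftrightarrow> is_sq \<tau> \<and> (\<exists>l. has_len \<tau> l \<and> l \<le> m + 1 \<and>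
     (\<forall>i<l. \<exists>j C y. ent \<tau> i (pr j C) \<and> Arg \<tau> i y C \<and> j \<le> y))" (is "_ \<longleftrightarrow> ?R")
proof
  assume ?R
  then obtain l where l: "is_sq \<tau>" "has_len \<tau> l" "l \<le> m + 1"
    "\<forall>i<l. \<exists>j C y. ent \<tau> i (pr j C) \<and> Arg \<tau> i y C \<and> j \<le> y" by blast
  have "\<exists>j<\<tau>+1. \<exists>C<\<tau>+1. \<exists>y<n+\<tau>+2. ent \<tau> i (pr j C) \<and> Arg \<tau> i y C \<and> j \<le> y" if i: "i < l" for i
  proof -
    obtain j C y where *: "ent \<tau> i (pr j C)" "Arg \<tau> i y C" "j \<le> y" using l(4) i by blast
    then have "y < n + C + 2" using Arg_le by blast
    also have "n + C + 2 \<le> n + \<tau> + 2" using ent_pr_le[OF *(1)] by simp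
    finally show ?thesis using * ent_pr_le[OF *(1)] by blast
  qed
  then show "node \<tau>" unfolding node_def using l has_len_ent_le by blast
qed (unfold node_def, blast)

lemma node_len: "node \<tau> \<Longrightarrow> has_len \<tau> l \<Longrightarrow> l \<le> m + 1"
  unfolding node_iff using has_len_unique by blast

lemma node_sq: "node \<tau> \<Longrightarrow> is_sq \<tau>"
  by (simp add: node_iff)

lemma node_0: "node 0"
  unfolding node_iff using is_sq_0 has_len_0 by (auto intro!: exI[of _ 0])

definition extendable :: "num \<Rightarrow> num \<Rightarrow> num \<Rightarrow> bool" where
  "extendable \<sigma> j C \<longleftrightarrow> node \<sigma> \<and>
     (\<exists>l<\<sigma>+1. \<exists>y<n+C+2. has_len \<sigma> l \<and> l \<le> m \<and> Arg \<sigma> l y C \<and> j \<le> y)"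

lemma D0_extendable [D0_intros]:
  "Tm f \<Longrightarrow> Tm g \<Longrightarrow> Tm h \<Longrightarrow> D0 (\<lambda>e. extendable (f e) (g e) (h e))"
  by (rule D0_comp3[of extendable]) (unfold extendable_def, intro D0_intros)

lemma extendable_iff:
  "extendable \<sigma> j C \<longleftrightarrow> node \<sigma> \<and> (\<exists>l y. has_len \<sigma> l \<and> l \<le> m \<and> Arg \<sigma> l y C \<and> j \<le> y)"
  unfolding extendable_def using has_len_ent_le(1) Arg_le by meson

text \<open>All children of a node carry the same computation, hence share one stage.\<close>

lemma extendable_unique: "extendable \<sigma> j C \<Longrightarrow> extendable \<sigma> j' C' \<Longrightarrow> C = C'"
  unfolding extendable_iff using Arg_unique has_len_unique by metis

lemma node_app:
  assumes "extendable \<sigma> j C" and "app \<sigma> (pr j C) \<tau>"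
  shows "node \<tau>"
proof -
  obtain l y where l: "has_len \<sigma> l" "l \<le> m" "Arg \<sigma> l y C" "j \<le> y" "node \<sigma>"
    using assms(1) unfolding extendable_iff by blast
  have \<tau>: "pre \<sigma> \<tau>" "has_len \<tau> (l+1)" "ent \<tau> l (pr j C)"
    using assms(2) l(1) has_len_unique unfolding app_iff by blast+
  have "\<exists>j C y. ent \<tau> i (pr j C) \<and> Arg \<tau> i y C \<and> j \<le> y" if "i < l + 1" for i
    using that
  proof (rule num_less_cases)
    assume "i < l"
    then obtain j C y where "ent \<sigma> i (pr j C)" "Arg \<sigma> i y C" "j \<le> y"
      using l(1,5) has_len_unique unfolding node_iff by blast
    then show ?thesis using \<tau>(1) pre_ent Arg_pre[OF \<tau>(1) l(1)] \<open>i < l\<close> order_less_imp_le by blast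
  next
    assume "i = l"
    then show ?thesis using \<tau>(3) l Arg_pre[OF \<tau>(1) l(1)] by blast
  qed
  then show ?thesis unfolding node_iff using \<tau> l(2) pre_sq by auto
qed

lemma node_cases: "node \<tau> \<Longrightarrow> \<tau> = 0 \<or> (\<exists>\<sigma> j C. extendable \<sigma> j C \<and> app \<sigma> (pr j C) \<tau>)"
proof -
  assume "node \<tau>"
  then obtain l where l: "is_sq \<tau>" "has_len \<tau> l" "l \<le> m + 1"
    "\<forall>i<l. \<exists>j C y. ent \<tau> i (pr j C) \<and> Arg \<tau> i y C \<and> j \<le> y" unfolding node_iff by blast
  show ?thesis
  proof (cases l rule: num_cases)
    case 1
    then show ?thesis using l has_len_0_eq by blast
  next
    case (2 k)
    then obtain \<sigma> u where \<sigma>: "app \<sigma> u \<tau>" "has_len \<sigma> k" using app_split l by blast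
    then have pre: "pre \<sigma> \<tau>" "ent \<tau> k u" using l(2) 2 has_len_unique unfolding app_iff by blast+
    obtain j C y where *: "ent \<tau> k (pr j C)" "Arg \<tau> k y C" "j \<le> y" using l(4) 2 by auto
    have u: "u = pr j C" using * pre ent_unique by blast
    have "\<exists>j C y. ent \<sigma> i (pr j C) \<and> Arg \<sigma> i y C \<and> j \<le> y" if "i < k" for i
    proof -
      have "i < l" using \<open>i < k\<close> 2 by (simp add: less_imp_le)
      then obtain j C y where "ent \<tau> i (pr j C)" "Arg \<tau> i y C" "j \<le> y" using l(4) by blast
      then show ?thesis using pre_ent'[OF pre(1) \<sigma>(2)] Arg_pre[OF pre(1) \<sigma>(2)] that order_less_imp_le by blast
    qed
    moreover have "k \<le> m" "k \<le> m + 1" using l(3) 2 by (auto intro: order_trans[of k m])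
    ultimately have "node \<sigma>" unfolding node_iff using pre_sq pre \<sigma>(2) by blast
    then have "extendable \<sigma> j C" unfolding extendable_iff
      using * Arg_pre[OF pre(1) \<sigma>(2)] \<sigma>(2) \<open>k \<le> m\<close> by blast
    then show ?thesis using \<sigma>(1) u by blast
  qed
qed

text \<open>
  The stage at which a node is enumerated; it is determined by the parent \<open>\<sigma>\<close> of the node, and it
  increases strictly along branches because codes bound their entries.
\<close>

definition stg :: "num \<Rightarrow> num \<Rightarrow> bool" where
  "stg \<tau> s \<longleftrightarrow> \<tau> = 0 \<and> s = 0 \<or>
     (\<exists>\<sigma> j C. extendable \<sigma> j C \<and> app \<sigma> (pr j C) \<tau> \<and> s = pr (\<sigma> * \<sigma>) C + 1)"

lemma app_ne_0: "\<not> app \<sigma> u 0"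
  using app_less by force

lemma stg_unique: "stg \<tau> s \<Longrightarrow> stg \<tau> s' \<Longrightarrow> s = s'"
proof (cases "\<tau> = 0")
  case False
  assume "stg \<tau> s" "stg \<tau> s'"
  then obtain \<sigma> j C \<sigma>' j' C' where *: "app \<sigma> (pr j C) \<tau>" "s = pr (\<sigma> * \<sigma>) C + 1"
    "app \<sigma>' (pr j' C') \<tau>" "s' = pr (\<sigma>' * \<sigma>') C' + 1"
    using False unfolding stg_def by blast
  then show ?thesis using app_inj[OF *(1,3)] by simp
qed (auto simp: stg_def app_ne_0)

lemma stg_node: "stg \<tau> s \<Longrightarrow> node \<tau>"
  unfolding stg_def using node_0 node_app by blast

lemma node_stg: "node \<tau> \<Longrightarrow> \<exists>s. stg \<tau> s"
  unfolding stg_def using node_cases by blast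

text \<open>For the parents \<open>\<sigma>'\<close> of \<open>\<rho>\<close> and
  \<open>\<sigma>\<close> of \<open>\<tau>\<close>, both \<open>\<sigma>'\<close> and
  \<open>C'\<close> are below \<open>\<rho> \<le> \<sigma>\<close>, so
  \<open>\<sigma>' * \<sigma>' + C' < \<sigma> * \<sigma>\<close>. The square is chosen for this
  inequality, because \<open>pr\<close> compares the sums of the components first. The
  \<open>+ 1\<close> leaves stage 0 to the root.\<close>

lemma stg_less:
  assumes "stg \<rho> r" and "stg \<tau> s" and "pre \<rho> \<tau>" and "\<rho> \<noteq> \<tau>"
  shows "r < s"
proof -
  have "\<tau> \<noteq> 0" using pre_less[OF assms(3,4)] by auto
  then obtain \<sigma> j C where \<tau>: "extendable \<sigma> j C" "app \<sigma> (pr j C) \<tau>" "s = pr (\<sigma> * \<sigma>) C + 1"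
    using assms(2) unfolding stg_def by blast
  have "\<rho> \<le> \<sigma>" using pre_app[OF assms(3) \<tau>(2)] assms(4) pre_less by (metis order.order_iff_strict)
  show ?thesis
  proof (cases "\<rho> = 0")
    case True
    then have "r = 0" using assms(1) app_ne_0 unfolding stg_def by blast
    then show ?thesis using \<tau>(3) by simp
  next
    case False
    then obtain \<sigma>' j' C' where \<rho>: "extendable \<sigma>' j' C'" "app \<sigma>' (pr j' C') \<rho>" "r = pr (\<sigma>' * \<sigma>') C' + 1"
      using assms(1) unfolding stg_def by blast
    have "\<sigma>' < \<rho>" "pr j' C' < \<rho>" using app_less[OF \<rho>(2)] by blast+
    then have "\<sigma>' < \<sigma>" "C' < \<sigma>" using pr_ge(2)[of C' j'] \<open>\<rho> \<le> \<sigma>\<close> by simp_all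
    then obtain z where z: "\<sigma> = \<sigma>' + z + 1" by (elim num_lessE)
    have "(\<sigma>' + z + 1) * (\<sigma>' + z + 1) = \<sigma>' * \<sigma>' + (\<sigma>' + z + 1) + (\<sigma>' + z + \<sigma>' * z + \<sigma>' * z + z * z)"
      by (simp add: algebra_simps)
    then have "\<sigma>' * \<sigma>' + \<sigma> \<le> \<sigma> * \<sigma>" unfolding z by simp
    have "\<sigma>' * \<sigma>' + C' < \<sigma>' * \<sigma>' + \<sigma>" using \<open>C' < \<sigma>\<close> by simp
    also note \<open>\<sigma>' * \<sigma>' + \<sigma> \<le> \<sigma> * \<sigma>\<close>
    also have "\<sigma> * \<sigma> \<le> \<sigma> * \<sigma> + C" by simp
    finally have "pr (\<sigma>' * \<sigma>') C' < pr (\<sigma> * \<sigma>) C" by (rule pr_less)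
    then show ?thesis unfolding \<rho>(3) \<tau>(3) by (simp only: add_less_cancel_right)
  qed
qed

definition InE :: "num \<Rightarrow> num \<Rightarrow> bool" where
  "InE s x \<longleftrightarrow> x = 0 \<or> (\<exists>\<sigma><x+1. \<exists>j<x+1. \<exists>C<x+1. extendable \<sigma> j C \<and> app \<sigma> (pr j C) x \<and> pr (\<sigma> * \<sigma>) C + 1 \<le> s)"

lemma D0_InE [D0_intros]: "Tm f \<Longrightarrow> Tm g \<Longrightarrow> D0 (\<lambda>e. InE (f e) (g e))"
  by (rule D0_comp2[of InE]) (unfold InE_def, intro D0_intros)

lemma InE_iff: "InE s x \<longleftrightarrow> (\<exists>r\<le>s. stg x r)"
proof -
  have "\<sigma> < x + 1" "j < x + 1" "C < x + 1" if "app \<sigma> (pr j C) x" for \<sigma> j C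
    using app_less[OF that] pr_ge(1)[of j C] pr_ge(2)[of C j] by auto
  then have "InE s x \<longleftrightarrow> x = 0 \<or> (\<exists>\<sigma> j C. extendable \<sigma> j C \<and> app \<sigma> (pr j C) x \<and> pr (\<sigma> * \<sigma>) C + 1 \<le> s)"
    unfolding InE_def by blast
  moreover have "0 \<le> s" by simp
  ultimately show ?thesis unfolding stg_def by blast
qed

text \<open>That \<open>e\<close> contains every node of stage at most \<open>s\<close> would
  quantify over unbounded codes. Instead, the data \<open>\<sigma>\<close>, \<open>j\<close>,
  \<open>C\<close> of a child range below bounds given by the stage, and the child itself is sought
  inside \<open>e\<close>.\<close>

definition Good :: "num \<Rightarrow> num \<Rightarrow> bool" where
  "Good s e \<longleftrightarrow> (\<forall>x<e+1. mem x e \<longrightarrow> InE s x) \<and> mem 0 e \<and>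
     (\<forall>\<sigma><s+1. \<forall>C<s+1. \<forall>j<n+s+2. extendable \<sigma> j C \<longrightarrow> pr (\<sigma> * \<sigma>) C + 1 \<le> s \<longrightarrow>
        (\<exists>x<e+1. mem x e \<and> app \<sigma> (pr j C) x))"

text \<open>A finite set has many codes; taking the least one makes the enumeration a
  function.\<close>

definition EE :: "num \<Rightarrow> num \<Rightarrow> bool"
  where "EE s e \<longleftrightarrow> Good s e \<and> (\<forall>d<e. \<not> Good s d)"

lemma D0_Good [D0_intros]: "Tm f \<Longrightarrow> Tm g \<Longrightarrow> D0 (\<lambda>e. Good (f e) (g e))"
  by (rule D0_comp2[of Good]) (unfold Good_def, intro D0_intros)

lemma D0_EE [D0_intros]: "Tm f \<Longrightarrow> Tm g \<Longrightarrow> D0 (\<lambda>e. EE (f e) (g e))"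
  by (rule D0_comp2[of EE]) (unfold EE_def, intro D0_intros)

lemma mem_le: "mem x e \<Longrightarrow> x < e + 1"
  unfolding mem_iff using ent_le by auto

lemma extendable_bounds:
  assumes "extendable \<sigma> j C" and "pr (\<sigma> * \<sigma>) C + 1 \<le> s"
  shows "\<sigma> < s + 1" "C < s + 1" "j < n + s + 2"
proof -
  have "\<sigma> \<le> \<sigma> * \<sigma>" by (cases "\<sigma> = 0") simp_all
  then have "\<sigma> \<le> pr (\<sigma> * \<sigma>) C" using pr_ge(1) order_trans by blast
  moreover have "pr (\<sigma> * \<sigma>) C < s" using assms(2) by (simp add: num_less_iff)
  moreover have "C \<le> pr (\<sigma> * \<sigma>) C" by (rule pr_ge)
  ultimately show *: "\<sigma> < s + 1" "C < s + 1" by auto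
  have "j < n + C + 2" using assms(1) unfolding extendable_def by (meson order_le_less_trans)
  also have "n + C + 2 \<le> n + s + 2" using *(2) by simp
  finally show "j < n + s + 2" .
qed

lemma Good_iff: "Good s e \<longleftrightarrow> (\<forall>x. mem x e \<longleftrightarrow> InE s x)"
proof
  assume G: "Good s e"
  show "\<forall>x. mem x e \<longleftrightarrow> InE s x"
  proof (intro allI iffI)
    fix x assume "InE s x"
    then show "mem x e"
    proof (cases "x = 0")
      case False
      then obtain \<sigma> j C where "extendable \<sigma> j C" "app \<sigma> (pr j C) x" "pr (\<sigma> * \<sigma>) C + 1 \<le> s"
        using \<open>InE s x\<close> unfolding InE_def by blast
      then show ?thesis using G extendable_bounds app_unique unfolding Good_def by metis
    qed (use G in \<open>simp add: Good_def\<close>)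
  next
    fix x assume "mem x e"
    then show "InE s x" using G mem_le unfolding Good_def by blast
  qed
next
  assume *: "\<forall>x. mem x e \<longleftrightarrow> InE s x"
  have "\<exists>x<e+1. mem x e \<and> app \<sigma> (pr j C) x" if "extendable \<sigma> j C" "pr (\<sigma> * \<sigma>) C + 1 \<le> s" for \<sigma> j C
  proof -
    have "is_sq \<sigma>" using that(1) node_sq unfolding extendable_def by blast
    then obtain x where "app \<sigma> (pr j C) x" using app_exists by blast
    moreover from this that have "InE s x" unfolding InE_iff stg_def by blast
    ultimately show ?thesis using * mem_le by blast
  qed
  then show "Good s e" using * unfolding Good_def by (auto simp: InE_def)
qed

lemma Good_exists: "\<exists>e. Good s e"
proof -
  \<comment> \<open>The monotonicity of \<open>pr\<close> puts every pair of a parent and a new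
    entry possible by stage \<open>s\<close> at or below \<open>?N\<close>, so collection bounds all
    the resulting children by \<open>B\<close>.\<close>
  let ?N = "pr s (pr (n+s+2) s)"
  let ?\<phi> = "\<lambda>i x. \<forall>\<sigma><i+1. \<forall>u<i+1. i = pr \<sigma> u \<longrightarrow> is_sq \<sigma> \<longrightarrow> app \<sigma> u x"
  have "D0 (\<lambda>e. ?\<phi> (e 0) (e 1))" by (intro D0_intros)
  moreover have "\<exists>x. ?\<phi> i x" for i
  proof (cases "\<exists>\<sigma> u. i = pr \<sigma> u \<and> is_sq \<sigma>")
    case True
    then obtain \<sigma> u x where "i = pr \<sigma> u" "app \<sigma> u x" using app_exists by blast
    then show ?thesis by auto
  qed blast
  ultimately obtain B where B: "\<forall>i<?N+1. \<exists>x<B+1. ?\<phi> i x" using collection[of ?\<phi> "?N+1"] by blast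
  have bound: "x \<le> B" if x: "InE s x" for x
  proof (cases "x = 0")
    case False
    then obtain \<sigma> j C where *: "extendable \<sigma> j C" "app \<sigma> (pr j C) x" "pr (\<sigma> * \<sigma>) C + 1 \<le> s"
      using x unfolding InE_def by blast
    let ?i = "pr \<sigma> (pr j C)"
    have "\<sigma> \<le> s" "j \<le> n + s + 2" "C \<le> s" using extendable_bounds[OF *(1,3)] by auto
    then have "?i < ?N + 1" by (simp add: pr_mono)
    then obtain y where "y < B + 1" "?\<phi> ?i y" using B by blast
    moreover have "\<sigma> < ?i + 1" "pr j C < ?i + 1" using pr_ge by auto
    moreover have "is_sq \<sigma>" using *(1) node_sq unfolding extendable_def by blast
    ultimately have "app \<sigma> (pr j C) y" "y < B + 1" by blast+
    then show ?thesis using *(2) app_unique by auto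
  qed simp
  have "D0 (\<lambda>e. InE s (e 0))" by (intro D0_intros)
  moreover have "InE s 0" by (simp add: InE_def)
  ultimately obtain e where "\<forall>x. mem x e \<longleftrightarrow> x \<le> B \<and> InE s x" using set_comprehension[of "InE s"] by blast
  then show ?thesis using bound unfolding Good_iff by blast
qed

lemma EE_exists: "\<exists>e. EE s e"
proof -
  have "D0 (\<lambda>e. Good s (e 0))" by (intro D0_intros)
  then show ?thesis using Good_exists D0_least[of "Good s"] unfolding EE_def by blast
qed

lemma EE_unique: "EE s e \<Longrightarrow> EE s d \<Longrightarrow> d = e"
  unfolding EE_def by (metis linorder_neqE)

lemma EE_mem: "EE s e \<Longrightarrow> mem x e \<longleftrightarrow> InE s x"
  unfolding EE_def Good_iff by blast

end

section \<open>The hypotheses of BME_* for this enumeration\<close>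

section \<open>Satisfaction of the formulas on enumerations\<close>

definition gr :: "fm \<Rightarrow> (nat \<Rightarrow> num) \<Rightarrow> num \<Rightarrow> num \<Rightarrow> bool"
  where "gr \<epsilon> e s v \<longleftrightarrow> sat (case_nat s (case_nat v e)) \<epsilon>"

lemma sat_value_is [simp]: "sat e (value_is \<epsilon> s t) \<longleftrightarrow> gr \<epsilon> e (val e s) (val e t)"
proof -
  have "(\<lambda>n. val e (case_nat s (case_nat t Var) n)) = case_nat (val e s) (case_nat (val e t) e)"
    by (auto simp: fun_eq_iff split: nat.split)
  then show ?thesis by (simp add: value_is_def sat_subst gr_def)
qed

lemma gr_upE [simp]: "gr (upE k \<epsilon>) e = gr \<epsilon> (\<lambda>n. e (n + k))"
proof -
  have *: "(\<lambda>n. val (case_nat s (case_nat v e)) (case_nat (Var 0) (case_nat (Var 1) (\<lambda>n. Var (n + k + 2))) n))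
      = case_nat s (case_nat v (\<lambda>n. e (n + k)))" for s v
    by (auto simp: fun_eq_iff split: nat.split)
  show ?thesis by (intro ext) (simp only: upE_def sat_subst gr_def *)
qed

definition in_st :: "(num \<Rightarrow> num \<Rightarrow> bool) \<Rightarrow> num \<Rightarrow> num \<Rightarrow> bool"
  where "in_st G s x \<longleftrightarrow> (\<exists>v. G s v \<and> mem x v)"

definition enum_at :: "(num \<Rightarrow> num \<Rightarrow> bool) \<Rightarrow> num \<Rightarrow> num \<Rightarrow> bool"
  where "enum_at G s x \<longleftrightarrow> in_st G s x \<and> \<not> (\<exists>r. s = r + 1 \<and> in_st G r x)"

definition enum_before :: "(num \<Rightarrow> num \<Rightarrow> bool) \<Rightarrow> num \<Rightarrow> num \<Rightarrow> bool"
  where "enum_before G s x \<longleftrightarrow> (\<exists>r<s. enum_at G r x)"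

definition longest :: "(num \<Rightarrow> num \<Rightarrow> bool) \<Rightarrow> num \<Rightarrow> num \<Rightarrow> num \<Rightarrow> bool" where
  "longest G s \<tau> \<tau>\<^sub>0 \<longleftrightarrow> pre \<tau>\<^sub>0 \<tau> \<and> enum_before G s \<tau>\<^sub>0 \<and>
     (\<forall>\<rho>. pre \<rho> \<tau> \<and> enum_before G s \<rho> \<longrightarrow> (\<exists>k l. has_len \<rho> k \<and> has_len \<tau>\<^sub>0 l \<and> k \<le> l))"

lemma sat_in_stage [simp]:
  "sat e (in_stage \<epsilon> s \<tau>) \<longleftrightarrow> in_st (gr \<epsilon> e) (val e s) (val e \<tau>)"
  by (simp add: in_stage_def in_st_def)

lemma sat_enumerated_at [simp]:
  "sat e (enumerated_at \<epsilon> s \<tau>) \<longleftrightarrow> enum_at (gr \<epsilon> e) (val e s) (val e \<tau>)"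
  by (simp add: enumerated_at_def enum_at_def)

lemma sat_enumerated_before [simp]:
  "sat e (enumerated_before \<epsilon> s \<tau>) \<longleftrightarrow> enum_before (gr \<epsilon> e) (val e s) (val e \<tau>)"
  by (simp add: enumerated_before_def enum_before_def)

lemma sat_longest_before [simp]:
  "sat e (longest_before \<epsilon> s \<tau> \<tau>\<^sub>0) \<longleftrightarrow> longest (gr \<epsilon> e) (val e s) (val e \<tau>) (val e \<tau>\<^sub>0)"
  by (simp add: longest_before_def longest_def sat_not_longer)

lemma sat_monotone_enumeration:
  "sat e (monotone_enumeration \<epsilon>) \<longleftrightarrow> (let G = gr \<epsilon> e in
     (\<forall>s. \<exists>v. G s v \<and> (\<forall>w. G s w \<longrightarrow> w = v)) \<and>
     (\<forall>s x. in_st G s x \<longrightarrow> is_sq x \<and> in_st G (s + 1) x) \<and>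
     (\<exists>x. is_sq x \<and> has_len x 0 \<and> enum_at G 0 x) \<and>
     (\<forall>s. \<exists>v. \<forall>x. enum_at G s x \<longrightarrow> mem x v) \<and>
     (\<forall>s \<tau> \<tau>\<^sub>0. enum_at G s \<tau> \<and> longest G s \<tau> \<tau>\<^sub>0 \<longrightarrow>
        \<not> (\<exists>\<rho>. pre \<tau>\<^sub>0 \<rho> \<and> \<rho> \<noteq> \<tau>\<^sub>0 \<and> enum_before G s \<rho>) \<and> (\<forall>\<rho>. enum_at G s \<rho> \<longrightarrow> pre \<tau>\<^sub>0 \<rho>)))"
  by (simp add: monotone_enumeration_def is_function_def increasing_sets_of_seqs_def Let_def
      eval_nat_numeral)

lemma sat_stage_by_stage:
  "sat e (stage_by_stage \<epsilon> \<tau> c) \<Longrightarrow> \<exists>l. has_len (val e c) l \<and> ent (val e c) 0 (val e \<tau>) \<and>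
     (\<forall>i. i + 1 < l \<longrightarrow> (\<exists>x y s. ent (val e c) i x \<and> ent (val e c) (i + 1) y \<and>
        enum_at (gr \<epsilon> e) s x \<and> longest (gr \<epsilon> e) s x y))"
  by (auto simp: stage_by_stage_def eval_nat_numeral)

lemma sat_bounded_by:
  "sat e (bounded_by \<epsilon> b) \<longleftrightarrow> (\<forall>\<tau> c l. (\<exists>s. in_st (gr \<epsilon> e) s \<tau>) \<and>
     sat (case_nat l (case_nat c (case_nat \<tau> e))) (stage_by_stage (upE 3 \<epsilon>) (Var 2) (Var 1)) \<and>
     has_len c l \<longrightarrow> l \<le> val e b)"
  by (simp add: bounded_by_def eval_nat_numeral)

lemma sat_finite_tree:
  "sat e (finite_tree \<epsilon>) \<longleftrightarrow>
     (\<exists>v. \<forall>\<tau>. (\<exists>s \<sigma>. in_st (gr \<epsilon> e) s \<sigma> \<and> pre \<tau> \<sigma>) \<longrightarrow> mem \<tau> v)"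
  by (simp add: finite_tree_def in_tree_def eval_nat_numeral)

section \<open>The enumeration of the tree\<close>

context
  fixes m n :: num
begin

lemma in_st_EE: "in_st (EE m n) s x \<longleftrightarrow> InE m n s x"
  unfolding in_st_def using EE_exists EE_mem by blast

lemma enum_at_EE: "enum_at (EE m n) s x \<longleftrightarrow> stg m n x s"
proof
  assume *: "enum_at (EE m n) s x"
  then obtain r where r: "stg m n x r" "r \<le> s" unfolding enum_at_def in_st_EE InE_iff by blast
  have "\<not> r < s"
  proof
    assume "r < s"
    then obtain t where "s = r + t + 1" by (elim num_lessE)
    moreover have "r \<le> r + t" by simp
    then have "InE m n (r + t) x" unfolding InE_iff using r(1) by blast
    ultimately show False using * unfolding enum_at_def in_st_EE by blast
  qed
  then show "stg m n x s" using r by (metis order.order_iff_strict)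
next
  assume *: "stg m n x s"
  have "\<not> (\<exists>t\<le>r. stg m n x t)" if "s = r + 1" for r
  proof
    assume "\<exists>t\<le>r. stg m n x t"
    then have "s \<le> r" using * stg_unique by blast
    then show False using that by simp
  qed
  with * show "enum_at (EE m n) s x"
    unfolding enum_at_def in_st_EE InE_iff by blast
qed

lemma enum_before_EE: "enum_before (EE m n) s x \<longleftrightarrow> (\<exists>r<s. stg m n x r)"
  unfolding enum_before_def enum_at_EE ..

lemma node_pre: "node m n \<tau> \<Longrightarrow> pre \<rho> \<tau> \<Longrightarrow> node m n \<rho>"
proof -
  assume "node m n \<tau>" and pre: "pre \<rho> \<tau>"
  then obtain l where l: "has_len \<tau> l" "l \<le> m + 1"
    "\<forall>i<l. \<exists>j C y. ent \<tau> i (pr j C) \<and> Arg m n \<tau> i y C \<and> j \<le> y" unfolding node_iff by blast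
  obtain k where k: "has_len \<rho> k" using pre pre_sq is_sq_len by blast
  have "k \<le> l" using pre_len[OF pre k l(1)] .
  have "\<exists>j C y. ent \<rho> i (pr j C) \<and> Arg m n \<rho> i y C \<and> j \<le> y" if "i < k" for i
  proof -
    have "i < l" "i \<le> k" using \<open>i < k\<close> \<open>k \<le> l\<close> by auto
    then show ?thesis using l(3) pre_ent'[OF pre k that] Arg_pre[OF pre k] by blast
  qed
  then show ?thesis unfolding node_iff using pre pre_sq k \<open>k \<le> l\<close> l(2) order_trans by blast
qed

text \<open>The longest segment is the parent: it appears strictly earlier by
  \<open>stg_less\<close>, and any other proper initial segment is an initial segment of it.\<close>

lemma longest_EE:
  assumes "stg m n \<tau> s" and "longest (EE m n) s \<tau> \<tau>\<^sub>0"
  shows "\<exists>j C. extendable m n \<tau>\<^sub>0 j C \<and> app \<tau>\<^sub>0 (pr j C) \<tau> \<and> s = pr (\<tau>\<^sub>0 * \<tau>\<^sub>0) C + 1"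
proof -
  obtain r where r: "pre \<tau>\<^sub>0 \<tau>" "stg m n \<tau>\<^sub>0 r" "r < s"
    using assms(2) unfolding longest_def enum_before_EE by blast
  have "\<tau> \<noteq> 0" using r(3) assms(1) app_ne_0 unfolding stg_def by auto
  then obtain \<sigma> j C where \<sigma>: "extendable m n \<sigma> j C" "app \<sigma> (pr j C) \<tau>" "s = pr (\<sigma> * \<sigma>) C + 1"
    using assms(1) unfolding stg_def by blast
  have pre: "pre \<sigma> \<tau>" "\<sigma> \<noteq> \<tau>" using \<sigma>(2) app_less[OF \<sigma>(2)] unfolding app_iff by auto
  obtain q where q: "stg m n \<sigma> q" using \<sigma>(1) node_stg unfolding extendable_iff by blast
  then have "q < s" using stg_less assms(1) pre by blast
  then obtain k l where kl: "has_len \<sigma> k" "has_len \<tau>\<^sub>0 l" "k \<le> l"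
    using assms(2) pre q unfolding longest_def enum_before_EE by blast
  have "\<tau>\<^sub>0 \<noteq> \<tau>" using r(2,3) assms(1) stg_unique by blast
  then have "pre \<tau>\<^sub>0 \<sigma>" using pre_app r(1) \<sigma>(2) by blast
  moreover from this have "l \<le> k" using pre_len kl by blast
  ultimately have "\<tau>\<^sub>0 = \<sigma>" using pre_same_len kl by auto
  then show ?thesis using \<sigma> by blast
qed

lemma square_inj: "x * x = y * y \<Longrightarrow> x = y" for x y :: num
  by (metis linorder_neqE mult_strict_mono' num_zero_le order_less_irrefl)

text \<open>Clause (a): a proper extension of \<open>\<tau>\<^sub>0\<close> passes through a child
  of \<open>\<tau>\<^sub>0\<close>; that child has stage \<open>s\<close>, and what lies above it
  has none earlier. Clause (b): injectivity of \<open>pr\<close> and of squaring recovers the parent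
  from the stage.\<close>

lemma monotone_EE:
  "let G = EE m n in
     (\<forall>s. \<exists>v. G s v \<and> (\<forall>w. G s w \<longrightarrow> w = v)) \<and>
     (\<forall>s x. in_st G s x \<longrightarrow> is_sq x \<and> in_st G (s + 1) x) \<and>
     (\<exists>x. is_sq x \<and> has_len x 0 \<and> enum_at G 0 x) \<and>
     (\<forall>s. \<exists>v. \<forall>x. enum_at G s x \<longrightarrow> mem x v) \<and>
     (\<forall>s \<tau> \<tau>\<^sub>0. enum_at G s \<tau> \<and> longest G s \<tau> \<tau>\<^sub>0 \<longrightarrow>
        \<not> (\<exists>\<rho>. pre \<tau>\<^sub>0 \<rho> \<and> \<rho> \<noteq> \<tau>\<^sub>0 \<and> enum_before G s \<rho>) \<and> (\<forall>\<rho>. enum_at G s \<rho> \<longrightarrow> pre \<tau>\<^sub>0 \<rho>))"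
  unfolding Let_def in_st_EE enum_at_EE enum_before_EE
proof (intro conjI allI impI)
  show "\<exists>v. EE m n s v \<and> (\<forall>w. EE m n s w \<longrightarrow> w = v)" for s
    using EE_exists EE_unique by blast
  show "is_sq x" if "InE m n s x" for s x
    using that stg_node node_sq unfolding InE_iff by blast
  show "InE m n (s + 1) x" if "InE m n s x" for s x
    using that unfolding InE_iff by (meson le_add_same_cancel1 num_zero_le order_trans)
  show "\<exists>x. is_sq x \<and> has_len x 0 \<and> stg m n x 0"
    using is_sq_0 has_len_0 by (auto simp: stg_def)
  show "\<exists>v. \<forall>x. stg m n x s \<longrightarrow> mem x v" for s
    using EE_exists[of m n s] EE_mem unfolding InE_iff by blast
next
  fix s \<tau> \<tau>\<^sub>0 assume *: "stg m n \<tau> s \<and> longest (EE m n) s \<tau> \<tau>\<^sub>0"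
  then obtain j C where \<tau>: "extendable m n \<tau>\<^sub>0 j C" "s = pr (\<tau>\<^sub>0 * \<tau>\<^sub>0) C + 1" using longest_EE by blast
  show "\<not> (\<exists>\<rho>. pre \<tau>\<^sub>0 \<rho> \<and> \<rho> \<noteq> \<tau>\<^sub>0 \<and> (\<exists>r<s. stg m n \<rho> r))"
  proof
    assume "\<exists>\<rho>. pre \<tau>\<^sub>0 \<rho> \<and> \<rho> \<noteq> \<tau>\<^sub>0 \<and> (\<exists>r<s. stg m n \<rho> r)"
    then obtain \<rho> r where \<rho>: "pre \<tau>\<^sub>0 \<rho>" "\<rho> \<noteq> \<tau>\<^sub>0" "r < s" "stg m n \<rho> r" by blast
    obtain k l where kl: "has_len \<tau>\<^sub>0 k" "has_len \<rho> l" using \<rho>(1) pre_sq is_sq_len by meson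
    then have "k \<le> l" "k \<noteq> l" using \<rho> pre_len pre_same_len by blast+
    then have "k < l" by order
    \<comment> \<open>This is the child of \<open>\<tau>\<^sub>0\<close> on the way to
      \<open>\<rho>\<close>.\<close>
    have "\<exists>\<rho>'. pre \<rho>' \<rho> \<and> has_len \<rho>' (k+1)"
    proof (cases "k + 1 = l")
      case True
      then show ?thesis using kl(2) pre_refl pre_sq(2)[OF \<rho>(1)] by blast
    next
      case False
      moreover have "k + 1 \<le> l" using \<open>k < l\<close> by (simp add: num_less_iff)
      ultimately have "k + 1 < l" by order
      then show ?thesis using restrict pre_sq(2)[OF \<rho>(1)] kl(2) by blast
    qed
    then obtain \<rho>' where \<rho>': "pre \<rho>' \<rho>" "has_len \<rho>' (k+1)" by blast
    then obtain q where q: "stg m n \<rho>' q" using node_pre stg_node[OF \<rho>(4)] node_stg by blast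
    obtain \<sigma> u where \<sigma>: "app \<sigma> u \<rho>'" "has_len \<sigma> k" using app_split \<rho>' pre_sq by blast
    have "pre \<sigma> \<rho>" using \<sigma>(1) \<rho>'(1) pre_trans unfolding app_iff by blast
    then have "\<sigma> = \<tau>\<^sub>0" using \<rho>(1) \<sigma>(2) kl(1) pre_linear pre_same_len by blast
    have "\<rho>' \<noteq> 0" using \<sigma>(1) app_ne_0 by blast
    then have "q = s"
      using q \<sigma>(1) \<tau> \<open>\<sigma> = \<tau>\<^sub>0\<close> app_inj extendable_unique unfolding stg_def by metis
    moreover have "q \<le> r"
    proof (cases "\<rho>' = \<rho>")
      case True
      then have "q = r" using q \<rho>(4) stg_unique by blast
      then show ?thesis by simp
    next
      case False
      then show ?thesis using stg_less[OF q \<rho>(4) \<rho>'(1)] by simp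
    qed
    ultimately show False using \<rho>(3) by simp
  qed
  show "pre \<tau>\<^sub>0 \<rho>" if "stg m n \<rho> s" for \<rho>
  proof -
    have "s \<noteq> 0" using \<tau>(2) by simp
    then obtain \<sigma> j' C' where \<sigma>: "app \<sigma> (pr j' C') \<rho>" "s = pr (\<sigma> * \<sigma>) C' + 1"
      using \<open>stg m n \<rho> s\<close> unfolding stg_def by blast
    then have "pr (\<sigma> * \<sigma>) C' = pr (\<tau>\<^sub>0 * \<tau>\<^sub>0) C" using \<tau>(2) by simp
    then have "\<sigma> * \<sigma> = \<tau>\<^sub>0 * \<tau>\<^sub>0" by simp
    then have "\<sigma> = \<tau>\<^sub>0" by (rule square_inj)
    then show ?thesis using \<sigma>(1) unfolding app_iff by blast
  qed
qed

text \<open>Each step passes to the parent and removes one entry, so the length of the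
  \<open>i\<close>-th member of \<open>c\<close> plus \<open>i\<close> remains the length of
  \<open>\<tau>\<close>, at most \<open>m + 1\<close>.\<close>

lemma bounded_EE:
  assumes "InE m n t \<tau>" and c: "has_len c l" "ent c 0 \<tau>"
    and step: "\<And>i. i + 1 < l \<Longrightarrow> \<exists>x y s. ent c i x \<and> ent c (i + 1) y \<and>
       enum_at (EE m n) s x \<and> longest (EE m n) s x y"
  shows "l \<le> m + 2"
proof -
  have \<tau>: "node m n \<tau>" using assms(1) stg_node unfolding InE_iff by blast
  then obtain p where p: "has_len \<tau> p" using node_sq is_sq_len by blast
  let ?P = "\<lambda>i. i < l \<longrightarrow> (\<exists>x<c+1. \<exists>k<x+1. ent c i x \<and> has_len x k \<and> k + i = p)"
  have "?P i" for i
  proof (rule D0_induct[of ?P])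
    show "D0 (\<lambda>e. ?P (e 0))" by (intro D0_intros)
    have "\<tau> < c + 1" "p < \<tau> + 1" using c(2) p has_len_ent_le by blast+
    then show "?P 0" using c(2) p by (intro impI exI[of _ \<tau>] exI[of _ p] conjI) simp_all
    show "?P (i+1)" if IH: "?P i" for i
    proof
      assume i: "i + 1 < l"
      then obtain x y s where xy: "ent c i x" "ent c (i+1) y" "stg m n x s" "longest (EE m n) s x y"
        using step unfolding enum_at_EE by blast
      have "i < i + 1" by simp
      then have "i < l" using i by order
      then obtain k where k: "has_len x k" "k + i = p" using IH xy(1) ent_unique by blast
      obtain u where "app y u x" using longest_EE xy by blast
      then obtain j where j: "has_len y j" "k = j + 1" using k(1) has_len_unique unfolding app_iff by blast
      then have "j + (i + 1) = p" using k(2) by (simp add: add_ac)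
      then show "\<exists>x<c+1. \<exists>k<x+1. ent c (i+1) x \<and> has_len x k \<and> k + (i+1) = p"
        using xy(2) j(1) has_len_ent_le by blast
    qed
  qed
  \<comment> \<open>The length is positive, as there is an entry with index 0; the invariant is read
    at the last index.\<close>
  moreover obtain i where i: "l = i + 1"
    using c ent_index_less num_cases num_not_less_0 by metis
  ultimately obtain k where "k + i = p" by auto
  then have "i \<le> p" by auto
  also have "p \<le> m + 1" using node_len \<tau> p by blast
  finally show ?thesis unfolding i one_add_one[symmetric] add.assoc[symmetric] by simp
qed

section \<open>From a bound on the tree to a value of the function\<close>

section \<open>A bound on the tree makes the Ackermann function defined\<close>

context
  fixes F :: num
  assumes F: "\<And>\<tau>. node m n \<tau> \<Longrightarrow> \<tau> \<le> F"
begin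

text \<open>The bound on \<open>y\<close> follows from that on \<open>C\<close> by
  \<open>LW_le\<close>, so it excludes nothing; it serves to make the predicate Delta_0.\<close>

definition DD :: "num \<Rightarrow> num \<Rightarrow> bool"
  where "DD x j \<longleftrightarrow> (\<exists>y<F+2. \<exists>C<F+1. LW x j y C)"

lemma D0_DD [D0_intros]: "Tm f \<Longrightarrow> Tm g \<Longrightarrow> D0 (\<lambda>e. DD (f e) (g e))"
  by (rule D0_comp2[of DD]) (unfold DD_def, intro D0_intros)

lemma DD_0: "DD x 0"
proof -
  have "1 < F + 2" unfolding one_add_one[symmetric] add.assoc[symmetric] by simp
  moreover have "0 < F + 1" by simp
  ultimately show ?thesis unfolding DD_def using LW_0 by blast
qed

lemma extendable_le: "extendable m n \<sigma> j C \<Longrightarrow> pr j C < F + 1"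
proof -
  assume *: "extendable m n \<sigma> j C"
  then obtain \<tau> where \<tau>: "app \<sigma> (pr j C) \<tau>" using app_exists node_sq unfolding extendable_iff by blast
  then have "\<tau> \<le> F" using * node_app F by blast
  then show ?thesis using app_less[OF \<tau>] by auto
qed

text \<open>Maximality is recorded only as failure of the next index \<open>j + 1\<close>, a local
  condition that can be checked level by level.\<close>

definition maximal_at :: "num \<Rightarrow> num \<Rightarrow> bool" where
  "maximal_at \<sigma> k \<longleftrightarrow> (\<exists>j<F+1. \<exists>C<F+1. \<exists>y<n+F+2. \<exists>x<m+1.
     ent \<sigma> k (pr j C) \<and> Arg m n \<sigma> k y C \<and> j \<le> y \<and> k + x = m \<and> (j < y \<longrightarrow> \<not> DD x (j + 1)))"

lemma D0_maximal_at [D0_intros]: "Tm f \<Longrightarrow> Tm g \<Longrightarrow> D0 (\<lambda>e. maximal_at (f e) (g e))"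
  by (rule D0_comp2[of maximal_at]) (unfold maximal_at_def, intro D0_intros D0_Arg)

lemma maximal_path:
  "i \<le> m \<Longrightarrow> \<exists>\<sigma>. node m n \<sigma> \<and> has_len \<sigma> i \<and> (\<exists>y C. Arg m n \<sigma> i y C) \<and> (\<forall>k<i. maximal_at \<sigma> k)"
proof -
  let ?P = "\<lambda>i. i \<le> m \<longrightarrow> (\<exists>\<sigma><F+1. node m n \<sigma> \<and> has_len \<sigma> i \<and>
     (\<exists>y<n+F+2. \<exists>C<F+1. Arg m n \<sigma> i y C) \<and> (\<forall>k<i. maximal_at \<sigma> k))"
  have "?P i"
  proof (rule D0_induct[of ?P])
    show "D0 (\<lambda>e. ?P (e 0))" by (intro D0_intros)
    have "n < n + F + 2" by (simp add: add.assoc add_nonneg_pos)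
    then show "?P 0" using node_0 has_len_0 by (auto simp: Arg_0 intro!: exI[of _ 0])
    show "?P (i+1)" if IH: "?P i" for i
    proof
      assume "i + 1 \<le> m"
      then obtain x' where "m = i + (x' + 1)" by (auto simp: num_le add_ac)
      then obtain x where x: "i + x = m" by metis
      then have "i \<le> m" by auto
      then obtain \<sigma> y C where \<sigma>: "node m n \<sigma>" "has_len \<sigma> i" "Arg m n \<sigma> i y C" "\<forall>k<i. maximal_at \<sigma> k"
        using IH by blast
      \<comment> \<open>The greatest such index exists: index 0 qualifies by \<open>DD_0\<close>,
        and \<open>y\<close> is an upper bound.\<close>
      have "D0 (\<lambda>e. e 0 \<le> y \<and> DD x (e 0))" by (intro D0_intros)
      then obtain j where j: "j \<le> y" "DD x j" "\<And>z. z \<le> y \<Longrightarrow> DD x z \<Longrightarrow> z \<le> j"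
        using D0_greatest[of "\<lambda>j. j \<le> y \<and> DD x j" 0 y] DD_0 by auto
      have ext: "extendable m n \<sigma> j C" unfolding extendable_iff using \<sigma> j(1) \<open>i \<le> m\<close> by blast
      obtain \<tau> where \<tau>: "app \<sigma> (pr j C) \<tau>" using app_exists node_sq \<sigma>(1) by blast
      then have pre: "pre \<sigma> \<tau>" "has_len \<tau> (i+1)" "ent \<tau> i (pr j C)"
        using \<sigma>(2) has_len_unique unfolding app_iff by blast+
      have node: "node m n \<tau>" using node_app ext \<tau> by blast
      have lt: "j < F + 1" "C < F + 1" using extendable_le[OF ext] pr_ge(1)[of j C] pr_ge(2)[of C j] by auto
      obtain y' C' where y': "y' < F + 2" "C' < F + 1" "LW x j y' C'" using j(2) unfolding DD_def by blast
      then have "Arg m n \<tau> (i+1) y' C'" unfolding Arg_Suc using x pre(3) by blast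
      moreover have "F + 2 \<le> n + F + 2" by simp
      then have "y' < n + F + 2" using y'(1) by order
      moreover have "maximal_at \<tau> k" if "k < i + 1" for k
        using that
      proof (rule num_less_cases)
        assume "k < i"
        then have "maximal_at \<sigma> k" "k \<le> i" using \<sigma>(4) by auto
        then obtain j C y x where *: "j < F + 1" "C < F + 1" "y < n + F + 2" "x < m + 1" "ent \<sigma> k (pr j C)"
          "Arg m n \<sigma> k y C" "j \<le> y" "k + x = m" "j < y \<longrightarrow> \<not> DD x (j + 1)"
          unfolding maximal_at_def by blast
        have "ent \<tau> k (pr j C)" "Arg m n \<tau> k y C"
          using *(5,6) pre_ent[OF pre(1)] Arg_pre[OF pre(1) \<sigma>(2) \<open>k \<le> i\<close>] by blast+
        with * show ?thesis unfolding maximal_at_def by blast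
      next
        assume "k = i"
        have "Arg m n \<tau> i y C" using \<sigma>(3) Arg_pre[OF pre(1) \<sigma>(2)] by blast
        moreover have "y < n + C + 2" using Arg_le \<sigma>(3) by blast
        moreover have "n + C + 2 \<le> n + F + 2" using lt(2) by simp
        moreover have "x < m + 1" using x by auto
        moreover have "\<not> DD x (j + 1)" if "j < y"
          using j(3)[of "j+1"] that by (auto simp: num_less_iff)
        moreover from calculation(2,3) have "y < n + F + 2" by order
        ultimately show ?thesis unfolding maximal_at_def \<open>k = i\<close> using pre(3) j(1) x lt by blast
      qed
      ultimately show "\<exists>\<sigma><F+1. node m n \<sigma> \<and> has_len \<sigma> (i+1) \<and>
          (\<exists>y<n+F+2. \<exists>C<F+1. Arg m n \<sigma> (i+1) y C) \<and> (\<forall>k<i+1. maximal_at \<sigma> k)"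
        using node F[OF node] pre(2) y'(2) by auto
    qed
  qed
  then show "i \<le> m \<Longrightarrow> ?thesis" by blast
qed

lemma ack_defined: "\<exists>z. ack m n z"
proof -
  obtain \<sigma> y\<^sub>0 C\<^sub>0 where \<sigma>: "node m n \<sigma>" "has_len \<sigma> m" "Arg m n \<sigma> m y\<^sub>0 C\<^sub>0" "\<And>k. k < m \<Longrightarrow> maximal_at \<sigma> k"
    using maximal_path[of m] by blast
  \<comment> \<open>Here \<open>t\<close> is the first argument of the call on level
    \<open>i\<close>. The value and its computation are quantified explicitly, which exhibits the
    statement as Sigma_1.\<close>
  let ?P = "\<lambda>t. t \<le> m \<longrightarrow> (\<exists>i y C z c. i + t = m \<and> Arg m n \<sigma> i y C \<and> comp_of c t y z)"
  have "?P t" for t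
  proof (rule S1_induct[of ?P])
    have "S1 (\<lambda>e. \<exists>i y C z c. e 0 \<le> m \<longrightarrow> i + e 0 = m \<and> Arg m n \<sigma> i y C \<and> comp_of c (e 0) y z)"
      by (intro S1_ex S1_D0 D0_intros)
    then show "S1 (\<lambda>e. ?P (e 0))" by simp
    have "m + 0 = m" by simp
    then show "?P 0" using \<sigma>(3) ack_0 unfolding ack_def by blast
    show "?P (t+1)" if IH: "?P t" for t
    proof
      assume "t + 1 \<le> m"
      then obtain k where k: "k + (t + 1) = m" by (auto simp: num_le add_ac)
      have "t \<le> t + 1" by simp
      then have "t \<le> m" using \<open>t + 1 \<le> m\<close> by order
      then obtain i y C z where i: "i + t = m" "Arg m n \<sigma> i y C" "ack t y z"
        using IH unfolding ack_def by blast
      have "(k + 1) + t = i + t" using k i(1) by (simp add: add_ac)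
      then have "i = k + 1" by (rule add_right_imp_eq[symmetric])
      then obtain x j D where x: "k + x = m" "ent \<sigma> k (pr j D)" "LW x j y C"
        using i(2) unfolding \<open>i = k + 1\<close> Arg_Suc by blast
      have "x = t + 1" using k x(1) by (metis add_left_imp_eq)
      have "k < m" unfolding k[symmetric] by simp
      then have "maximal_at \<sigma> k" by (rule \<sigma>(4))
      then obtain j' D' y' x' where y': "ent \<sigma> k (pr j' D')" "Arg m n \<sigma> k y' D'" "j' \<le> y'"
        "k + x' = m" "j' < y' \<longrightarrow> \<not> DD x' (j' + 1)" unfolding maximal_at_def by blast
      have "pr j' D' = pr j D" using y'(1) x(2) ent_unique by blast
      then have eq: "j' = j" "D' = D" by simp_all
      have "x' = x" using y'(4) x(1) by (metis add_left_imp_eq)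
      \<comment> \<open>The argument \<open>y\<close> is \<open>A(t + 1, j - 1)\<close>, or 1 if
        \<open>j = 0\<close>; by the matching recursion equation \<open>A(t, y)\<close> is
        \<open>A(t + 1, j)\<close>.\<close>
      have ack: "ack (t + 1) j z"
      proof (cases j rule: num_cases)
        case 1
        then show ?thesis using x(3) i(3) ack_Suc_0 by (auto simp: LW_def)
      next
        case (2 l)
        have "ack (t + 1) l y" using x(3) unfolding 2 \<open>x = t + 1\<close> by (rule LW_ack)
        then show ?thesis using i(3) unfolding 2 by (rule ack_Suc_Suc)
      qed
      have "j = y'"
      proof (rule ccontr)
        assume "j \<noteq> y'"
        then have "j < y'" using y'(3) eq by simp
        then have "\<not> DD (t + 1) (j + 1)" using y'(5) eq \<open>x' = x\<close> \<open>x = t + 1\<close> by simp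
        \<comment> \<open>The value \<open>A(t + 1, j)\<close> is just what the sibling with index
          \<open>j + 1\<close> passes down as an argument.\<close>
        obtain z' C' where z': "LW (t + 1) (j + 1) z' C'" using ack ack_LW by blast
        obtain \<rho> where \<rho>: "pre \<rho> \<sigma>" "has_len \<rho> k" using restrict node_sq \<sigma>(1,2) \<open>k < m\<close> by blast
        have "Arg m n \<rho> k y' D" using y'(2) Arg_pre[OF \<rho> order_refl] eq by blast
        moreover have "node m n \<rho>" using node_pre \<sigma>(1) \<rho>(1) by blast
        moreover have "k \<le> m" "j + 1 \<le> y'" using \<open>k < m\<close> \<open>j < y'\<close> by (auto simp: num_less_iff[of j])
        ultimately have "extendable m n \<rho> (j + 1) D" unfolding extendable_iff using \<rho>(2) by blast
        moreover obtain \<sigma>' where \<sigma>': "app \<rho> (pr (j + 1) D) \<sigma>'" using app_exists \<rho>(1) pre_sq by blast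
        ultimately have "node m n \<sigma>'" using node_app by blast
        moreover have len: "has_len \<sigma>' (k + 1)" "ent \<sigma>' k (pr (j + 1) D)"
          using \<sigma>' \<rho>(2) has_len_unique unfolding app_iff by blast+
        then have "Arg m n \<sigma>' (k + 1) z' C'" unfolding Arg_Suc using k z' by blast
        moreover have "k + 1 \<le> m" using \<open>k < m\<close> by (simp add: num_less_iff)
        \<comment> \<open>Index 0 is always admissible, so the sibling \<open>\<sigma>'\<close> has
          a child, and the code of that child bounds \<open>C'\<close>.\<close>
        ultimately have "extendable m n \<sigma>' 0 C'" unfolding extendable_iff using len(1) num_zero_le by blast
        then have "C' < F + 1" using extendable_le[of \<sigma>' 0 C'] pr_ge(2)[of C' 0] by simp
        moreover have "z' < F + 2"
        proof -
          have "z' < C' + 2" using LW_le z' by blast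
          also have "C' + 2 \<le> F + 2" using \<open>C' < F + 1\<close> by simp
          finally show ?thesis .
        qed
        ultimately show False using z' \<open>\<not> DD (t + 1) (j + 1)\<close> unfolding DD_def by blast
      qed
      then show "\<exists>i y C z c. i + (t + 1) = m \<and> Arg m n \<sigma> i y C \<and> comp_of c (t + 1) y z"
        using k y'(2) ack eq unfolding ack_def by blast
    qed
  qed
  from this[of m] obtain i y C z where "i + m = m" "Arg m n \<sigma> i y C" "ack m y z"
    unfolding ack_def by blast
  \<comment> \<open>For \<open>t = m\<close> the level \<open>i\<close> is 0, where the argument is
    \<open>n\<close>.\<close>
  then show ?thesis by (auto simp: Arg_0)
qed

end

end

section \<open>The theorem\<close>

text \<open>Brings the formula into the shape required by \<open>BME_star\<close>:
  \<open>Var 0\<close> and \<open>Var 1\<close> are stage and value, and the constants become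
  parameters held by \<open>e\<close>. Further entries of the environment are irrelevant and set to
  0.\<close>

lemma EE_formula: "\<exists>\<epsilon> e. delta0 \<epsilon> \<and> gr \<epsilon> e = EE m n"
proof -
  have "D0 (\<lambda>e. EE m n (e 0) (e 1))" by (intro D0_intros)
  then obtain \<phi> h where \<phi>: "delta0 \<phi>" "\<And>e. EE m n (e 0) (e 1) \<longleftrightarrow> sat (fill h e) \<phi>"
    using D0_rep[of "\<lambda>e. EE m n (e 0) (e 1)"] by auto
  let ?t = "\<lambda>k. case h k of Inl i \<Rightarrow> (if i < 2 then Var i else Var (k + 2)) | Inr a \<Rightarrow> Var (k + 2)"
  let ?e = "\<lambda>k. case h k of Inl i \<Rightarrow> 0 | Inr a \<Rightarrow> a"
  have "(\<lambda>k. val (case_nat s (case_nat v ?e)) (?t k)) = fill h (case_nat s (case_nat v (\<lambda>_. 0)))" for s v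
    by (auto simp: fun_eq_iff less_2_cases_iff split: sum.split nat.split)
  then have "gr (subst \<phi> ?t) ?e s v \<longleftrightarrow> EE m n s v" for s v
    using \<phi>(2)[of "case_nat s (case_nat v (\<lambda>_. 0))"] by (simp add: gr_def sat_subst)
  then show ?thesis using delta0_subst[OF \<phi>(1)] by (intro exI[of _ "subst \<phi> ?t"] exI[of _ ?e]) auto
qed

lemma ack_total:
  assumes "models \<MM> BME_star"
  shows "\<exists>z. ack m n z"
proof -
  obtain \<epsilon> e where \<epsilon>: "delta0 \<epsilon>" "gr \<epsilon> e = EE m n" using EE_formula by blast
  let ?\<psi> = "monotone_enumeration (upE 1 \<epsilon>) \<^bold>\<and> bounded_by (upE 1 \<epsilon>) (Var 0) \<^bold>\<rightarrow> finite_tree (upE 1 \<epsilon>)"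
  have "\<forall>e. sat e (univ_closure (Forall ?\<psi>))"
    using assms \<epsilon>(1) unfolding models_def BME_star_def by blast
  then have "sat e (Forall ?\<psi>)" unfolding sat_univ_closure ..
  \<comment> \<open>The bound \<open>b\<close> is \<open>m + 2\<close>, one more than the greatest
    length of a node.\<close>
  then have "sat (case_nat (m + 2) e) ?\<psi>" by simp
  moreover have gr: "gr (upE 1 \<epsilon>) (case_nat (m + 2) e) = EE m n" using \<epsilon>(2) by simp
  moreover have "sat (case_nat (m + 2) e) (monotone_enumeration (upE 1 \<epsilon>))"
    unfolding sat_monotone_enumeration gr by (rule monotone_EE)
  moreover have "sat (case_nat (m + 2) e) (bounded_by (upE 1 \<epsilon>) (Var 0))"
    unfolding sat_bounded_by gr in_st_EE
  proof (intro allI impI, elim conjE exE)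
    fix \<tau> c l s
    let ?e = "case_nat l (case_nat c (case_nat \<tau> (case_nat (m + 2) e)))"
    assume 1: "InE m n s \<tau>" "has_len c l" and 2: "sat ?e (stage_by_stage (upE 3 (upE 1 \<epsilon>)) (Var 2) (Var 1))"
    have "gr (upE 3 (upE 1 \<epsilon>)) ?e = EE m n" using \<epsilon>(2) by (simp add: eval_nat_numeral)
    from sat_stage_by_stage[OF 2, unfolded this] obtain l' where l': "has_len c l'" "ent c 0 \<tau>"
      "\<And>i. i + 1 < l' \<Longrightarrow> \<exists>x y s. ent c i x \<and> ent c (i + 1) y \<and>
         enum_at (EE m n) s x \<and> longest (EE m n) s x y"
      by (auto simp: eval_nat_numeral simp del: num_less_add1)
    have "l' \<le> m + 2" using 1(1) l' by (rule bounded_EE)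
    then show "l \<le> val (case_nat (m + 2) e) (Var 0)" using has_len_unique[OF 1(2) l'(1)] by simp
  qed
  ultimately have "sat (case_nat (m + 2) e) (finite_tree (upE 1 \<epsilon>))" by simp
  then obtain F where F: "\<And>s \<tau>. InE m n s \<tau> \<Longrightarrow> pre \<tau> \<tau> \<Longrightarrow> mem \<tau> F"
    unfolding sat_finite_tree gr in_st_EE by blast
  have "\<tau> \<le> F" if "node m n \<tau>" for \<tau>
  proof -
    have "mem \<tau> F" using F node_stg[OF that] pre_refl[OF node_sq[OF that]] unfolding InE_iff by blast
    then show ?thesis using mem_le by fastforce
  qed
  then show ?thesis by (rule ack_defined)
qed

theorem theorem3p2:
  shows "ISigma1 \<union> BME_star \<turnstile> Forall (Forall (Exists (ackermann_graph (Var 2) (Var 1) (Var 0))))"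
proof (rule ccontr)
  assume *: "\<not> ?thesis"
  have "fv_bound \<psi> = 0" if "\<psi> \<in> ISigma1 \<union> BME_star" for \<psi>
    using that by (auto simp: ISigma1_def BME_star_def PA_basic_def Neg_def Iff_def Conj_def Exists_def)
  moreover have "PA_basic \<subseteq> ISigma1 \<union> BME_star" by (auto simp: ISigma1_def)
  ultimately obtain S :: "num struct" and e where "models S (ISigma1 \<union> BME_star)" "\<not> sat_in S e totality"
    using completeness[OF _ _ * bij_Abs_num] unfolding totality_def by metis
  \<comment> \<open>A countermodel exists, so the model chosen for the type is itself one.\<close>
  then obtain e where "models \<MM> BME_star" "\<not> sat e totality" using \<MM>(2) by blast
  then show False using ack_total by (auto simp: totality_def eval_nat_numeral)
qed

end
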